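(* For every graph $F$ (with at least one edge), either there is an integer $r \geq 1$ and, for each residue class $C$ modulo $r$, an integer $k_C$ such that $$ sat(n,F)= \frac{(r-1)n+k_C}{r} $$ for every residue class $C$ modulo $r$ and all large enough $n \in C$, or $$ sat(n,F) \geq n+o(n). $$ The former occurs if and only if there is a tree $T$ such that every graph $T+e$ obtained by adding a new edge $e$ to $T$, and every graph $2T+e$ obtained from the disjoint union $2T$ of two copies of $T$ by adding an edge $e$ between the two copies, contains a connected component of $F$ that is not contained in $T$; and in that case $r$ is the minimum number of vertices of such a tree.
   Context: All graphs are finite and simple; "contains" means contains as a (not necessarily induced) subgraph. A graph $G$ is $F$-saturated if $G$ does not contain $F$ but adding any new edge to $G$ yields a graph containing $F$; $sat(n,F)$ is the minimum number of edges of an $F$-saturated graph on $n$ vertices. *)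

theory Defs
  imports Complex_Main "HOL-Library.Landau_Symbols"
begin

datatype 'a sgraph = SGraph (verts: "'a set") (edges: "'a set set")

definition vpairs :: "'a set \<Rightarrow> 'a set set" where
  "vpairs V = {e. e \<subseteq> V \<and> card e = 2}"

definition simple_graph :: "'a sgraph \<Rightarrow> bool" where
  "simple_graph G \<longleftrightarrow> finite (verts G) \<and> edges G \<subseteq> vpairs (verts G)"

definition contains :: "'b sgraph \<Rightarrow> 'a sgraph \<Rightarrow> bool" where
  "contains G F \<longleftrightarrow>
     (\<exists>f. inj_on f (verts F) \<and> f ` verts F \<subseteq> verts G \<and> (\<forall>e\<in>edges F. f ` e \<in> edges G))"

definition non_edges :: "'a sgraph \<Rightarrow> 'a set set" where
  "non_edges G = vpairs (verts G) - edges G"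

definition add_edge :: "'a sgraph \<Rightarrow> 'a set \<Rightarrow> 'a sgraph" where
  "add_edge G e = SGraph (verts G) (insert e (edges G))"

definition adj :: "'a sgraph \<Rightarrow> 'a \<Rightarrow> 'a \<Rightarrow> bool" where
  "adj G u v \<longleftrightarrow> {u, v} \<in> edges G"

definition connected_graph :: "'a sgraph \<Rightarrow> bool" where
  "connected_graph G \<longleftrightarrow> verts G \<noteq> {} \<and> (\<forall>u\<in>verts G. \<forall>v\<in>verts G. (adj G)\<^sup>*\<^sup>* u v)"

definition induced_subgraph :: "'a sgraph \<Rightarrow> 'a set \<Rightarrow> 'a sgraph" where
  "induced_subgraph G W = SGraph W {e \<in> edges G. e \<subseteq> W}"

definition components_of :: "'a sgraph \<Rightarrow> 'a sgraph set" where
  "components_of G = {induced_subgraph G {u. (adj G)\<^sup>*\<^sup>* v u} | v. v \<in> verts G}"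

definition is_cycle :: "'a sgraph \<Rightarrow> 'a list \<Rightarrow> bool" where
  "is_cycle G xs \<longleftrightarrow> length xs \<ge> 3 \<and> distinct xs \<and>
     (\<forall>i<length xs. adj G (xs ! i) (xs ! (Suc i mod length xs)))"

definition is_tree :: "'a sgraph \<Rightarrow> bool" where
  "is_tree T \<longleftrightarrow> simple_graph T \<and> connected_graph T \<and> (\<nexists>xs. is_cycle T xs)"

definition double :: "'a sgraph \<Rightarrow> ('a + 'a) sgraph" where
  "double T = SGraph (verts T <+> verts T) ((`) Inl ` edges T \<union> (`) Inr ` edges T)"

definition saturated :: "'a sgraph \<Rightarrow> 'b sgraph \<Rightarrow> bool" where
  "saturated F G \<longleftrightarrow> simple_graph G \<and> \<not> contains G F \<and>
     (\<forall>e\<in>non_edges G. contains (add_edge G e) F)"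

text \<open>Every finite graph is isomorphic to one with natural-number vertices.  If \<open>F\<close> has an edge,
  then the edgeless graph on \<open>n\<close> vertices does not contain \<open>F\<close>, so a maximal \<open>F\<close>-free graph exists
  and the minimum is attained for every \<open>n\<close>.\<close>

definition sat :: "nat \<Rightarrow> 'a sgraph \<Rightarrow> nat" where
  "sat n F = (LEAST m. \<exists>G :: nat sgraph. saturated F G \<and> card (verts G) = n \<and> card (edges G) = m)"

definition sat_eventually_linear :: "'a sgraph \<Rightarrow> nat \<Rightarrow> bool" where
  "sat_eventually_linear F r \<longleftrightarrow>
     (\<exists>k :: nat \<Rightarrow> int. \<forall>c<r. \<exists>N. \<forall>n\<ge>N. n mod r = c \<longrightarrow>
        real (sat n F) = ((real r - 1) * real n + real_of_int (k c)) / real r)"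

definition sat_at_least_n :: "'a sgraph \<Rightarrow> bool" where
  "sat_at_least_n F \<longleftrightarrow>
     (\<exists>g :: nat \<Rightarrow> real. g \<in> o(\<lambda>n. real n) \<and> (\<forall>n. real (sat n F) \<ge> real n + g n))"

definition contains_new_component :: "'b sgraph \<Rightarrow> 'a sgraph \<Rightarrow> 'c sgraph \<Rightarrow> bool" where
  "contains_new_component G F T \<longleftrightarrow> (\<exists>K\<in>components_of F. contains G K \<and> \<not> contains T K)"

definition good_tree :: "'a sgraph \<Rightarrow> 'b sgraph \<Rightarrow> bool" where
  "good_tree F T \<longleftrightarrow> is_tree T \<and>
     (\<forall>e\<in>non_edges T. contains_new_component (add_edge T e) F T) \<and>
     (\<forall>u\<in>verts T. \<forall>v\<in>verts T. contains_new_component (add_edge (double T) {Inl u, Inr v}) F T)"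

end

theory Submission
  imports Defs
begin

text \<open>Lower bound: a graph with \<open>n\<close> vertices and \<open>t\<close> components that are trees has at least \<open>n - t\<close>
  edges. If an \<open>F\<close>-saturated graph has many components isomorphic to one tree \<open>T\<close>, then \<open>T\<close> is good:
  in the copy of \<open>F\<close> created by a new edge inside these components, the component of \<open>F\<close> using that
  edge cannot embed into \<open>T\<close>, since it could then be moved to an unused copy of \<open>T\<close>. As there
  are finitely many trees of each size, only trees of at least \<open>r\<close> vertices occur often.

  Upper bound: adding one more copy of \<open>T\<close> to a saturated graph with many such components keeps it
  saturated, so along each residue class \<open>r * sat n F - (r - 1) * n\<close> is eventually nonincreasing,
  hence constant, once every residue class contains a saturated graph with many copies of \<open>T\<close>.
  Only the part \<open>F'\<close> of \<open>F\<close> made of components that do not embed into \<open>T\<close> matters. If one of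
  these components is a star, a clique on \<open>card F' - 1\<close> vertices with isolated vertices and copies
  of \<open>T\<close> can be saturated while touching boundedly many copies. Otherwise take a clique with one
  vertex less than the number of vertices of degree at least 2 in \<open>F'\<close>, and hang many leaves at each
  clique vertex: \<open>F'\<close> does not fit, any edge to a copy of \<open>T\<close> makes it fit, and the number of leaves,
  being arbitrary, gives all residue classes.\<close>

subsection \<open>Embeddings and components\<close>

text \<open>The obstacle in the upper bound: saturated graphs are obtained by maximally extending an
  \<open>F\<close>-free host, which adds unknown edges, and enough copies of \<open>T\<close> must
  survive as whole components. Goodness of \<open>T\<close> takes care of edges inside or between
  copies: such an edge creates a component of \<open>F'\<close>, and the host is chosen so that the
  rest of \<open>F'\<close> fits into its core. Edges from the core to a copy need a separate
  argument, and this is where stars differ. If no component of \<open>F'\<close> is a star, each has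
  two vertices of degree at least 2, and a single such edge relieves the clique. A star centred at
  an isolated host vertex needs one touched copy for each leaf, so some copies are lost.
  Monotonicity along a residue class starts from an optimal graph, whose frequent tree component may
  be a good tree other than \<open>T\<close>; only its number \<open>r\<close> of vertices enters.
  It exists because a graph with about (1 - 1/r) n edges is too sparse for almost all tree
  components to have more than \<open>r\<close> vertices, which would force about (1 - 1/(r+1)) n
  edges.\<close>

definition emb :: "('a \<Rightarrow> 'b) \<Rightarrow> 'a sgraph \<Rightarrow> 'b sgraph \<Rightarrow> bool" where
  "emb f F G \<longleftrightarrow> inj_on f (verts F) \<and> f ` verts F \<subseteq> verts G \<and> (\<forall>e\<in>edges F. f ` e \<in> edges G)"

lemma contains_iff_emb: "contains G F \<longleftrightarrow> (\<exists>f. emb f F G)"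
  by (simp add: contains_def emb_def)

lemma emb_comp: "emb f F G \<Longrightarrow> emb g G H \<Longrightarrow> emb (g \<circ> f) F H"
  unfolding emb_def by (metis comp_inj_on image_comp image_mono inj_on_subset subset_trans)

lemma contains_trans: "contains G F \<Longrightarrow> emb g G H \<Longrightarrow> contains H F"
  unfolding contains_iff_emb using emb_comp by blast

lemma adj_sym: "adj G u v \<Longrightarrow> adj G v u"
  by (simp add: adj_def insert_commute)

lemma simple_edgeE:
  assumes "simple_graph G" "e \<in> edges G"
  obtains u v where "e = {u, v}" "u \<noteq> v" "u \<in> verts G" "v \<in> verts G" "adj G u v"
proof -
  have "e \<subseteq> verts G" "card e = 2" using assms by (auto simp: simple_graph_def vpairs_def)
  then obtain u v where "e = {u, v}" "u \<noteq> v" by (auto simp: card_2_iff)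
  with assms \<open>e \<subseteq> verts G\<close> show ?thesis by (intro that[of u v]) (auto simp: adj_def)
qed

lemma simple_adjD:
  assumes "simple_graph G" "adj G u v"
  shows "u \<in> verts G" "v \<in> verts G" "u \<noteq> v"
proof -
  have "{u, v} \<subseteq> verts G" "card {u, v} = 2"
    using assms by (auto simp: simple_graph_def vpairs_def adj_def)
  then show "u \<in> verts G" "v \<in> verts G" "u \<noteq> v" by auto
qed

lemma embI:
  assumes "simple_graph F" "inj_on f (verts F)" "f ` verts F \<subseteq> verts G"
    and "\<And>u v. adj F u v \<Longrightarrow> adj G (f u) (f v)"
  shows "emb f F G"
  unfolding emb_def
proof (intro conjI ballI)
  fix e assume "e \<in> edges F"
  with assms(1) obtain u v where "e = {u, v}" "adj F u v" by (rule simple_edgeE)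
  with assms(4)[of u v] show "f ` e \<in> edges G" by (simp add: adj_def)
qed (use assms in auto)

lemma emb_adj: "emb f F G \<Longrightarrow> adj F u v \<Longrightarrow> adj G (f u) (f v)"
  unfolding emb_def adj_def by force

lemma adj_add_edge: "adj (add_edge G e) u v \<longleftrightarrow> adj G u v \<or> {u, v} = e"
  by (auto simp: adj_def add_edge_def)

lemma verts_add_edge [simp]: "verts (add_edge G e) = verts G"
  by (simp add: add_edge_def)

lemma emb_add_edge: "emb f F G \<Longrightarrow> emb f (add_edge F e) (add_edge G (f ` e))"
  by (auto simp: emb_def add_edge_def)

lemma simple_induced: "simple_graph G \<Longrightarrow> W \<subseteq> verts G \<Longrightarrow> simple_graph (induced_subgraph G W)"
  by (auto simp: simple_graph_def induced_subgraph_def vpairs_def intro: finite_subset)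

lemma adj_induced: "adj (induced_subgraph G W) u v \<longleftrightarrow> adj G u v \<and> u \<in> W \<and> v \<in> W"
  by (auto simp: adj_def induced_subgraph_def)

lemma verts_induced [simp]: "verts (induced_subgraph G W) = W"
  by (simp add: induced_subgraph_def)

lemma simple_finite: "simple_graph G \<Longrightarrow> finite (verts G)" "simple_graph G \<Longrightarrow> finite (edges G)"
  by (auto simp: simple_graph_def vpairs_def intro: finite_subset[of _ "Pow (verts G)"])

definition cset :: "'a sgraph \<Rightarrow> 'a \<Rightarrow> 'a set" where
  "cset G v = {u. (adj G)\<^sup>*\<^sup>* v u}"

definition comp_at :: "'a sgraph \<Rightarrow> 'a \<Rightarrow> 'a sgraph" where
  "comp_at G v = induced_subgraph G (cset G v)"

lemma components_of_eq: "components_of G = comp_at G ` verts G"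
  by (auto simp: components_of_def comp_at_def cset_def)

lemma verts_comp_at [simp]: "verts (comp_at G v) = cset G v"
  by (simp add: comp_at_def)

lemma cset_refl [simp]: "v \<in> cset G v" by (simp add: cset_def)

lemma rtranclp_adj_sym: "(adj G)\<^sup>*\<^sup>* u v \<Longrightarrow> (adj G)\<^sup>*\<^sup>* v u"
  by (rule sympD[OF symp_rtranclp]) (auto intro: sympI adj_sym)

lemma cset_eq: "u \<in> cset G v \<Longrightarrow> cset G u = cset G v"
  unfolding cset_def by (auto intro: rtranclp_trans rtranclp_adj_sym)

lemma comp_at_eq: "u \<in> cset G v \<Longrightarrow> comp_at G u = comp_at G v"
  by (simp add: comp_at_def cset_eq)

lemma cset_adj: "u \<in> cset G v \<Longrightarrow> adj G u w \<Longrightarrow> w \<in> cset G v"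
  unfolding cset_def by (auto intro: rtranclp.rtrancl_into_rtrancl)

lemma adj_cset: "adj G u w \<Longrightarrow> w \<in> cset G u"
  using cset_adj[of u G u w] by simp

lemma cset_disjoint: "cset G u \<inter> cset G v \<noteq> {} \<Longrightarrow> cset G u = cset G v"
  using cset_eq by (metis disjoint_iff)

lemma cset_induct [consumes 1, case_names base step]:
  assumes "u \<in> cset G v" "P v" "\<And>x y. x \<in> cset G v \<Longrightarrow> P x \<Longrightarrow> adj G x y \<Longrightarrow> P y"
  shows "P u"
proof -
  have "(adj G)\<^sup>*\<^sup>* v u" using assms(1) by (simp add: cset_def)
  then show ?thesis
  proof (induction rule: rtranclp_induct)
    case (step x y)
    from step(1) have "x \<in> cset G v" by (simp add: cset_def)
    from assms(3)[OF this step(3,2)] show ?case .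
  qed (rule assms(2))
qed

lemma cset_subset: "simple_graph G \<Longrightarrow> v \<in> verts G \<Longrightarrow> cset G v \<subseteq> verts G"
proof
  fix u assume "simple_graph G" "v \<in> verts G" "u \<in> cset G v"
  from this(3) show "u \<in> verts G"
    by (induction rule: cset_induct) (use \<open>v \<in> verts G\<close> \<open>simple_graph G\<close> simple_adjD in auto)
qed

lemma simple_comp_at: "simple_graph G \<Longrightarrow> v \<in> verts G \<Longrightarrow> simple_graph (comp_at G v)"
  by (simp add: comp_at_def simple_induced cset_subset)

lemma adj_comp_at: "adj (comp_at G v) x y \<longleftrightarrow> adj G x y \<and> x \<in> cset G v"
  by (auto simp: comp_at_def adj_induced intro: cset_adj)

lemma connected_comp_at: "connected_graph (comp_at G v)"
proof -
  have *: "(adj (comp_at G v))\<^sup>*\<^sup>* v u" if "u \<in> cset G v" for u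
    using that
  proof (induction rule: cset_induct)
    case (step x y)
    then have "adj (comp_at G v) x y" by (simp add: adj_comp_at)
    with step show ?case by (meson rtranclp.rtrancl_into_rtrancl)
  qed simp
  show ?thesis unfolding connected_graph_def
    using * rtranclp_adj_sym[of "comp_at G v"]
    by (metis cset_refl empty_iff rtranclp_trans verts_comp_at)
qed

text \<open>\<open>T\<close> occurs \<open>M\<close> times as a connected component of \<open>G\<close> (for connected \<open>T\<close>).\<close>

definition copies :: "'b sgraph \<Rightarrow> 'c sgraph \<Rightarrow> nat \<Rightarrow> (nat \<Rightarrow> 'c \<Rightarrow> 'b) \<Rightarrow> bool" where
  "copies G T M \<tau> \<longleftrightarrow>
     (\<forall>i<M. inj_on (\<tau> i) (verts T) \<and> \<tau> i ` verts T \<subseteq> verts G) \<and>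
     (\<forall>i<M. \<forall>j<M. i \<noteq> j \<longrightarrow> \<tau> i ` verts T \<inter> \<tau> j ` verts T = {}) \<and>
     (\<forall>i<M. \<forall>x\<in>verts T. \<forall>w. adj G (\<tau> i x) w \<longleftrightarrow> (\<exists>y\<in>verts T. w = \<tau> i y \<and> adj T x y))"

lemma copies_mono: "copies G T M \<tau> \<Longrightarrow> M' \<le> M \<Longrightarrow> copies G T M' \<tau>"
  unfolding copies_def using less_le_trans by meson

lemma copiesD:
  assumes "copies G T M \<tau>"
  shows "i < M \<Longrightarrow> inj_on (\<tau> i) (verts T)"
    and "i < M \<Longrightarrow> x \<in> verts T \<Longrightarrow> \<tau> i x \<in> verts G"
    and "i < M \<Longrightarrow> j < M \<Longrightarrow> i \<noteq> j \<Longrightarrow> \<tau> i ` verts T \<inter> \<tau> j ` verts T = {}"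
    and "i < M \<Longrightarrow> x \<in> verts T \<Longrightarrow> adj G (\<tau> i x) w \<Longrightarrow> \<exists>y\<in>verts T. w = \<tau> i y \<and> adj T x y"
    and "i < M \<Longrightarrow> x \<in> verts T \<Longrightarrow> y \<in> verts T \<Longrightarrow> adj T x y \<Longrightarrow> adj G (\<tau> i x) (\<tau> i y)"
  using assms unfolding copies_def by blast+

text \<open>A set that meets pairwise disjoint sets needs a different point for each of them, so
  \<open>Z\<close> spoils at most \<open>card Z\<close> indices.\<close>

lemma unused_indices:
  fixes S :: "nat \<Rightarrow> 'b set"
  assumes "finite Z" "\<And>i j. i < M \<Longrightarrow> j < M \<Longrightarrow> i \<noteq> j \<Longrightarrow> S i \<inter> S j = {}"
  shows "M \<le> card {i. i < M \<and> S i \<inter> Z = {}} + card Z"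
proof -
  let ?U = "{i. i < M \<and> S i \<inter> Z = {}}" and ?B = "{i. i < M \<and> S i \<inter> Z \<noteq> {}}"
  define w where "w i = (SOME x. x \<in> S i \<inter> Z)" for i
  have w: "w i \<in> S i \<inter> Z" if "i \<in> ?B" for i
    using that unfolding w_def by (intro someI_ex[of "\<lambda>x. x \<in> S i \<inter> Z"]) auto
  have "inj_on w ?B"
  proof (rule inj_onI)
    fix i j assume ij: "i \<in> ?B" "j \<in> ?B" "w i = w j"
    then have "w i \<in> S i \<inter> S j" using w[of i] w[of j] by auto
    then show "i = j" using assms(2)[of i j] ij by auto
  qed
  moreover have "w ` ?B \<subseteq> Z" using w by auto
  ultimately have "card ?B \<le> card Z" using assms(1) by (rule card_inj_on_le)
  moreover have "{..<M} = ?U \<union> ?B" by auto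
  then have "card {..<M} \<le> card ?U + card ?B" by (simp only: card_Un_le)
  ultimately show ?thesis by simp
qed

lemma unused_index:
  assumes "copies G T M \<tau>" "finite Z" "card Z < M"
  obtains j where "j < M" "\<tau> j ` verts T \<inter> Z = {}"
proof -
  have "M \<le> card {i. i < M \<and> \<tau> i ` verts T \<inter> Z = {}} + card Z"
    using assms(1,2) by (intro unused_indices) (auto dest: copiesD(3))
  with assms(3) have "{i. i < M \<and> \<tau> i ` verts T \<inter> Z = {}} \<noteq> {}" by (metis add_0 card.empty not_le)
  then show ?thesis using that by blast
qed

text \<open>An inclusion-maximal \<open>F\<close>-free edge set is saturated. This spares proving
  saturation of a construction, at the price of losing control over the added edges.\<close>

lemma extend_saturated:
  assumes "simple_graph G" "\<not> contains G F"
  obtains G' where "saturated F G'" "verts G' = verts G" "edges G \<subseteq> edges G'"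
proof -
  define A where "A = {E. edges G \<subseteq> E \<and> E \<subseteq> vpairs (verts G) \<and> \<not> contains (SGraph (verts G) E) F}"
  have "finite (vpairs (verts G))" using assms(1)
    by (auto simp: vpairs_def simple_graph_def intro: finite_subset[of _ "Pow (verts G)"])
  then have "finite A" by (auto simp: A_def intro: finite_subset[of _ "Pow (vpairs (verts G))"])
  moreover have "edges G \<in> A" using assms by (cases G) (auto simp: simple_graph_def A_def)
  ultimately have "\<exists>E\<in>A. edges G \<subseteq> E \<and> (\<forall>E'\<in>A. E \<subseteq> E' \<longrightarrow> E = E')"
    by (rule finite_has_maximal2)
  then obtain E where "E \<in> A" and max: "\<And>E'. E' \<in> A \<Longrightarrow> E \<subseteq> E' \<Longrightarrow> E = E'" by metis
  then have E: "edges G \<subseteq> E" "E \<subseteq> vpairs (verts G)" "\<not> contains (SGraph (verts G) E) F"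
    by (auto simp: A_def)
  have "saturated F (SGraph (verts G) E)"
    unfolding saturated_def
  proof (intro conjI ballI)
    fix e assume e: "e \<in> non_edges (SGraph (verts G) E)"
    show "contains (add_edge (SGraph (verts G) E) e) F"
    proof (rule ccontr)
      assume "\<not> ?thesis"
      then have "insert e E \<in> A" using E e by (auto simp: A_def add_edge_def non_edges_def)
      from max[OF this] e show False by (auto simp: non_edges_def)
    qed
  qed (use E assms in \<open>auto simp: simple_graph_def\<close>)
  with E show ?thesis by (intro that[of "SGraph (verts G) E"]) auto
qed

subsection \<open>Saturated graphs with many equal components\<close>

text \<open>The copy of \<open>F\<close> must use \<open>e'\<close>, and \<open>{x, y}\<close> is
  the edge of \<open>F\<close> placed there. As \<open>M\<close> exceeds the number of vertices of
  \<open>F\<close>, some copy of \<open>T\<close> is untouched and would offer room for the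
  component of \<open>x\<close>.\<close>

lemma new_component:
  assumes F: "simple_graph F" and C: "copies G T M \<tau>" and M: "card (verts F) < M"
    and f: "emb f F (add_edge G e')" and nc: "\<not> contains G F"
  obtains x y where "x \<in> verts F" "\<not> contains T (comp_at F x)" "adj F x y" "{f x, f y} = e'"
proof -
  have "\<not> emb f F G" using nc contains_iff_emb by blast
  then obtain e0 where e0: "e0 \<in> edges F" "f ` e0 = e'"
    using f by (auto simp: emb_def add_edge_def)
  from F e0(1) obtain x y where xy: "e0 = {x, y}" "x \<in> verts F" "adj F x y" by (rule simple_edgeE)
  have inj: "inj_on f (verts F)" using f by (simp add: emb_def)
  have "\<not> contains T (comp_at F x)"
  proof
    assume "contains T (comp_at F x)"
    then obtain g where g: "emb g (comp_at F x) T" using contains_iff_emb by blast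
    have gV: "g z \<in> verts T" if "z \<in> cset F x" for z using g that by (auto simp: emb_def)
    have "card (f ` verts F) < M" using M card_image_le[OF simple_finite(1)[OF F], of f] by linarith
    with C obtain j where j: "j < M" "\<tau> j ` verts T \<inter> f ` verts F = {}"
      using unused_index[of G T M \<tau> "f ` verts F"] simple_finite(1)[OF F] by blast
    have injt: "inj_on (\<tau> j) (verts T)" using copiesD(1)[OF C j(1)] .
    \<comment> \<open>Reroutes the component through the untouched copy \<open>j\<close>. The edge
      \<open>e'\<close> is then avoided, so \<open>f'\<close> embeds \<open>F\<close> into
      \<open>G\<close> itself.\<close>
    define f' where "f' z = (if z \<in> cset F x then \<tau> j (g z) else f z)" for z
    have "emb f' F G"
    proof (rule embI[OF F])
      show "inj_on f' (verts F)"
      proof (rule inj_onI)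
        fix a b assume ab: "a \<in> verts F" "b \<in> verts F" "f' a = f' b"
        consider "a \<in> cset F x" "b \<in> cset F x" | "a \<notin> cset F x" "b \<notin> cset F x"
          | "a \<in> cset F x \<longleftrightarrow> b \<notin> cset F x" by blast
        then show "a = b"
        proof cases
          case 1
          with ab have "g a = g b" using inj_onD[OF injt] gV by (simp add: f'_def)
          with 1 g show ?thesis by (auto simp: emb_def inj_on_def)
        next
          case 2
          with ab inj show ?thesis by (auto simp: f'_def inj_on_def)
        next
          case 3
          with ab j(2) gV show ?thesis by (fastforce simp: f'_def split: if_splits)
        qed
      qed
      show "f' ` verts F \<subseteq> verts G"
        using f gV copiesD(2)[OF C j(1)] by (auto simp: f'_def emb_def)
      fix u v assume uv: "adj F u v"
      show "adj G (f' u) (f' v)"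
      proof (cases "u \<in> cset F x")
        case True
        then have "v \<in> cset F x" using uv by (rule cset_adj)
        moreover have "adj T (g u) (g v)" using True uv by (intro emb_adj[OF g]) (simp add: adj_comp_at)
        ultimately show ?thesis using True copiesD(5)[OF C j(1)] gV by (simp add: f'_def)
      next
        case False
        then have v: "v \<notin> cset F x" using cset_adj[OF _ adj_sym[OF uv]] by blast
        \<comment> \<open>By injectivity only the edge \<open>{x, y}\<close> is sent to
          \<open>e'\<close>, and it lies in the rerouted component.\<close>
        have "{f u, f v} \<noteq> e'"
        proof
          assume "{f u, f v} = e'"
          then have "f ` {u, v} = f ` {x, y}" using e0 xy by simp
          moreover have "{u, v} \<subseteq> verts F" "{x, y} \<subseteq> verts F"
            using simple_adjD[OF F uv] simple_adjD[OF F xy(3)] by auto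
          ultimately have "{u, v} = {x, y}" using inj_on_image_eq_iff[OF inj] by blast
          with False v show False by (metis cset_refl insert_iff singletonD)
        qed
        with emb_adj[OF f uv] have "adj G (f u) (f v)" by (simp add: adj_add_edge)
        with False v show ?thesis by (simp add: f'_def)
      qed
    qed
    with nc show False using contains_iff_emb by blast
  qed
  with xy e0 show ?thesis by (intro that[of x y]) auto
qed

text \<open>The image of \<open>D\<close> is closed under adjacency in \<open>H\<close>, so a
  component of \<open>F\<close> with one vertex in it stays inside, and inverting
  \<open>\<sigma>\<close> turns it into a subgraph of \<open>D\<close>.\<close>

lemma closed_pullback:
  assumes F: "simple_graph F" and f: "emb f F H" and x: "x \<in> verts F" and inj: "inj_on \<sigma> (verts D)"
    and cl: "\<And>a w. a \<in> verts D \<Longrightarrow> adj H (\<sigma> a) w \<Longrightarrow> \<exists>b\<in>verts D. w = \<sigma> b \<and> adj D a b"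
    and fx: "f x \<in> \<sigma> ` verts D"
  shows "contains D (comp_at F x)"
proof -
  have im: "f u \<in> \<sigma> ` verts D" if "u \<in> cset F x" for u
    using that
  proof (induction rule: cset_induct)
    case (step a b)
    then obtain z where z: "z \<in> verts D" "f a = \<sigma> z" by blast
    with emb_adj[OF f step(2)] cl[of z "f b"] show ?case by auto
  qed (rule fx)
  let ?h = "\<lambda>u. inv_into (verts D) \<sigma> (f u)"
  have h: "?h u \<in> verts D" "\<sigma> (?h u) = f u" if "u \<in> cset F x" for u
    using im[OF that] by (auto simp: inv_into_into f_inv_into_f)
  have "emb ?h (comp_at F x) D"
  proof (rule embI)
    show "simple_graph (comp_at F x)" using F x by (rule simple_comp_at)
    show "inj_on ?h (verts (comp_at F x))"
    proof (rule inj_onI)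
      fix a b assume ab: "a \<in> verts (comp_at F x)" "b \<in> verts (comp_at F x)" "?h a = ?h b"
      then have "f a = f b" using h by (metis verts_comp_at)
      moreover have "a \<in> verts F" "b \<in> verts F" using ab cset_subset[OF F x] by auto
      ultimately show "a = b" using f by (auto simp: emb_def dest: inj_onD)
    qed
    show "?h ` verts (comp_at F x) \<subseteq> verts D" using h by auto
    fix u v assume "adj (comp_at F x) u v"
    then have uv: "adj F u v" "u \<in> cset F x" "v \<in> cset F x" by (auto simp: adj_comp_at intro: cset_adj)
    then have "adj H (\<sigma> (?h u)) (f v)" using emb_adj[OF f uv(1)] h(2) by simp
    with cl h(1)[OF uv(2)] obtain b where b: "b \<in> verts D" "f v = \<sigma> b" "adj D (?h u) b" by blast
    then have "?h v = b" using inj by simp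
    with b show "adj D (?h u) (?h v)" by simp
  qed
  then show ?thesis using contains_iff_emb by blast
qed

lemma verts_double [simp]: "verts (double T) = verts T <+> verts T"
  by (simp add: double_def)

lemma adj_double:
  "adj (double T) (Inl a) (Inl b) \<longleftrightarrow> adj T a b"
  "adj (double T) (Inr a) (Inr b) \<longleftrightarrow> adj T a b"
  "\<not> adj (double T) (Inl a) (Inr b)" "\<not> adj (double T) (Inr a) (Inl b)"
proof -
  have l: "{Inl a, Inl b} = Inl ` e \<longleftrightarrow> e = {a, b}" for e :: "'a set"
    using inj_image_eq_iff[OF inj_Inl, of "{a, b}" e] by auto
  have r: "{Inr a, Inr b} = Inr ` e \<longleftrightarrow> e = {a, b}" for e :: "'a set"
    using inj_image_eq_iff[OF inj_Inr, of "{a, b}" e] by auto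
  have lr: "{Inl a, Inl b} \<noteq> Inr ` e" "{Inr a, Inr b} \<noteq> Inl ` e" for e :: "'a set" by auto
  show "adj (double T) (Inl a) (Inl b) \<longleftrightarrow> adj T a b" "adj (double T) (Inr a) (Inr b) \<longleftrightarrow> adj T a b"
    unfolding adj_def double_def sgraph.sel Un_iff image_iff by (simp_all only: l r lr) auto
  show "\<not> adj (double T) (Inl a) (Inr b)" "\<not> adj (double T) (Inr a) (Inl b)"
    by (auto simp: adj_def double_def)
qed

lemma non_edge_iff: "{u, v} \<in> non_edges G \<longleftrightarrow> u \<in> verts G \<and> v \<in> verts G \<and> u \<noteq> v \<and> \<not> adj G u v"
  by (auto simp: non_edges_def vpairs_def adj_def card_2_iff)

lemma non_edgeE:
  assumes "e \<in> non_edges G"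
  obtains u v where "e = {u, v}" "u \<in> verts G" "v \<in> verts G" "u \<noteq> v" "\<not> adj G u v"
proof -
  from assms have "card e = 2" by (simp add: non_edges_def vpairs_def)
  then obtain u v where "e = {u, v}" by (auto simp: card_2_iff)
  with assms non_edge_iff[of u v G] show ?thesis using that by blast
qed

lemma many_copies_good:
  assumes F: "simple_graph F" and G: "saturated F G" and T: "is_tree T"
    and C: "copies G T M \<tau>" and M: "card (verts F) + 2 \<le> M"
  shows "good_tree F T"
proof -
  have sG: "simple_graph G" and nc: "\<not> contains G F"
    and sat: "\<And>e. e \<in> non_edges G \<Longrightarrow> contains (add_edge G e) F"
    using G by (auto simp: saturated_def)
  obtain p q where M': "card (verts F) < M" "p < M" "q < M" and pq: "p \<noteq> q"
    using that[of 0 1] M by auto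
  \<comment> \<open>\<open>D\<close> stands for \<open>T + e\<close> or \<open>2T + e\<close>. It is
    laid over one or two copies of \<open>T\<close> in \<open>G\<close>, where it is closed under
    adjacency even after \<open>e'\<close> is added, so \<open>closed_pullback\<close>
    applies.\<close>
  have key: "contains_new_component D F T"
    if e: "e' \<in> non_edges G" and inj: "inj_on \<sigma> (verts D)"
      and cl: "\<And>a w. a \<in> verts D \<Longrightarrow> adj (add_edge G e') (\<sigma> a) w \<Longrightarrow> \<exists>b\<in>verts D. w = \<sigma> b \<and> adj D a b"
      and sub: "e' \<subseteq> \<sigma> ` verts D" for D :: "'z sgraph" and \<sigma> e'
  proof -
    obtain f where f: "emb f F (add_edge G e')" using sat[OF e] contains_iff_emb by blast
    obtain x y where x: "x \<in> verts F" "\<not> contains T (comp_at F x)" "{f x, f y} = e'"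
      using new_component[OF F C M'(1) f nc] by metis
    have "contains D (comp_at F x)"
      using closed_pullback[OF F f x(1) inj cl] x(3) sub by blast
    with x show ?thesis by (auto simp: contains_new_component_def components_of_eq)
  qed
  show ?thesis unfolding good_tree_def
  proof (intro conjI ballI T)
    fix e assume "e \<in> non_edges T"
    then obtain u v where e: "e = {u, v}" and uv: "u \<in> verts T" "v \<in> verts T" "u \<noteq> v" "\<not> adj T u v"
      by (rule non_edgeE)
    have i: "inj_on (\<tau> p) (verts T)" using copiesD(1)[OF C M'(2)] .
    show "contains_new_component (add_edge T e) F T"
    proof (rule key[of "{\<tau> p u, \<tau> p v}" "\<tau> p"])
      have "\<not> adj G (\<tau> p u) (\<tau> p v)"
        using copiesD(4)[OF C M'(2) uv(1)] uv inj_onD[OF i] by metis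
      moreover have "\<tau> p u \<noteq> \<tau> p v" using uv inj_onD[OF i] by metis
      ultimately show "{\<tau> p u, \<tau> p v} \<in> non_edges G"
        using uv copiesD(2)[OF C M'(2)] by (simp add: non_edge_iff)
      show "inj_on (\<tau> p) (verts (add_edge T e))" using i by simp
      show "{\<tau> p u, \<tau> p v} \<subseteq> \<tau> p ` verts (add_edge T e)" using uv by auto
      fix a w assume a: "a \<in> verts (add_edge T e)" and w: "adj (add_edge G {\<tau> p u, \<tau> p v}) (\<tau> p a) w"
      then have a': "a \<in> verts T" by simp
      from w consider "adj G (\<tau> p a) w" | "{\<tau> p a, w} = {\<tau> p u, \<tau> p v}" by (auto simp: adj_add_edge)
      then show "\<exists>b\<in>verts (add_edge T e). w = \<tau> p b \<and> adj (add_edge T e) a b"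
      proof cases
        case 1
        then show ?thesis using copiesD(4)[OF C M'(2) a'] by (auto simp: adj_add_edge)
      next
        case 2
        then have "a = u \<and> w = \<tau> p v \<or> a = v \<and> w = \<tau> p u"
          using inj_onD[OF i] a' uv by (auto simp: doubleton_eq_iff)
        then show ?thesis using uv e by (auto simp: adj_add_edge)
      qed
    qed
  next
    fix u v assume uv: "u \<in> verts T" "v \<in> verts T"
    let ?s = "case_sum (\<tau> p) (\<tau> q)" and ?e = "{\<tau> p u, \<tau> q v}"
    let ?D = "add_edge (double T) {Inl u, Inr v}"
    have i0: "inj_on (\<tau> p) (verts T)" using copiesD(1)[OF C M'(2)] .
    have i1: "inj_on (\<tau> q) (verts T)" using copiesD(1)[OF C M'(3)] .
    have "\<tau> p ` verts T \<inter> \<tau> q ` verts T = {}" using copiesD(3)[OF C M'(2,3) pq] .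
    then have d: "\<tau> p x \<noteq> \<tau> q y" if "x \<in> verts T" "y \<in> verts T" for x y using that by blast
    show "contains_new_component ?D F T"
    proof (rule key[of ?e ?s])
      have "\<not> adj G (\<tau> p u) (\<tau> q v)" using copiesD(4)[OF C M'(2) uv(1)] d uv by metis
      then show "?e \<in> non_edges G"
        using uv d copiesD(2)[OF C M'(2)] copiesD(2)[OF C M'(3)] by (simp add: non_edge_iff)
      show "inj_on ?s (verts ?D)" 
      proof (rule inj_onI)
        fix a b assume "a \<in> verts ?D" "b \<in> verts ?D" "?s a = ?s b"
        then show "a = b" using d d[THEN not_sym]
          by (cases a; cases b) (auto simp: inj_on_eq_iff[OF i0] inj_on_eq_iff[OF i1])
      qed
      show "?e \<subseteq> ?s ` verts ?D" using uv by (auto intro: rev_image_eqI)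
      fix a w assume a: "a \<in> verts ?D" and w: "adj (add_edge G ?e) (?s a) w"
      show "\<exists>b\<in>verts ?D. w = ?s b \<and> adj ?D a b"
      proof (cases a)
        case (Inl a')
        then have a': "a' \<in> verts T" using a by auto
        from w Inl consider "adj G (\<tau> p a') w" | "{\<tau> p a', w} = ?e" by (auto simp: adj_add_edge)
        then show ?thesis
        proof cases
          case 1
          then obtain b where "b \<in> verts T" "w = \<tau> p b" "adj T a' b" using copiesD(4)[OF C M'(2) a'] by blast
          then show ?thesis using Inl by (intro bexI[of _ "Inl b"]) (auto simp: adj_add_edge adj_double)
        next
          case 2
          then have "\<tau> p a' = \<tau> p u \<and> w = \<tau> q v" using d[OF a' uv(2)] by (auto simp: doubleton_eq_iff)
          then have "a' = u" "w = \<tau> q v" using inj_onD[OF i0] a' uv by auto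
          then show ?thesis using Inl uv by (intro bexI[of _ "Inr v"]) (auto simp: adj_add_edge)
        qed
      next
        case (Inr a')
        then have a': "a' \<in> verts T" using a by auto
        from w Inr consider "adj G (\<tau> q a') w" | "{\<tau> q a', w} = ?e" by (auto simp: adj_add_edge)
        then show ?thesis
        proof cases
          case 1
          then obtain b where "b \<in> verts T" "w = \<tau> q b" "adj T a' b" using copiesD(4)[OF C M'(3) a'] by blast
          then show ?thesis using Inr by (intro bexI[of _ "Inr b"]) (auto simp: adj_add_edge adj_double)
        next
          case 2
          then have "\<tau> q a' = \<tau> q v \<and> w = \<tau> p u" using d[OF uv(1) a'] by (auto simp: doubleton_eq_iff)
          then have "a' = v" "w = \<tau> p u" using inj_onD[OF i1] a' uv by auto
          then show ?thesis using Inr uv by (intro bexI[of _ "Inl u"]) (auto simp: adj_add_edge insert_commute)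
        qed
      qed
    qed
  qed
qed

text \<open>Copies of \<open>T\<close> are interchangeable, and with more copies than vertices of
  \<open>F\<close> one is always free: an embedding of \<open>F\<close> into \<open>G'\<close> can
  leave the new copy, and a new edge at the new copy can be imitated at an old one.\<close>

lemma clone_copy:
  assumes F: "simple_graph F" and G: "saturated F G" and T: "simple_graph T"
    and C: "copies G T M \<tau>" and M: "card (verts F) + 2 \<le> M"
    and inj: "inj_on \<sigma> (verts T)" and fresh: "\<sigma> ` verts T \<inter> verts G = {}"
  defines "G' \<equiv> SGraph (verts G \<union> \<sigma> ` verts T) (edges G \<union> (`) \<sigma> ` edges T)"
  shows "saturated F G'" "copies G' T (Suc M) (\<tau>(M := \<sigma>))"
    "card (verts G') = card (verts G) + card (verts T)"
    "card (edges G') = card (edges G) + card (edges T)"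
proof -
  have sG: "simple_graph G" and nc: "\<not> contains G F"
    and sat: "\<And>e. e \<in> non_edges G \<Longrightarrow> contains (add_edge G e) F"
    using G by (auto simp: saturated_def)
  have vG': "verts G' = verts G \<union> \<sigma> ` verts T" by (simp add: G'_def)
  have adj': "adj G' a b \<longleftrightarrow> adj G a b \<or> (\<exists>x y. a = \<sigma> x \<and> b = \<sigma> y \<and> adj T x y)" for a b
  proof -
    have "{a, b} \<in> (`) \<sigma> ` edges T \<longleftrightarrow> (\<exists>x y. a = \<sigma> x \<and> b = \<sigma> y \<and> adj T x y)"
    proof
      assume "{a, b} \<in> (`) \<sigma> ` edges T"
      then obtain e where e: "e \<in> edges T" "{a, b} = \<sigma> ` e" by auto
      then obtain x y where "e = {x, y}" "adj T x y" using T by (metis simple_edgeE)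
      moreover from this e(2) have "a = \<sigma> x \<and> b = \<sigma> y \<or> a = \<sigma> y \<and> b = \<sigma> x"
        by (simp add: doubleton_eq_iff)
      ultimately show "\<exists>x y. a = \<sigma> x \<and> b = \<sigma> y \<and> adj T x y" by (metis adj_sym)
    next
      assume "\<exists>x y. a = \<sigma> x \<and> b = \<sigma> y \<and> adj T x y"
      then obtain x y where xy: "a = \<sigma> x" "b = \<sigma> y" "{x, y} \<in> edges T" by (auto simp: adj_def)
      then have "{a, b} = \<sigma> ` {x, y}" by simp
      with xy(3) show "{a, b} \<in> (`) \<sigma> ` edges T" by (rule image_eqI[rotated])
    qed
    then show ?thesis by (simp add: adj_def G'_def)
  qed
  have sub: "edges G \<subseteq> vpairs (verts G)" "edges T \<subseteq> vpairs (verts T)"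
    using sG T by (auto simp: simple_graph_def)
  have "(`) \<sigma> ` edges T \<subseteq> vpairs (\<sigma> ` verts T)"
  proof
    fix e assume "e \<in> (`) \<sigma> ` edges T"
    then obtain e0 where e0: "e = \<sigma> ` e0" "e0 \<subseteq> verts T" "card e0 = 2" using sub by (auto simp: vpairs_def)
    then have "card e = 2" using inj by (metis card_image inj_on_subset)
    with e0 show "e \<in> vpairs (\<sigma> ` verts T)" by (auto simp: vpairs_def)
  qed
  then have sG': "simple_graph G'"
    using sub simple_finite(1)[OF sG] simple_finite(1)[OF T]
    by (auto simp: simple_graph_def G'_def vpairs_def)
  show "card (verts G') = card (verts G) + card (verts T)"
    unfolding vG' using fresh simple_finite(1)[OF sG] simple_finite(1)[OF T]
    by (subst card_Un_disjoint) (auto simp: card_image[OF inj])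
  have "inj_on ((`) \<sigma>) (edges T)"
    using inj_on_image_Pow[OF inj] by (rule inj_on_subset) (use sub in \<open>auto simp: vpairs_def\<close>)
  moreover have "edges G \<inter> (`) \<sigma> ` edges T = {}"
  proof -
    have "e \<inter> verts G = {} \<and> e \<noteq> {}" if "e \<in> (`) \<sigma> ` edges T" for e
      using that fresh sub by (fastforce simp: vpairs_def)
    moreover have "e \<subseteq> verts G" if "e \<in> edges G" for e using that sub by (auto simp: vpairs_def)
    ultimately have "e \<notin> edges G \<inter> (`) \<sigma> ` edges T" for e by (metis IntE inf.absorb1)
    then show ?thesis by blast
  qed
  ultimately show "card (edges G') = card (edges G) + card (edges T)"
    unfolding G'_def using simple_finite(2)[OF sG] simple_finite(2)[OF T]
    by (simp add: card_Un_disjoint card_image)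
  have adjG_V: "a \<in> verts G" "b \<in> verts G" if "adj G a b" for a b using simple_adjD[OF sG that] by auto
  have fr: "\<sigma> x \<notin> verts G" if "x \<in> verts T" for x using fresh that by auto
  have adjT_V: "x \<in> verts T" "y \<in> verts T" if "adj T x y" for x y using simple_adjD[OF T that] by auto
  have \<tau>V: "\<tau> i x \<in> verts G" if "i < M" "x \<in> verts T" for i x using copiesD(2)[OF C that] .
  show "copies G' T (Suc M) (\<tau>(M := \<sigma>))"
    unfolding copies_def
  proof (intro conjI allI impI ballI)
    fix i assume "i < Suc M"
    then have "i < M \<or> i = M" by auto
    then show "inj_on ((\<tau>(M := \<sigma>)) i) (verts T)" "(\<tau>(M := \<sigma>)) i ` verts T \<subseteq> verts G'"
      using inj copiesD(1)[OF C] \<tau>V by (auto simp: vG')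
  next
    fix i j assume "i < Suc M" "j < Suc M" "i \<noteq> j"
    then consider "i < M" "j < M" | "i = M" "j < M" | "i < M" "j = M" by linarith
    then show "(\<tau>(M := \<sigma>)) i ` verts T \<inter> (\<tau>(M := \<sigma>)) j ` verts T = {}"
    proof cases
      case 1 with \<open>i \<noteq> j\<close> copiesD(3)[OF C] show ?thesis by auto
    next
      case 2 then show ?thesis using fr \<tau>V[of j] by fastforce
    next
      case 3 then show ?thesis using fr \<tau>V[of i] by fastforce
    qed
  next
    fix i x w assume i: "i < Suc M" and x: "x \<in> verts T"
    show "adj G' ((\<tau>(M := \<sigma>)) i x) w \<longleftrightarrow> (\<exists>y\<in>verts T. w = (\<tau>(M := \<sigma>)) i y \<and> adj T x y)"
    proof (cases "i = M")
      case True
      have "\<not> adj G (\<sigma> x) w" using adjG_V fr[OF x] by blast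
      then have "adj G' (\<sigma> x) w \<longleftrightarrow> (\<exists>y\<in>verts T. w = \<sigma> y \<and> adj T x y)"
        using adjT_V inj_onD[OF inj _ x] by (auto simp: adj')
      with True show ?thesis by simp
    next
      case False
      with i have "i < M" by simp
      then have "adj G' (\<tau> i x) w \<longleftrightarrow> adj G (\<tau> i x) w"
        using \<tau>V[OF \<open>i < M\<close> x] fr adjT_V by (auto simp: adj')
      also have "\<dots> \<longleftrightarrow> (\<exists>y\<in>verts T. w = \<tau> i y \<and> adj T x y)"
        using copiesD(4,5)[OF C \<open>i < M\<close> x] by blast
      finally show ?thesis using False by simp
    qed
  qed
  have emb_old: "emb id G G'" by (auto simp: emb_def G'_def)
  have nc': "\<not> contains G' F"
  proof
    assume "contains G' F"
    then obtain f where f: "emb f F G'" using contains_iff_emb by blast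
    have "card (f ` verts F) < M" using M card_image_le[OF simple_finite(1)[OF F], of f] by linarith
    then obtain j where j: "j < M" "\<tau> j ` verts T \<inter> f ` verts F = {}"
      using unused_index[OF C] simple_finite(1)[OF F] by blast
    \<comment> \<open>Folds the new copy onto the old copy \<open>j\<close>, which the image of
      \<open>F\<close> avoids; hence \<open>\<pi>\<close> is injective on that image.\<close>
    define \<pi> where "\<pi> z = (if z \<in> verts G then z else \<tau> j (inv_into (verts T) \<sigma> z))" for z
    have \<pi>\<sigma>: "\<pi> (\<sigma> x) = \<tau> j x" if "x \<in> verts T" for x using that fr inj by (simp add: \<pi>_def)
    have \<pi>V: "\<pi> z = z" if "z \<in> verts G" for z using that by (simp add: \<pi>_def)
    have fV: "f z \<in> verts G \<or> (\<exists>x\<in>verts T. f z = \<sigma> x)" if "z \<in> verts F" for z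
      using f that by (auto simp: emb_def vG')
    have nj: "f z \<noteq> \<tau> j x" if "z \<in> verts F" "x \<in> verts T" for z x using j(2) that by blast
    have injf: "inj_on f (verts F)" using f by (simp add: emb_def)
    have "emb (\<pi> \<circ> f) F G"
    proof (rule embI[OF F])
      show "inj_on (\<pi> \<circ> f) (verts F)"
      proof (rule inj_onI)
        fix a b assume ab: "a \<in> verts F" "b \<in> verts F" "(\<pi> \<circ> f) a = (\<pi> \<circ> f) b"
        then have "f a = f b"
          using fV[OF ab(1)] fV[OF ab(2)] \<pi>V \<pi>\<sigma> nj inj_onD[OF copiesD(1)[OF C j(1)]]
          by auto metis+
        then show "a = b" using injf ab by (auto dest: inj_onD)
      qed
      show "(\<pi> \<circ> f) ` verts F \<subseteq> verts G" using fV \<pi>V \<pi>\<sigma> \<tau>V[OF j(1)] by fastforce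
      fix u v assume "adj F u v"
      then have "adj G' (f u) (f v)" by (rule emb_adj[OF f])
      then show "adj G ((\<pi> \<circ> f) u) ((\<pi> \<circ> f) v)"
        using \<pi>V adjG_V \<pi>\<sigma> adjT_V copiesD(5)[OF C j(1)] by (auto simp: adj')
    qed
    with nc show False using contains_iff_emb by blast
  qed
  show "saturated F G'" unfolding saturated_def
  proof (intro conjI ballI sG' nc')
    fix e assume e: "e \<in> non_edges G'"
    then obtain u v where uv: "e = {u, v}" "u \<in> verts G'" "v \<in> verts G'" "u \<noteq> v" "\<not> adj G' u v"
      by (rule non_edgeE)
    show "contains (add_edge G' e) F"
    proof (cases "u \<in> verts G \<and> v \<in> verts G")
      case True
      then have "e \<in> non_edges G" using uv by (auto simp: non_edge_iff adj')
      moreover have "emb id (add_edge G e) (add_edge G' e)" using emb_add_edge[OF emb_old, of e] by simp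
      ultimately show ?thesis using sat contains_trans by blast
    next
      case False
      then have "card ({u, v} \<inter> verts G) \<le> 1"
        using uv(4) by (cases "u \<in> verts G"; cases "v \<in> verts G") auto
      then have "card ({u, v} \<inter> verts G) < M" using M by linarith
      then obtain j where j: "j < M" "\<tau> j ` verts T \<inter> ({u, v} \<inter> verts G) = {}"
        using unused_index[OF C, of "{u, v} \<inter> verts G"] by auto
      have ij: "inj_on (\<tau> j) (verts T)" using copiesD(1)[OF C j(1)] .
      \<comment> \<open>Embeds \<open>G\<close> into \<open>G'\<close> with the new copy in place of
        copy \<open>j\<close>. Copy \<open>j\<close> avoids the endpoint of \<open>e\<close> in
        \<open>G\<close>, if any, so both endpoints are in the range; adjacency is preserved both
        ways, so they come from a non-edge of \<open>G\<close>.\<close>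
      define \<psi> where "\<psi> z = (if z \<in> \<tau> j ` verts T then \<sigma> (inv_into (verts T) (\<tau> j) z) else z)" for z
      have \<psi>\<tau>: "\<psi> (\<tau> j x) = \<sigma> x" if "x \<in> verts T" for x using that ij by (simp add: \<psi>_def)
      have \<psi>o: "\<psi> z = z" if "z \<notin> \<tau> j ` verts T" for z using that by (simp add: \<psi>_def)
      have \<psi>cl: "adj G a b \<longleftrightarrow> adj G' (\<psi> a) (\<psi> b)" if ab: "a \<in> verts G" "b \<in> verts G" for a b
      proof -
        have old: "adj G (\<tau> j x) b \<longleftrightarrow> (\<exists>y\<in>verts T. b = \<tau> j y \<and> adj T x y)" if "x \<in> verts T" for x b
          using copiesD(4,5)[OF C j(1) that] by blast
        have \<sigma>\<sigma>: "adj G' (\<sigma> x) b \<longleftrightarrow> (\<exists>y\<in>verts T. b = \<sigma> y \<and> adj T x y)" if "x \<in> verts T" for x b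
          using adjT_V inj_onD[OF inj _ that] fr[OF that] adjG_V by (auto simp: adj')
        consider x y where "x \<in> verts T" "a = \<tau> j x" "y \<in> verts T" "b = \<tau> j y"
          | x where "x \<in> verts T" "a = \<tau> j x" "b \<notin> \<tau> j ` verts T"
          | y where "a \<notin> \<tau> j ` verts T" "y \<in> verts T" "b = \<tau> j y"
          | "a \<notin> \<tau> j ` verts T" "b \<notin> \<tau> j ` verts T" by blast
        then show ?thesis
        proof cases
          case 1
          then show ?thesis by (auto simp: inj_on_eq_iff[OF ij] inj_on_eq_iff[OF inj] \<psi>\<tau> old \<sigma>\<sigma>)
        next
          case 2
          then show ?thesis using fr ab by (auto simp: \<psi>\<tau> \<psi>o old \<sigma>\<sigma>)
        next
          case 3
          then have "adj G b a \<longleftrightarrow> adj G' (\<psi> b) (\<psi> a)" using fr ab by (auto simp: \<psi>\<tau> \<psi>o old \<sigma>\<sigma>)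
          then show ?thesis using adj_sym by metis
        next
          case 4
          then show ?thesis using fr adjT_V ab by (auto simp: \<psi>o adj')
        qed
      qed
      have \<psi>V: "\<psi> z \<in> verts G'" if "z \<in> verts G" for z
        using that \<psi>\<tau> \<psi>o[of z] by (cases "z \<in> \<tau> j ` verts T") (auto simp: vG')
      have \<psi>i: "inj_on \<psi> (verts G)"
      proof (rule inj_onI)
        fix a b assume ab: "a \<in> verts G" "b \<in> verts G" "\<psi> a = \<psi> b"
        then show "a = b"
          using fr
          by (cases "a \<in> \<tau> j ` verts T"; cases "b \<in> \<tau> j ` verts T") (auto simp: \<psi>\<tau> \<psi>o inj_on_eq_iff[OF inj])
      qed
      have e\<psi>: "emb \<psi> G G'"
      proof (rule embI[OF sG \<psi>i])
        show "\<psi> ` verts G \<subseteq> verts G'" using \<psi>V by blast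
        show "adj G' (\<psi> a) (\<psi> b)" if "adj G a b" for a b
          using \<psi>cl[OF adjG_V[OF that]] that by blast
      qed
      have pre: "\<exists>z\<in>verts G. \<psi> z = w" if "w \<in> {u, v}" for w
      proof (cases "w \<in> verts G")
        case True
        with j(2) that show ?thesis using \<psi>o[of w] by auto
      next
        case False
        with that uv(2,3) obtain x where "x \<in> verts T" "w = \<sigma> x" by (auto simp: vG')
        then show ?thesis using \<psi>\<tau> \<tau>V[OF j(1)] by auto
      qed
      obtain u' v' where u'v': "u' \<in> verts G" "v' \<in> verts G" "\<psi> u' = u" "\<psi> v' = v"
        using pre[of u] pre[of v] by auto
      then have "{u', v'} \<in> non_edges G" using uv \<psi>cl by (auto simp: non_edge_iff)
      moreover have "emb \<psi> (add_edge G {u', v'}) (add_edge G' e)"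
        using emb_add_edge[OF e\<psi>, of "{u', v'}"] u'v' uv(1) by simp
      ultimately show ?thesis using sat contains_trans by blast
    qed
  qed
qed

subsection \<open>Counting tree components\<close>

text \<open>Trees generated by attaching leaves: the edge count, connectivity and the existence of a
  leaf follow by induction or inversion, without arguing about cycles.\<close>

inductive grown_tree :: "'a set \<Rightarrow> 'a set set \<Rightarrow> bool" where
  single: "grown_tree {v} {}"
| attach: "grown_tree V P \<Longrightarrow> u \<in> V \<Longrightarrow> w \<notin> V \<Longrightarrow> grown_tree (insert w V) (insert {u, w} P)"

lemma grown_tree_basic:
  "grown_tree V P \<Longrightarrow> finite V \<and> finite P \<and> P \<subseteq> vpairs V \<and> card P + 1 = card V"
proof (induction rule: grown_tree.induct)
  case (attach V P u w)
  then have "{u, w} \<notin> P" "u \<noteq> w" by (auto simp: vpairs_def)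
  with attach show ?case by (auto simp: vpairs_def)
qed auto

lemma connected_graphI:
  assumes "v \<in> verts G" "\<And>u. u \<in> verts G \<Longrightarrow> (adj G)\<^sup>*\<^sup>* v u"
  shows "connected_graph G"
  unfolding connected_graph_def using assms by (metis empty_iff rtranclp_adj_sym rtranclp_trans)

lemma grown_tree_connected: "grown_tree V P \<Longrightarrow> connected_graph (SGraph V P)"
proof (induction rule: grown_tree.induct)
  case (single v)
  then show ?case by (auto simp: connected_graph_def)
next
  case (attach V P u w)
  let ?G = "SGraph V P" and ?H = "SGraph (insert w V) (insert {u, w} P)"
  have "adj ?G a b \<Longrightarrow> adj ?H a b" for a b by (simp add: adj_def)
  then have le: "(adj ?G)\<^sup>*\<^sup>* a b \<Longrightarrow> (adj ?H)\<^sup>*\<^sup>* a b" for a b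
    by (metis mono_rtranclp)
  show ?case
  proof (rule connected_graphI[of u])
    show "u \<in> verts ?H" using attach by simp
    fix x assume "x \<in> verts ?H"
    then consider "x \<in> V" | "x = w" by auto
    then show "(adj ?H)\<^sup>*\<^sup>* u x"
    proof cases
      case 1
      then show ?thesis using attach le by (simp add: connected_graph_def)
    next
      case 2
      then show ?thesis by (intro r_into_rtranclp) (simp add: adj_def)
    qed
  qed
qed

lemma grown_tree_leaf:
  assumes "grown_tree V P" "2 \<le> card V"
  obtains y w where "y \<in> V" "w \<in> V" "{y, w} \<in> P" "\<And>x. {y, x} \<in> P \<Longrightarrow> x = w"
  using assms
proof (cases rule: grown_tree.cases)
  case (attach V' P' u w)
  have "P' \<subseteq> vpairs V'" using attach grown_tree_basic by blast
  then have "{w, x} \<notin> P'" for x using attach by (auto simp: vpairs_def)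
  with attach show ?thesis by (intro that[of w u]) (auto simp: insert_commute doubleton_eq_iff)
qed auto

text \<open>Take a maximal vertex set that carries a grown tree inside \<open>G\<close>; an edge
  leaving it would permit one more attachment.\<close>

lemma spanning_grown_tree:
  assumes G: "simple_graph G" "connected_graph G"
  obtains P where "P \<subseteq> edges G" "grown_tree (verts G) P"
proof -
  define A where "A = {S. S \<subseteq> verts G \<and> (\<exists>P\<subseteq>edges G. grown_tree S P)}"
  obtain v where v: "v \<in> verts G" using G by (auto simp: connected_graph_def)
  have "finite A" using simple_finite(1)[OF G(1)] by (auto simp: A_def intro: finite_subset[of _ "Pow (verts G)"])
  moreover have "{v} \<in> A" using v grown_tree.single[of v] by (auto simp: A_def intro!: exI[of _ "{}"])
  ultimately have "\<exists>S\<in>A. {v} \<subseteq> S \<and> (\<forall>S'\<in>A. S \<subseteq> S' \<longrightarrow> S = S')" by (rule finite_has_maximal2)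
  then obtain S where S: "S \<in> A" "v \<in> S" and max: "\<And>S'. S' \<in> A \<Longrightarrow> S \<subseteq> S' \<Longrightarrow> S = S'" by blast
  then obtain P where P: "P \<subseteq> edges G" "grown_tree S P" "S \<subseteq> verts G" by (auto simp: A_def)
  have "u \<in> S" if "(adj G)\<^sup>*\<^sup>* v u" for u
    using that
  proof (induction rule: rtranclp_induct)
    case (step a b)
    show ?case
    proof (rule ccontr)
      assume b: "b \<notin> S"
      have "grown_tree (insert b S) (insert {a, b} P)" using P(2) step(3) b by (rule grown_tree.attach)
      moreover have "insert {a, b} P \<subseteq> edges G" "insert b S \<subseteq> verts G"
        using P step(2) simple_adjD[OF G(1) step(2)] by (auto simp: adj_def)
      ultimately have "insert b S \<in> A" unfolding A_def by blast
      with max b show False by blast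
    qed
  qed (rule S(2))
  then have "S = verts G" using P(3) G(2) v by (auto simp: connected_graph_def)
  with P show ?thesis using that by blast
qed

lemma connected_card_le:
  assumes "simple_graph G" "connected_graph G"
  shows "card (verts G) \<le> card (edges G) + 1"
proof -
  obtain P where P: "P \<subseteq> edges G" "grown_tree (verts G) P" using spanning_grown_tree[OF assms] .
  then have "card P + 1 = card (verts G)" using grown_tree_basic by blast
  with card_mono[OF simple_finite(2)[OF assms(1)] P(1)] show ?thesis by simp
qed

text \<open>When the next vertex is already on the path, the path is cut back to that visit.\<close>

lemma rtranclp_distinct_path:
  assumes "R\<^sup>*\<^sup>* a b"
  obtains xs where "xs \<noteq> []" "hd xs = a" "last xs = b" "distinct xs"
    "\<And>i. Suc i < length xs \<Longrightarrow> R (xs ! i) (xs ! Suc i)"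
proof -
  have "\<exists>xs. xs \<noteq> [] \<and> hd xs = a \<and> last xs = b \<and> distinct xs \<and>
          (\<forall>i. Suc i < length xs \<longrightarrow> R (xs ! i) (xs ! Suc i))"
    using assms
  proof (induction rule: rtranclp_induct)
    case base
    then show ?case by (intro exI[of _ "[a]"]) auto
  next
    case (step b c)
    then obtain xs where xs: "xs \<noteq> []" "hd xs = a" "last xs = b" "distinct xs"
      and R: "\<And>i. Suc i < length xs \<Longrightarrow> R (xs ! i) (xs ! Suc i)" by blast
    show ?case
    proof (cases "c \<in> set xs")
      case True
      then obtain ys zs where yz: "xs = ys @ c # zs" by (meson split_list)
      have "R ((ys @ [c]) ! i) ((ys @ [c]) ! Suc i)" if "Suc i < length (ys @ [c])" for i
      proof -
        have "(ys @ [c]) ! k = xs ! k" if "k < length (ys @ [c])" for k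
          using that by (auto simp: yz nth_append)
        then show ?thesis using R[of i] that by (simp add: yz)
      qed
      then show ?thesis using xs yz by (intro exI[of _ "ys @ [c]"]) (auto simp: hd_append)
    next
      case False
      have "R ((xs @ [c]) ! i) ((xs @ [c]) ! Suc i)" if i: "Suc i < length (xs @ [c])" for i
      proof (cases "Suc i < length xs")
        case True
        then show ?thesis using R by (simp add: nth_append)
      next
        case False
        with i have "Suc i = length xs" by simp
        moreover from this have "xs ! i = b" using xs by (simp add: last_conv_nth \<open>Suc i = length xs\<close>[symmetric])
        ultimately show ?thesis using step(2) by (simp add: nth_append)
      qed
      then show ?thesis using xs False by (intro exI[of _ "xs @ [c]"]) auto
    qed
  qed
  then show ?thesis using that by blast
qed

text \<open>An edge outside a spanning grown tree \<open>P\<close> closes a cycle with the path in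
  \<open>P\<close> between its ends.\<close>

lemma tree_grown:
  assumes T: "is_tree T"
  shows "grown_tree (verts T) (edges T)"
proof -
  have sT: "simple_graph T" and cT: "connected_graph T" using T by (auto simp: is_tree_def)
  obtain P where P: "P \<subseteq> edges T" "grown_tree (verts T) P" using spanning_grown_tree[OF sT cT] .
  have "edges T \<subseteq> P"
  proof (rule ccontr)
    assume "\<not> edges T \<subseteq> P"
    then obtain e where e: "e \<in> edges T" "e \<notin> P" by blast
    from sT e(1) obtain a b where ab: "e = {a, b}" "a \<noteq> b" "a \<in> verts T" "b \<in> verts T" by (rule simple_edgeE)
    let ?R = "adj (SGraph (verts T) P)"
    have "?R\<^sup>*\<^sup>* a b" using grown_tree_connected[OF P(2)] ab by (simp add: connected_graph_def)
    then obtain xs where xs: "xs \<noteq> []" "hd xs = a" "last xs = b" "distinct xs"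
      and R: "\<And>i. Suc i < length xs \<Longrightarrow> ?R (xs ! i) (xs ! Suc i)" by (rule rtranclp_distinct_path) blast
    \<comment> \<open>One vertex would give \<open>a = b\<close>, and two would put \<open>e\<close>
      into \<open>P\<close>.\<close>
    have l: "3 \<le> length xs"
    proof (rule ccontr)
      assume "\<not> ?thesis"
      moreover have "length xs \<noteq> 0" using xs(1) by simp
      ultimately consider "length xs = 1" | "length xs = 2" by linarith
      then show False
      proof cases
        case 1
        then show ?thesis using xs ab(2) by (cases xs) auto
      next
        case 2
        then obtain p q where "xs = [p, q]" by (auto simp: length_Suc_conv numeral_eq_Suc)
        then show ?thesis using R[of 0] xs e ab by (simp add: adj_def)
      qed
    qed
    have "is_cycle T xs" unfolding is_cycle_def
    proof (intro conjI allI impI l xs(4))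
      fix i assume i: "i < length xs"
      show "adj T (xs ! i) (xs ! (Suc i mod length xs))"
      proof (cases "Suc i < length xs")
        case True
        then show ?thesis using R[OF True] P(1) by (auto simp: adj_def)
      next
        case False
        with i have "Suc i = length xs" by simp
        then have "xs ! i = b" "xs ! (Suc i mod length xs) = a"
          using xs by (auto simp: last_conv_nth hd_conv_nth \<open>Suc i = length xs\<close>[symmetric])
        then show ?thesis using e ab by (simp add: adj_def insert_commute)
      qed
    qed
    then show False using T by (auto simp: is_tree_def)
  qed
  with P show ?thesis by auto
qed

lemma tree_card_edges: "is_tree T \<Longrightarrow> card (edges T) + 1 = card (verts T)"
  using grown_tree_basic[OF tree_grown] by blast

lemma tree_leaf:
  assumes T: "is_tree T" and "2 \<le> card (verts T)"
  obtains y w where "y \<in> verts T" "w \<in> verts T" "adj T y w" "\<And>x. adj T y x \<Longrightarrow> x = w"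
  using grown_tree_leaf[OF tree_grown[OF T] assms(2)] that unfolding adj_def by metis

text \<open>Deleting one edge of the cycle leaves the graph connected, so a spanning tree still fits
  among the remaining edges.\<close>

lemma connected_cycle_card:
  assumes G: "simple_graph G" "connected_graph G" and xs: "is_cycle G xs"
  shows "card (verts G) \<le> card (edges G)"
proof -
  let ?n = "length xs"
  have l: "3 \<le> ?n" "distinct xs" and "xs \<noteq> []" and R: "\<And>i. i < ?n \<Longrightarrow> adj G (xs ! i) (xs ! (Suc i mod ?n))"
    using xs by (auto simp: is_cycle_def)
  let ?a = "xs ! (?n - 1)" and ?b = "xs ! 0"
  let ?G' = "SGraph (verts G) (edges G - {{?a, ?b}})"
  have "Suc (?n - 1) = ?n" "?n - 1 < ?n" using l by auto
  then have ab: "adj G ?a ?b" using R[of "?n - 1"] by simp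
  have path: "(adj ?G')\<^sup>*\<^sup>* ?b (xs ! i)" if "i < ?n" for i
    using that
  proof (induction i)
    case (Suc i)
    then have "adj G (xs ! i) (xs ! Suc i)" using R[of i] by simp
    moreover have "{xs ! i, xs ! Suc i} \<noteq> {?a, ?b}"
    proof
      assume "{xs ! i, xs ! Suc i} = {?a, ?b}"
      \<comment> \<open>The deleted edge joins positions \<open>?n - 1\<close> and \<open>0\<close>;
        a step between consecutive positions could coincide with it only if the cycle had length
        two.\<close>
      then have "i = ?n - 1 \<or> i = 0 \<and> Suc i = ?n - 1"
        using Suc.prems nth_eq_iff_index_eq[OF l(2), of i "?n - 1"] nth_eq_iff_index_eq[OF l(2), of i 0]
          nth_eq_iff_index_eq[OF l(2), of "Suc i" "?n - 1"] \<open>xs \<noteq> []\<close>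
        by (auto simp: doubleton_eq_iff)
      then show False using Suc.prems l(1) by linarith
    qed
    ultimately have "adj ?G' (xs ! i) (xs ! Suc i)" by (simp add: adj_def)
    with Suc show ?case by (simp add: rtranclp.rtrancl_into_rtrancl)
  qed simp
  have ba: "(adj ?G')\<^sup>*\<^sup>* ?b ?a" using path[of "?n - 1"] l by simp
  then have ab': "(adj ?G')\<^sup>*\<^sup>* ?a ?b" by (rule rtranclp_adj_sym)
  have step: "(adj ?G')\<^sup>*\<^sup>* x y" if "adj G x y" for x y
  proof (cases "{x, y} = {?a, ?b}")
    case True
    then show ?thesis using ab' ba by (auto simp: doubleton_eq_iff)
  next
    case False
    then show ?thesis using that by (intro r_into_rtranclp) (simp add: adj_def)
  qed
  have "(adj ?G')\<^sup>*\<^sup>* x y" if "(adj G)\<^sup>*\<^sup>* x y" for x y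
    using that
  proof (induction rule: rtranclp_induct)
    case (step y z)
    show ?case using step(3) \<open>\<And>x y. adj G x y \<Longrightarrow> (adj ?G')\<^sup>*\<^sup>* x y\<close>[OF step(2)] by (rule rtranclp_trans)
  qed simp
  then have c: "connected_graph ?G'" using G(2) by (simp add: connected_graph_def)
  have "simple_graph ?G'" using G(1) by (auto simp: simple_graph_def)
  from connected_card_le[OF this c] have "card (verts G) \<le> card (edges G - {{?a, ?b}}) + 1" by simp
  also have "\<dots> = card (edges G)"
    using card.remove[OF simple_finite(2)[OF G(1)], of "{?a, ?b}"] ab by (simp add: adj_def)
  finally show ?thesis .
qed

section \<open>Edge counts and frequent tree components\<close>

definition tree_comps :: "'a sgraph \<Rightarrow> 'a set set" where
  "tree_comps G = {C \<in> cset G ` verts G. is_tree (induced_subgraph G C)}"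

lemma finite_csets: "simple_graph G \<Longrightarrow> finite (cset G ` verts G)"
  using simple_finite by auto

lemma cset_partition:
  assumes "C \<in> cset G ` verts G" "D \<in> cset G ` verts G" "C \<noteq> D"
  shows "C \<inter> D = {}"
proof -
  obtain u v where "C = cset G u" "D = cset G v" using assms by blast
  then show ?thesis using cset_disjoint[of G u v] assms(3) by blast
qed

lemma Union_csets: "simple_graph G \<Longrightarrow> \<Union>(cset G ` verts G) = verts G"
proof
  assume "simple_graph G"
  then show "\<Union>(cset G ` verts G) \<subseteq> verts G" by (intro UN_least cset_subset)
  show "verts G \<subseteq> \<Union>(cset G ` verts G)" using cset_refl by (metis UN_I subsetI)
qed

text \<open>A component has at least as many edges as vertices unless it is a tree, which falls
  short by one; sum over all components.\<close>

lemma card_verts_le_tree_comps: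
  assumes G: "simple_graph G"
  shows "card (verts G) \<le> card (edges G) + card (tree_comps G)"
proof -
  let ?C = "cset G ` verts G" and ?E = "\<lambda>C. {e \<in> edges G. e \<subseteq> C}"
  have fin: "finite ?C" "finite (verts G)" "finite (edges G)" using finite_csets simple_finite G by auto
  have finC: "finite C" if "C \<in> ?C" for C using that fin(2) cset_subset[OF G] by (auto intro: finite_subset)
  have ne: "e \<noteq> {}" if "e \<in> edges G" for e using that G by (auto simp: simple_graph_def vpairs_def)
  have "card (verts G) = card (\<Union>?C)" using Union_csets[OF G] by simp
  also have "\<dots> = (\<Sum>C\<in>?C. card C)"
  proof (rule card_Union_disjoint)
    show "pairwise disjnt ?C" by (rule pairwiseI) (unfold disjnt_def, rule cset_partition)
  qed (rule finC)
  also have "\<dots> \<le> (\<Sum>C\<in>?C. card (?E C) + (if C \<in> tree_comps G then 1 else 0))"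
  proof (rule sum_mono)
    fix C assume C: "C \<in> ?C"
    then obtain v where v: "v \<in> verts G" "C = cset G v" by blast
    let ?H = "induced_subgraph G C"
    have H: "simple_graph ?H" "connected_graph ?H"
      using simple_comp_at[OF G v(1)] connected_comp_at[of G v] v by (simp_all add: comp_at_def)
    have E: "edges ?H = ?E C" by (simp add: induced_subgraph_def)
    show "card C \<le> card (?E C) + (if C \<in> tree_comps G then 1 else 0)"
    proof (cases "C \<in> tree_comps G")
      case True
      then show ?thesis using connected_card_le[OF H] E by simp
    next
      case False
      then have "\<not> is_tree ?H" using C by (simp add: tree_comps_def)
      then obtain xs where "is_cycle ?H xs" using H by (auto simp: is_tree_def)
      then show ?thesis using connected_cycle_card[OF H] E False by simp
    qed
  qed
  also have "\<dots> = (\<Sum>C\<in>?C. card (?E C)) + card (tree_comps G)"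
  proof -
    have "tree_comps G \<subseteq> ?C" by (auto simp: tree_comps_def)
    then have "?C \<inter> {C. C \<in> tree_comps G} = tree_comps G" by auto
    then show ?thesis using fin by (simp add: sum.distrib flip: sum.inter_filter) (simp add: Int_def)
  qed
  also have "(\<Sum>C\<in>?C. card (?E C)) = card (\<Union>C\<in>?C. ?E C)"
  proof (rule card_UN_disjoint[symmetric, OF fin(1)])
    show "\<forall>C\<in>?C. \<forall>D\<in>?C. C \<noteq> D \<longrightarrow> ?E C \<inter> ?E D = {}"
      using cset_partition ne by (smt (verit) Int_emptyI Int_greatest mem_Collect_eq subset_empty)
  qed (use fin in auto)
  also have "\<dots> \<le> card (edges G)" by (rule card_mono) (use fin in auto)
  finally show ?thesis by simp
qed

lemma sum_tree_comps_le:
  assumes G: "simple_graph G" and S: "S \<subseteq> cset G ` verts G"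
  shows "(\<Sum>C\<in>S. card C) \<le> card (verts G)"
proof -
  have fin: "finite S" using finite_csets[OF G] S by (rule finite_subset[rotated])
  have finC: "finite C" if "C \<in> S" for C
    using that S finite_subset[OF cset_subset[OF G] simple_finite(1)[OF G]] by auto
  have "(\<Sum>C\<in>S. card C) = card (\<Union>S)"
  proof (rule card_Union_disjoint[symmetric])
    show "pairwise disjnt S" by (rule pairwiseI) (unfold disjnt_def, meson S cset_partition subsetD)
  qed (rule finC)
  also have "\<dots> \<le> card (verts G)"
    using S Union_csets[OF G] simple_finite(1)[OF G] by (intro card_mono) auto
  finally show ?thesis .
qed

text \<open>A nonstrict bound suffices, because fibres smaller than \<open>M\<close> over a nonempty
  \<open>B\<close> add up to strictly less than \<open>M * card B\<close>.\<close>

lemma pigeonhole_fibre: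
  assumes "finite S" "finite B" "f ` S \<subseteq> B" "M * card B \<le> card S" "S \<noteq> {}"
  obtains y where "y \<in> B" "M \<le> card {x \<in> S. f x = y}"
proof (rule ccontr)
  assume "\<not> thesis"
  with that have lt: "card {x \<in> S. f x = y} < M" if "y \<in> B" for y using not_le that by blast
  have "card S = card (\<Union>y\<in>B. {x \<in> S. f x = y})" using assms(3) by (intro arg_cong[of _ _ card]) auto
  also have "\<dots> \<le> (\<Sum>y\<in>B. card {x \<in> S. f x = y})" using assms(2) by (rule card_UN_le)
  also have "\<dots> < (\<Sum>y\<in>B. M)" using assms lt by (intro sum_strict_mono) auto
  finally show False using assms(4) by (simp add: mult.commute)
qed

text \<open>A graph on \<open>j\<close> numbered vertices is determined by a set of ordered pairs of
  numbers, so there are at most \<open>2 ^ (j * j)\<close> classes. One component from a class of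
  size at least \<open>M\<close> itself serves as the model.\<close>

lemma many_isomorphic_components:
  assumes G: "simple_graph G" and S: "S \<subseteq> cset G ` verts G" and j: "\<And>C. C \<in> S \<Longrightarrow> card C = j"
    and M: "M * 2 ^ (j * j) \<le> card S" "S \<noteq> {}" "0 < M"
  obtains C \<tau> where "C \<in> S" "copies G (induced_subgraph G C) M \<tau>"
proof -
  have fin: "finite S" using finite_csets[OF G] S by (rule finite_subset[rotated])
  have finC: "finite C" if "C \<in> S" for C
    using that S finite_subset[OF cset_subset[OF G] simple_finite(1)[OF G]] by auto
  have "\<exists>h. bij_betw h C {0..<j}" if "C \<in> S" for C
    using ex_bij_betw_finite_nat[OF finC[OF that]] j[OF that] by simp
  then obtain h where h: "\<And>C. C \<in> S \<Longrightarrow> bij_betw (h C) C {0..<j}" by metis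
  define code where "code C = {(h C u, h C v) |u v. u \<in> C \<and> v \<in> C \<and> adj G u v}" for C
  have "code C \<subseteq> {0..<j} \<times> {0..<j}" if "C \<in> S" for C
    using h[OF that] by (auto simp: code_def bij_betw_def)
  then have "code ` S \<subseteq> Pow ({0..<j} \<times> {0..<j})" by auto
  moreover have "card (Pow ({0..<j} \<times> {0..<j})) = 2 ^ (j * j)" by (simp add: card_Pow)
  ultimately obtain y where y: "M \<le> card {C \<in> S. code C = y}"
    using pigeonhole_fibre[OF fin, of "Pow ({0..<j} \<times> {0..<j})" code M thesis] M
    by (metis finite_Pow_iff finite_SigmaI finite_atLeastLessThan)
  then obtain S' where S': "S' \<subseteq> {C \<in> S. code C = y}" "card S' = M" by (meson obtain_subset_with_card_n)
  then have finS': "finite S'" using fin by (auto intro: finite_subset)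
  obtain g where g: "bij_betw g {0..<M} S'" using ex_bij_betw_nat_finite[OF finS'] S'(2) by auto
  have gS: "g i \<in> S" "code (g i) = y" if "i < M" for i
  proof -
    have "g i \<in> S'" using g that by (auto simp: bij_betw_def)
    then show "g i \<in> S" "code (g i) = y" using S'(1) by auto
  qed
  define C0 where "C0 = g 0"
  have C0: "C0 \<in> S" "code C0 = y" using gS[OF M(3)] by (auto simp: C0_def)
  \<comment> \<open>The numbering of \<open>C0\<close> followed by the inverse numbering of
    \<open>g i\<close> is an isomorphism, because both components have code
    \<open>y\<close>.\<close>
  define \<tau> where "\<tau> i x = inv_into (g i) (h (g i)) (h C0 x)" for i x
  have bij: "bij_betw (\<tau> i) C0 (g i)" if "i < M" for i
    using bij_betw_trans[OF h[OF C0(1)] bij_betw_inv_into[OF h[OF gS(1)[OF that]]]]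
    by (simp add: \<tau>_def[abs_def] comp_def)
  have h\<tau>: "h (g i) (\<tau> i x) = h C0 x" if "i < M" "x \<in> C0" for i x
    using h[OF gS(1)[OF that(1)]] h[OF C0(1)] that(2)
    by (auto simp: \<tau>_def bij_betw_def intro!: f_inv_into_f)
  have closed: "w \<in> g i" if i: "i < M" and u: "u \<in> g i" "adj G u w" for i u w
  proof -
    obtain v where "g i = cset G v" using gS(1)[OF i] S by blast
    with u show ?thesis by (simp add: cset_adj)
  qed
  have codeI: "(h C u, h C v) \<in> code C" if "u \<in> C" "v \<in> C" "adj G u v" for C u v
    using that by (auto simp: code_def)
  have codeE: "\<exists>u v. u \<in> C \<and> v \<in> C \<and> adj G u v \<and> h C u = a \<and> h C v = b" if "(a, b) \<in> code C" for C a b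
    using that by (auto simp: code_def)
  have injh: "u = v" if "C \<in> S" "u \<in> C" "v \<in> C" "h C u = h C v" for C u v
    using h[OF that(1)] that by (auto simp: bij_betw_def inj_on_def)
  have "copies G (induced_subgraph G C0) M \<tau>"
    unfolding copies_def
  proof (intro conjI allI impI ballI)
    fix i assume i: "i < M"
    show "inj_on (\<tau> i) (verts (induced_subgraph G C0))" using bij[OF i] by (simp add: bij_betw_def)
    show "\<tau> i ` verts (induced_subgraph G C0) \<subseteq> verts G"
      using bij[OF i] gS(1)[OF i] S cset_subset[OF G] by (auto simp: bij_betw_def)
    show "\<tau> i ` verts (induced_subgraph G C0) \<inter> \<tau> k ` verts (induced_subgraph G C0) = {}"
      if "k < M" "i \<noteq> k" for k
    proof -
      have "g i \<noteq> g k" using g i that by (auto simp: bij_betw_def inj_on_def)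
      moreover have "g i \<in> cset G ` verts G" "g k \<in> cset G ` verts G"
        using gS(1)[OF i] gS(1)[OF that(1)] S by auto
      ultimately have "g i \<inter> g k = {}" by (intro cset_partition)
      then show ?thesis using bij[OF i] bij[OF that(1)] by (simp add: bij_betw_def)
    qed
    fix x w assume "x \<in> verts (induced_subgraph G C0)"
    then have x: "x \<in> C0" by simp
    have \<tau>x: "\<tau> i x \<in> g i" using bij[OF i] x by (auto simp: bij_betw_def)
    show "adj G (\<tau> i x) w \<longleftrightarrow>
            (\<exists>z\<in>verts (induced_subgraph G C0). w = \<tau> i z \<and> adj (induced_subgraph G C0) x z)"
    proof
      assume a: "adj G (\<tau> i x) w"
      then have w: "w \<in> g i" using closed[OF i \<tau>x] by simp
      then have "(h C0 x, h (g i) w) \<in> code (g i)" using codeI[OF \<tau>x w a] h\<tau>[OF i x] by simp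
      then obtain u v where uv: "u \<in> C0" "v \<in> C0" "adj G u v" "h C0 u = h C0 x" "h C0 v = h (g i) w"
        using gS(2)[OF i] C0(2) codeE[of "h C0 x" "h (g i) w" C0] by auto
      have "u = x" using injh[OF C0(1) uv(1) x uv(4)] .
      moreover have "\<tau> i v \<in> g i" using bij[OF i] uv(2) by (auto simp: bij_betw_def)
      then have "w = \<tau> i v" using injh[OF gS(1)[OF i] w] h\<tau>[OF i uv(2)] uv(5) by simp
      ultimately show "\<exists>z\<in>verts (induced_subgraph G C0). w = \<tau> i z \<and> adj (induced_subgraph G C0) x z"
        using uv by (intro bexI[of _ v]) (auto simp: adj_induced)
    next
      assume "\<exists>z\<in>verts (induced_subgraph G C0). w = \<tau> i z \<and> adj (induced_subgraph G C0) x z"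
      then obtain z where z: "z \<in> C0" "w = \<tau> i z" "adj G x z" by (auto simp: adj_induced)
      have w: "w \<in> g i" using bij[OF i] z by (auto simp: bij_betw_def)
      have "(h C0 x, h C0 z) \<in> code C0" using codeI[OF x z(1,3)] .
      then obtain u v where uv: "u \<in> g i" "v \<in> g i" "adj G u v" "h (g i) u = h C0 x" "h (g i) v = h C0 z"
        using gS(2)[OF i] C0(2) codeE[of "h C0 x" "h C0 z" "g i"] by auto
      have "u = \<tau> i x" using injh[OF gS(1)[OF i] uv(1) \<tau>x] uv(4) h\<tau>[OF i x] by simp
      moreover have "v = w" using injh[OF gS(1)[OF i] uv(2) w] uv(5) h\<tau>[OF i z(1)] z(2) by simp
      ultimately show "adj G (\<tau> i x) w" using uv by simp
    qed
  qed
  with C0 show ?thesis using that by blast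
qed

lemma many_tree_comps:
  assumes G: "simple_graph (G :: 'a sgraph)" and M: "0 < M" "M * 2 ^ (j * j) \<le> card {C \<in> tree_comps G. card C = j}"
  obtains T :: "'a sgraph" and \<tau> where "is_tree T" "card (verts T) = j" "copies G T M \<tau>"
proof -
  let ?S = "{C \<in> tree_comps G. card C = j}"
  have "0 < card ?S" using M by (meson less_le_trans mult_pos_pos pos2 zero_less_power)
  then have "?S \<noteq> {}" by (metis card.empty less_irrefl)
  moreover have "?S \<subseteq> cset G ` verts G" by (auto simp: tree_comps_def)
  ultimately obtain C \<tau> where "C \<in> ?S" "copies G (induced_subgraph G C) M \<tau>"
    using many_isomorphic_components[OF G, of ?S j M] M by blast
  then show ?thesis using that[of "induced_subgraph G C" \<tau>] by (auto simp: tree_comps_def)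
qed

subsection \<open>Saturated graphs in every residue class\<close>

definition new_verts :: "'a sgraph \<Rightarrow> 'b sgraph \<Rightarrow> 'a set" where
  "new_verts F T = {x \<in> verts F. \<not> contains T (comp_at F x)}"

lemma new_verts_subset: "new_verts F T \<subseteq> verts F"
  by (auto simp: new_verts_def)

lemma new_verts_cset: "simple_graph F \<Longrightarrow> x \<in> new_verts F T \<Longrightarrow> u \<in> cset F x \<Longrightarrow> u \<in> new_verts F T"
  using cset_subset[of F x] comp_at_eq[of u F x] by (auto simp: new_verts_def)

lemma new_verts_adj: "simple_graph F \<Longrightarrow> x \<in> new_verts F T \<Longrightarrow> adj F x y \<Longrightarrow> y \<in> new_verts F T"
  using new_verts_cset adj_cset by metis

text \<open>A component of \<open>F\<close> that embeds into \<open>T\<close> is free once there are many copies of \<open>T\<close>, so only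
  the remaining vertices of \<open>F\<close> matter.\<close>

lemma contains_by_new_verts:
  assumes F: "simple_graph F"
    and g: "inj_on g (new_verts F T)" "g ` new_verts F T \<subseteq> verts G"
      "\<And>x y. x \<in> new_verts F T \<Longrightarrow> adj F x y \<Longrightarrow> adj G (g x) (g y)"
    and \<tau>: "\<And>i. i < M \<Longrightarrow> emb (\<tau> i) T G"
      "\<And>i j. i < M \<Longrightarrow> j < M \<Longrightarrow> i \<noteq> j \<Longrightarrow> \<tau> i ` verts T \<inter> \<tau> j ` verts T = {}"
    and M: "2 * card (verts F) \<le> M"
  shows "contains G F"
proof -
  let ?N = "new_verts F T" and ?C = "cset F ` verts F"
  \<comment> \<open>The image of \<open>g\<close> spoils at most \<open>card (verts F)\<close>
    copies, and at most that many components want a copy of their own; hence the factor 2 in the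
    bound on \<open>M\<close>.\<close>
  let ?U = "{i. i < M \<and> \<tau> i ` verts T \<inter> g ` ?N = {}}"
  have finF: "finite (verts F)" using simple_finite F by auto
  then have finN: "finite ?N" using new_verts_subset by (rule finite_subset[rotated])
  have "M \<le> card ?U + card (g ` ?N)" using finN \<tau>(2) by (intro unused_indices) auto
  moreover have "card (g ` ?N) \<le> card (verts F)"
    using card_image_le[OF finN, of g] card_mono[OF finF new_verts_subset] by (meson le_trans)
  moreover have "card ?C \<le> card (verts F)" using finF by (rule card_image_le)
  ultimately have "card ?C \<le> card ?U" using M by linarith
  then obtain \<iota> where \<iota>: "inj_on \<iota> ?C" "\<iota> ` ?C \<subseteq> ?U"
    using inj_on_iff_card_le[of ?C ?U] finF by auto
  \<comment> \<open>Chosen for the vertex set of a component rather than for a vertex, so that all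
    vertices of one component share the same embedding.\<close>
  define e where "e C = (SOME f. emb f (induced_subgraph F C) T)" for C
  have e: "emb (e (cset F x)) (comp_at F x) T" if "x \<in> verts F - ?N" for x
    using that someI_ex[of "\<lambda>f. emb f (comp_at F x) T"]
    by (auto simp: new_verts_def contains_iff_emb comp_at_def e_def)
  have \<iota>U: "\<iota> (cset F x) < M" "\<tau> (\<iota> (cset F x)) ` verts T \<inter> g ` ?N = {}" if "x \<in> verts F" for x
    using \<iota>(2) that by auto
  have eT: "e (cset F x) x \<in> verts T" if "x \<in> verts F - ?N" for x
    using e[OF that] by (auto simp: emb_def)
  define f where "f x = (if x \<in> ?N then g x else \<tau> (\<iota> (cset F x)) (e (cset F x) x))" for x
  have fo: "f x \<in> \<tau> (\<iota> (cset F x)) ` verts T" if "x \<in> verts F - ?N" for x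
    using that eT by (auto simp: f_def)
  have "emb f F G"
  proof (rule embI[OF F])
    show "inj_on f (verts F)"
    proof (rule inj_onI)
      fix x y assume xy: "x \<in> verts F" "y \<in> verts F" "f x = f y"
      have no: False if "u \<in> ?N" "w \<in> verts F - ?N" "f u = f w" for u w
      proof -
        have "f u \<in> g ` ?N" using that(1) by (simp add: f_def)
        then show False using fo[OF that(2)] \<iota>U(2)[of w] that by auto
      qed
      consider "x \<in> ?N" "y \<in> ?N" | "x \<in> verts F - ?N" "y \<in> verts F - ?N"
        using no[of x y] no[of y x] xy by auto
      then show "x = y"
      proof cases
        case 1
        then show ?thesis using xy(3) g(1) by (auto simp: f_def dest: inj_onD)
      next
        case 2
        have "\<iota> (cset F x) = \<iota> (cset F y)"
        proof (rule ccontr)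
          assume "\<iota> (cset F x) \<noteq> \<iota> (cset F y)"
          from \<tau>(2)[OF \<iota>U(1)[OF xy(1)] \<iota>U(1)[OF xy(2)] this] show False
            using fo[OF 2(1)] fo[OF 2(2)] xy(3) by auto
        qed
        then have c: "cset F x = cset F y" using \<iota>(1) xy by (auto dest: inj_onD)
        then have "y \<in> cset F x" by simp
        moreover have "e (cset F x) x = e (cset F x) y"
          using xy(3) 2 c \<tau>(1)[OF \<iota>U(1)[OF xy(1)]] eT[OF 2(1)] eT[OF 2(2)]
          by (auto simp: f_def emb_def dest: inj_onD)
        ultimately show ?thesis using e[OF 2(1)] by (auto simp: emb_def dest: inj_onD)
      qed
    qed
    show "f ` verts F \<subseteq> verts G"
    proof
      fix z assume "z \<in> f ` verts F"
      then obtain x where x: "x \<in> verts F" "z = f x" by auto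
      show "z \<in> verts G"
      proof (cases "x \<in> ?N")
        case True
        then show ?thesis using x g(2) by (auto simp: f_def)
      next
        case False
        then show ?thesis using fo[of x] x \<tau>(1)[OF \<iota>U(1)[OF x(1)]] by (auto simp: emb_def)
      qed
    qed
    fix u v assume uv: "adj F u v"
    then have u: "u \<in> verts F" and v: "v \<in> verts F" using simple_adjD[OF F] by auto
    show "adj G (f u) (f v)"
    proof (cases "u \<in> ?N")
      case True
      then show ?thesis using g(3)[OF True uv] new_verts_adj[OF F True uv] by (simp add: f_def)
    next
      case False
      then have v': "v \<notin> ?N" using new_verts_adj[OF F _ adj_sym[OF uv]] by blast
      have "v \<in> cset F u" using uv by (rule adj_cset)
      then have c: "cset F v = cset F u" by (rule cset_eq)
      have "adj T (e (cset F u) u) (e (cset F u) v)"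
        using uv by (intro emb_adj[OF e[of u]]) (auto simp: adj_comp_at False u)
      from emb_adj[OF \<tau>(1)[OF \<iota>U(1)[OF u]] this] show ?thesis using False v' c by (simp add: f_def)
    qed
  qed
  then show ?thesis using contains_iff_emb by blast
qed

section \<open>Host graphs and their saturated extensions\<close>

datatype hvert = Clq nat | Pend nat | Cp nat nat

text \<open>A clique \<open>Clq 0, \<dots>, Clq (m - 1)\<close>, further vertices \<open>Pend j\<close> with \<open>j < p\<close>, each of which is
  a leaf hanging at \<open>Clq (j mod m)\<close> or (if \<open>\<not> att\<close>) isolated, and \<open>M\<close> copies of \<open>T\<close>.\<close>

fun host_rel :: "nat sgraph \<Rightarrow> bool \<Rightarrow> nat \<Rightarrow> hvert \<Rightarrow> hvert \<Rightarrow> bool" where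
  "host_rel T att m (Clq a) (Clq b) \<longleftrightarrow> a \<noteq> b"
| "host_rel T att m (Clq a) (Pend j) \<longleftrightarrow> att \<and> a = j mod m"
| "host_rel T att m (Pend j) (Clq a) \<longleftrightarrow> att \<and> a = j mod m"
| "host_rel T att m (Cp i x) (Cp k y) \<longleftrightarrow> i = k \<and> adj T x y"
| "host_rel T att m _ _ \<longleftrightarrow> False"

definition host_core :: "nat \<Rightarrow> nat \<Rightarrow> hvert set" where
  "host_core m p = Clq ` {..<m} \<union> Pend ` {..<p}"

definition host_verts :: "nat sgraph \<Rightarrow> nat \<Rightarrow> nat \<Rightarrow> nat \<Rightarrow> hvert set" where
  "host_verts T m p M = host_core m p \<union> (\<Union>i<M. Cp i ` verts T)"

definition host :: "nat sgraph \<Rightarrow> bool \<Rightarrow> nat \<Rightarrow> nat \<Rightarrow> nat \<Rightarrow> hvert sgraph" where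
  "host T att m p M = SGraph (host_verts T m p M)
     {{u, v} |u v. u \<in> host_verts T m p M \<and> v \<in> host_verts T m p M \<and> host_rel T att m u v}"

lemma host_rel_sym: "host_rel T att m u v \<Longrightarrow> host_rel T att m v u"
  by (cases u; cases v) (auto intro: adj_sym)

lemma verts_host [simp]: "verts (host T att m p M) = host_verts T m p M"
  by (simp add: host_def)

lemma adj_host: "adj (host T att m p M) u v \<longleftrightarrow>
    u \<in> host_verts T m p M \<and> v \<in> host_verts T m p M \<and> host_rel T att m u v"
  by (auto simp: adj_def host_def doubleton_eq_iff intro: host_rel_sym)

lemma host_verts_simps [simp]:
  "Clq a \<in> host_verts T m p M \<longleftrightarrow> a < m" "Pend j \<in> host_verts T m p M \<longleftrightarrow> j < p"
  "Cp i x \<in> host_verts T m p M \<longleftrightarrow> i < M \<and> x \<in> verts T"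
  "Clq a \<in> host_core m p \<longleftrightarrow> a < m" "Pend j \<in> host_core m p \<longleftrightarrow> j < p"
  "Cp i x \<notin> host_core m p"
  by (auto simp: host_verts_def host_core_def)

lemma host_core_subset: "host_core m p \<subseteq> host_verts T m p M"
  by (auto simp: host_verts_def)

lemma simple_host:
  assumes "simple_graph T"
  shows "simple_graph (host T att m p M)"
proof -
  have "host_rel T att m u v \<Longrightarrow> u \<noteq> v" for u v
    using simple_adjD[OF assms] by (cases u; cases v) auto
  moreover have "finite (host_verts T m p M)"
    using simple_finite[OF assms] by (simp add: host_verts_def host_core_def)
  ultimately show ?thesis
    by (auto simp: simple_graph_def host_def vpairs_def)
qed

lemma card_host_core: "card (host_core m p) = m + p"
  unfolding host_core_def by (subst card_Un_disjoint) (auto simp: card_image inj_on_def)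

lemma card_host_verts:
  assumes "finite (verts T)"
  shows "card (host_verts T m p M) = m + p + M * card (verts T)"
proof -
  have "card (\<Union>i<M. Cp i ` verts T) = (\<Sum>i<M. card (Cp i ` verts T))"
    using assms by (intro card_UN_disjoint) auto
  also have "\<dots> = M * card (verts T)" by (simp add: card_image inj_on_def)
  finally have c: "card (\<Union>i<M. Cp i ` verts T) = M * card (verts T)" .
  have "card (host_verts T m p M) = card (host_core m p) + card (\<Union>i<M. Cp i ` verts T)"
    unfolding host_verts_def using assms by (intro card_Un_disjoint) (auto simp: host_core_def)
  then show ?thesis by (simp add: c card_host_core)
qed

text \<open>An embedding of the subgraph of \<open>F\<close> induced by \<open>W\<close> with
  targets confined to \<open>Z\<close>; it lets parts of \<open>F'\<close> be placed separately and
  glued.\<close>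

definition embeds_on :: "'a sgraph \<Rightarrow> 'a set \<Rightarrow> 'c sgraph \<Rightarrow> 'c set \<Rightarrow> bool" where
  "embeds_on F W G Z \<longleftrightarrow> (\<exists>g. inj_on g W \<and> g ` W \<subseteq> Z \<and>
     (\<forall>x\<in>W. \<forall>y\<in>W. adj F x y \<longrightarrow> adj G (g x) (g y)))"

lemma embeds_onE:
  assumes "embeds_on F W G Z"
  obtains g where "inj_on g W" "g ` W \<subseteq> Z"
    "\<And>x y. x \<in> W \<Longrightarrow> y \<in> W \<Longrightarrow> adj F x y \<Longrightarrow> adj G (g x) (g y)"
proof -
  from assms obtain g where "inj_on g W \<and> g ` W \<subseteq> Z \<and>
     (\<forall>x\<in>W. \<forall>y\<in>W. adj F x y \<longrightarrow> adj G (g x) (g y))"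
    unfolding embeds_on_def by (rule exE)
  then show ?thesis by (intro that[of g]) simp_all
qed

lemma embeds_onI:
  assumes "inj_on g W" "g ` W \<subseteq> Z"
    "\<And>x y. x \<in> W \<Longrightarrow> y \<in> W \<Longrightarrow> adj F x y \<Longrightarrow> adj G (g x) (g y)"
  shows "embeds_on F W G Z"
  unfolding embeds_on_def using assms by (intro exI[of _ g]) simp

text \<open>Conditions on the core under which a saturated extension keeps \<open>n\<close> copies
  of \<open>T\<close> as components: \<open>free\<close> makes the host \<open>F\<close>-free,
  \<open>rest\<close> excludes new edges inside and between copies, and \<open>touch\<close> lets
  each core vertex reach at most \<open>q\<close> copies. The \<open>m + p\<close> core vertices
  thus spoil at most \<open>q * (m + p)\<close> copies.\<close>

lemma host_saturated:
  assumes F: "simple_graph F" and T: "good_tree F T"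
    and free: "\<not> embeds_on F (new_verts F T) (host T att m p M) (host_core m p)"
    and rest: "\<And>x. x \<in> new_verts F T \<Longrightarrow>
      embeds_on F (new_verts F T - cset F x) (host T att m p M) (host_core m p)"
    and touch: "\<And>G h J. verts G = host_verts T m p M \<Longrightarrow> edges (host T att m p M) \<subseteq> edges G \<Longrightarrow>
      h \<in> host_core m p \<Longrightarrow> J \<subseteq> {..<M} \<Longrightarrow> q < card J \<Longrightarrow> \<forall>j\<in>J. \<exists>x\<in>verts T. adj G h (Cp j x) \<Longrightarrow>
      embeds_on F (new_verts F T) G (host_verts T m p M)"
    and M: "2 * card (verts F) \<le> M" "n + q * (m + p) \<le> M"
  shows "\<exists>(G :: hvert sgraph) \<tau>. saturated F G \<and> card (verts G) = m + p + M * card (verts T) \<and> copies G T n \<tau>"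
proof -
  let ?B = "host T att m p M" and ?N = "new_verts F T" and ?V = "host_verts T m p M"
  have sT: "simple_graph T" using T by (simp add: good_tree_def is_tree_def)
  have sB: "simple_graph ?B" using simple_host[OF sT] .
  have cpB: "adj ?B (Cp i x) w \<longleftrightarrow> (\<exists>y\<in>verts T. w = Cp i y \<and> adj T x y)" if "i < M" "x \<in> verts T" for i x w
    using that simple_adjD[OF sT, of x] by (cases w) (auto simp: adj_host)
  have "\<not> contains ?B F"
  proof
    assume "contains ?B F"
    then obtain f where f: "emb f F ?B" using contains_iff_emb by blast
    \<comment> \<open>In the host a copy of \<open>T\<close> is closed under adjacency, so a
      component that does not embed into \<open>T\<close> avoids all copies.\<close>
    have "f x \<in> host_core m p" if x: "x \<in> ?N" for x
    proof (rule ccontr)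
      assume "f x \<notin> host_core m p"
      moreover have xF: "x \<in> verts F" using x by (auto simp: new_verts_def)
      ultimately obtain i y where i: "i < M" "y \<in> verts T" "f x = Cp i y"
        using f by (auto simp: emb_def host_verts_def)
      have "contains T (comp_at F x)"
      proof (rule closed_pullback[OF F f xF])
        show "inj_on (Cp i) (verts T)" by (simp add: inj_on_def)
        show "f x \<in> Cp i ` verts T" using i by simp
        show "\<exists>b\<in>verts T. w = Cp i b \<and> adj T a b" if "a \<in> verts T" "adj ?B (Cp i a) w" for a w
          using cpB[OF i(1) that(1)] that(2) by blast
      qed
      with x show False by (simp add: new_verts_def)
    qed
    then have "embeds_on F ?N ?B (host_core m p)"
      using f emb_adj[OF f]
      by (intro embeds_onI[of f]) (auto simp: emb_def intro: inj_on_subset[OF _ new_verts_subset])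
    with free show False by simp
  qed
  with sB obtain G where G: "saturated F G" "verts G = ?V" "edges ?B \<subseteq> edges G"
    using extend_saturated by (metis verts_host)
  have nc: "\<not> contains G F" and sG: "simple_graph G" using G(1) by (auto simp: saturated_def)
  have BG: "adj G u v" if "adj ?B u v" for u v using that G(3) by (auto simp: adj_def)
  \<comment> \<open>The components that embed into \<open>T\<close> could always be supplied by the
    copies, so \<open>F'\<close> alone must be missing from \<open>G\<close>.\<close>
  have noemb: "\<not> embeds_on F ?N G ?V"
  proof
    assume "embeds_on F ?N G ?V"
    then obtain g where g: "inj_on g ?N" "g ` ?N \<subseteq> ?V"
      "\<And>x y. x \<in> ?N \<Longrightarrow> y \<in> ?N \<Longrightarrow> adj F x y \<Longrightarrow> adj G (g x) (g y)" by (rule embeds_onE) blast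
    have cpe: "emb (Cp i) T G" if i: "i < M" for i
    proof (rule embI[OF sT])
      show "inj_on (Cp i) (verts T)" by (simp add: inj_on_def)
      show "Cp i ` verts T \<subseteq> verts G" unfolding G(2) by (rule image_subsetI) (simp add: i)
      show "adj G (Cp i u) (Cp i v)" if "adj T u v" for u v
        using that i simple_adjD[OF sT that] by (intro BG) (simp add: adj_host)
    qed
    have cpd: "Cp i ` verts T \<inter> Cp j ` verts T = {}" if "i < M" "j < M" "i \<noteq> j" for i j using that by auto
    have gi: "g ` ?N \<subseteq> verts G" using g(2) G(2) by simp
    have ga: "adj G (g x) (g y)" if "x \<in> ?N" "adj F x y" for x y
      using g(3)[OF that(1) new_verts_adj[OF F that] that(2)] .
    have "contains G F" using contains_by_new_verts[where \<tau> = Cp, OF F g(1) gi ga cpe cpd M(1)] .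
    with nc show False ..
  qed
  \<comment> \<open>If a component of \<open>F'\<close> lay outside the core, \<open>rest\<close>
    would place the others inside the core, disjoint from it.\<close>
  have nonew: "\<not> contains_new_component D F T"
    if inj: "inj_on \<sigma> (verts D)" and im: "\<sigma> ` verts D \<subseteq> ?V - host_core m p"
      and ad: "\<And>a b. adj D a b \<Longrightarrow> adj G (\<sigma> a) (\<sigma> b)" for D :: "'z sgraph" and \<sigma>
  proof
    assume "contains_new_component D F T"
    then obtain z where z: "z \<in> verts F" "contains D (comp_at F z)" "\<not> contains T (comp_at F z)"
      by (auto simp: contains_new_component_def components_of_eq)
    then obtain \<phi> where \<phi>: "emb \<phi> (comp_at F z) D" using contains_iff_emb by blast
    have zN: "z \<in> ?N" using z by (simp add: new_verts_def)
    obtain g where g: "inj_on g (?N - cset F z)" "g ` (?N - cset F z) \<subseteq> host_core m p"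
      "\<And>x y. x \<in> ?N - cset F z \<Longrightarrow> y \<in> ?N - cset F z \<Longrightarrow> adj F x y \<Longrightarrow> adj ?B (g x) (g y)"
      using rest[OF zN] by (rule embeds_onE) blast
    define f where "f x = (if x \<in> cset F z then \<sigma> (\<phi> x) else g x)" for x
    have \<sigma>\<phi>: "\<sigma> (\<phi> x) \<in> ?V - host_core m p" if "x \<in> cset F z" for x
      using that \<phi> im by (auto simp: emb_def)
    have "embeds_on F ?N G ?V"
    proof (rule embeds_onI)
      show "inj_on f ?N"
      proof (rule inj_onI)
        fix x y assume xy: "x \<in> ?N" "y \<in> ?N" "f x = f y"
        have no: False if "u \<in> cset F z" "w \<in> ?N - cset F z" "f u = f w" for u w
          using \<sigma>\<phi>[OF that(1)] g(2) that by (auto simp: f_def)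
        consider "x \<in> cset F z" "y \<in> cset F z" | "x \<in> ?N - cset F z" "y \<in> ?N - cset F z"
          using no[of x y] no[of y x] xy by auto
        then show "x = y"
        proof cases
          case 1
          then have "\<phi> x = \<phi> y" using xy(3) inj \<phi> by (auto simp: f_def emb_def dest: inj_onD)
          with 1 \<phi> show ?thesis by (auto simp: emb_def dest: inj_onD)
        next
          case 2
          then show ?thesis using xy(3) g(1) by (auto simp: f_def dest: inj_onD)
        qed
      qed
      show "f ` ?N \<subseteq> ?V" using \<sigma>\<phi> g(2) host_core_subset[of m p T M] by (auto simp: f_def)
      fix x y assume xy: "x \<in> ?N" "y \<in> ?N" "adj F x y"
      show "adj G (f x) (f y)"
      proof (cases "x \<in> cset F z")
        case True
        then have "y \<in> cset F z" using xy(3) by (rule cset_adj)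
        moreover have "adj D (\<phi> x) (\<phi> y)" using True xy(3) by (intro emb_adj[OF \<phi>]) (simp add: adj_comp_at)
        ultimately show ?thesis using True ad by (simp add: f_def)
      next
        case False
        then have "y \<notin> cset F z" using cset_adj[OF _ adj_sym[OF xy(3)]] by blast
        with False show ?thesis using g(3) xy BG by (simp add: f_def)
      qed
    qed
    with noemb show False ..
  qed
  \<comment> \<open>By goodness of \<open>T\<close>, any additional edge among the copies would
    create a component of \<open>F'\<close> outside the core.\<close>
  have inner: "i = k \<and> adj T x y" if a: "adj G (Cp i x) (Cp k y)" for i k x y
  proof (rule ccontr)
    assume no: "\<not> ?thesis"
    have V: "i < M" "x \<in> verts T" "k < M" "y \<in> verts T" and ne: "Cp i x \<noteq> Cp k y"
      using simple_adjD[OF sG a] G(2) by auto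
    have cp: "adj G (Cp i u) (Cp i v)" if "i < M" "adj T u v" for i u v
      using that simple_adjD[OF sT that(2)] by (intro BG) (simp add: adj_host)
    show False
    proof (cases "i = k")
      case True
      then have "{x, y} \<in> non_edges T" using no V ne by (auto simp: non_edge_iff)
      then have "contains_new_component (add_edge T {x, y}) F T" using T by (simp add: good_tree_def)
      moreover have "\<not> contains_new_component (add_edge T {x, y}) F T"
        by (rule nonew[of "Cp i"])
          (use V True a adj_sym[OF a] cp in \<open>auto simp: inj_on_def adj_add_edge doubleton_eq_iff\<close>)
      ultimately show False by simp
    next
      case False
      let ?D = "add_edge (double T) {Inl x, Inr y}"
      have "contains_new_component ?D F T" using T V by (simp add: good_tree_def)
      moreover have "\<not> contains_new_component ?D F T"
      proof (rule nonew[of "case_sum (Cp i) (Cp k)"])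
        show "inj_on (case_sum (Cp i) (Cp k)) (verts ?D)"
          using False by (auto simp: inj_on_def)
        show "case_sum (Cp i) (Cp k) ` verts ?D \<subseteq> ?V - host_core m p" using V by auto
        fix b c assume "adj ?D b c"
        then have "adj (double T) b c \<or> b = Inl x \<and> c = Inr y \<or> b = Inr y \<and> c = Inl x"
          by (auto simp: adj_add_edge doubleton_eq_iff)
        then show "adj G (case_sum (Cp i) (Cp k) b) (case_sum (Cp i) (Cp k) c)"
          using a adj_sym[OF a] cp V by (cases b; cases c) (auto simp: adj_double)
      qed
      ultimately show False by simp
    qed
  qed
  define J where "J h = {j. j < M \<and> (\<exists>x\<in>verts T. adj G h (Cp j x))}" for h
  have J: "card (J h) \<le> q" if "h \<in> host_core m p" for h
  proof (rule ccontr)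
    assume "\<not> ?thesis"
    then have "embeds_on F ?N G ?V"
      using that by (intro touch[OF G(2,3), of h "J h"]) (auto simp: J_def)
    with noemb show False ..
  qed
  let ?Bad = "\<Union>h\<in>host_core m p. J h" and ?Good = "{..<M} - (\<Union>h\<in>host_core m p. J h)"
  have finc: "finite (host_core m p)" by (simp add: host_core_def)
  have "card ?Bad \<le> (\<Sum>h\<in>host_core m p. card (J h))" using finc by (rule card_UN_le)
  also have "\<dots> \<le> (m + p) * q"
    using sum_bounded_above[of "host_core m p" "\<lambda>h. card (J h)" q] J by (simp add: card_host_core)
  finally have "card ?Bad \<le> q * (m + p)" by (simp add: mult.commute)
  moreover have "card {..<M} - card ?Bad \<le> card ?Good"
    by (rule diff_card_le_card_Diff) (auto simp: J_def host_core_def)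
  ultimately have "card {..<n} \<le> card ?Good" using M(2) by simp
  then obtain \<iota> where \<iota>: "inj_on \<iota> {..<n}" "\<iota> ` {..<n} \<subseteq> ?Good"
    using inj_on_iff_card_le[of "{..<n}" ?Good] by auto
  have "copies G T n (\<lambda>i. Cp (\<iota> i))"
    unfolding copies_def
  proof (intro conjI allI impI ballI)
    fix i assume i: "i < n"
    then have iM: "\<iota> i < M" "\<And>h. h \<in> host_core m p \<Longrightarrow> \<iota> i \<notin> J h" using \<iota>(2) by auto
    show "inj_on (Cp (\<iota> i)) (verts T)" by (simp add: inj_on_def)
    show "Cp (\<iota> i) ` verts T \<subseteq> verts G" using iM G(2) by auto
    show "Cp (\<iota> i) ` verts T \<inter> Cp (\<iota> j) ` verts T = {}" if "j < n" "i \<noteq> j" for j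
      using \<iota>(1) i that by (auto dest: inj_onD)
    fix x w assume x: "x \<in> verts T"
    show "adj G (Cp (\<iota> i) x) w \<longleftrightarrow> (\<exists>y\<in>verts T. w = Cp (\<iota> i) y \<and> adj T x y)"
    proof
      assume a: "adj G (Cp (\<iota> i) x) w"
      then have w: "w \<in> ?V" using simple_adjD[OF sG a] G(2) by simp
      have "w \<notin> host_core m p" using iM adj_sym[OF a] x by (auto simp: J_def)
      with w obtain k y where "w = Cp k y" "y \<in> verts T" by (auto simp: host_verts_def)
      with inner a show "\<exists>y\<in>verts T. w = Cp (\<iota> i) y \<and> adj T x y" by blast
    next
      assume "\<exists>y\<in>verts T. w = Cp (\<iota> i) y \<and> adj T x y"
      then show "adj G (Cp (\<iota> i) x) w" using iM x by (intro BG) (auto simp: adj_host)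
    qed
  qed
  moreover have "card (verts G) = m + p + M * card (verts T)"
    using G(2) card_host_verts simple_finite(1)[OF sT] by simp
  ultimately show ?thesis using G(1) by blast
qed

section \<open>Hosts when some component of \<open>F'\<close> is a star\<close>

lemma inj_on_into_lessThan:
  assumes "finite A" "card A \<le> m" "a \<in> A \<longrightarrow> h < m"
  obtains \<alpha> :: "'a \<Rightarrow> nat" where "inj_on \<alpha> A" "\<alpha> ` A \<subseteq> {..<m}" "a \<in> A \<Longrightarrow> \<alpha> a = h"
proof (cases "a \<in> A")
  case True
  then have "card (A - {a}) \<le> card ({..<m} - {h})" using assms by (simp add: card_Diff_singleton)
  then obtain \<beta> where \<beta>: "inj_on \<beta> (A - {a})" "\<beta> ` (A - {a}) \<subseteq> {..<m} - {h}"
    using inj_on_iff_card_le[of "A - {a}" "{..<m} - {h}"] assms(1) by auto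
  have "inj_on (\<beta>(a := h)) A"
  proof (rule inj_onI)
    fix x y assume xy: "x \<in> A" "y \<in> A" "(\<beta>(a := h)) x = (\<beta>(a := h)) y"
    have "\<beta> z \<noteq> h" if "z \<in> A - {a}" for z using \<beta>(2) that by auto
    then show "x = y" using xy \<beta>(1) by (cases "x = a"; cases "y = a") (auto dest: inj_onD)
  qed
  moreover have "(\<beta>(a := h)) ` A \<subseteq> {..<m}" using \<beta>(2) True assms(3) by auto
  ultimately show ?thesis using that by simp
next
  case False
  then show ?thesis using inj_on_iff_card_le[of A "{..<m}"] assms that by auto
qed

text \<open>A component with a single vertex embeds into every nonempty graph.\<close>

lemma new_verts_nbr:
  assumes F: "simple_graph F" and T: "verts T \<noteq> {}" and x: "x \<in> new_verts F T"
  obtains y where "adj F x y"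
proof -
  have "\<exists>y. adj F x y"
  proof (rule ccontr)
    assume no: "\<nexists>y. adj F x y"
    have "u = x" if "u \<in> cset F x" for u
      using that by (induction rule: cset_induct) (use no in auto)
    then have c: "cset F x = {x}" by auto
    obtain t where t: "t \<in> verts T" using T by blast
    have "simple_graph (comp_at F x)" using F x by (intro simple_comp_at) (auto simp: new_verts_def)
    then have "emb (\<lambda>_. t) (comp_at F x) T"
      by (rule embI) (use c t no in \<open>auto simp: adj_comp_at\<close>)
    with x show False by (auto simp: new_verts_def contains_iff_emb)
  qed
  with that show ?thesis by blast
qed

text \<open>The clique is one vertex too small, and isolated host vertices cannot help because
  \<open>F'\<close> has no isolated vertex. If a clique vertex is touched, it takes the centre of
  the star while one leaf moves to the copy. If an isolated vertex is touched, it becomes the centre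
  itself and needs a touched copy for every leaf; hence the tolerance of
  \<open>card (verts F)\<close> copies per core vertex.\<close>

lemma host_saturated_star:
  assumes F: "simple_graph F" and T: "good_tree F (T :: nat sgraph)"
    and c: "c \<in> new_verts F T" and star: "\<And>u w. u \<in> cset F c \<Longrightarrow> adj F u w \<Longrightarrow> u = c \<or> w = c"
    and M: "2 * card (verts F) \<le> M" "n + card (verts F) * (card (new_verts F T) - 1 + p) \<le> M"
  shows "\<exists>(G :: hvert sgraph) \<tau>. saturated F G \<and>
    card (verts G) = card (new_verts F T) - 1 + p + M * card (verts T) \<and> copies G T n \<tau>"
proof (rule host_saturated[OF F T _ _ _ M(1,2)])
  let ?N = "new_verts F T" let ?m = "card ?N - 1" let ?B = "host T False ?m p M"
  have Tne: "verts T \<noteq> {}" using T by (auto simp: good_tree_def is_tree_def connected_graph_def)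
  have finF: "finite (verts F)" using F by (rule simple_finite)
  then have finN: "finite ?N" by (rule finite_subset[OF new_verts_subset])
  have cardN: "0 < card ?N" using c finN by (auto simp: card_gt_0_iff)
  let ?K = "{u. adj F c u}"
  have KF: "?K \<subseteq> verts F" using simple_adjD[OF F] by auto
  then have finK: "finite ?K" using finF by (rule finite_subset)
  have cK: "c \<notin> ?K" using simple_adjD(3)[OF F, of c c] by auto
  have KN: "?K \<subseteq> ?N" using new_verts_adj[OF F c] by auto
  have cs: "cset F c = insert c ?K"
  proof
    show "cset F c \<subseteq> insert c ?K"
    proof
      fix u assume "u \<in> cset F c"
      then show "u \<in> insert c ?K"
      proof (induction rule: cset_induct)
        case (step x y)
        with star[OF step(1,2)] adj_sym show ?case by auto
      qed simp
    qed
  qed (auto intro: adj_cset)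
  have leafK: "y = c" if "u \<in> ?K" "adj F u y" for u y
    using star[of u y] that cs cK by auto
  show "\<not> embeds_on F ?N ?B (host_core ?m p)"
  proof
    assume "embeds_on F ?N ?B (host_core ?m p)"
    then obtain g where g: "inj_on g ?N" "g ` ?N \<subseteq> host_core ?m p"
      "\<And>x y. x \<in> ?N \<Longrightarrow> y \<in> ?N \<Longrightarrow> adj F x y \<Longrightarrow> adj ?B (g x) (g y)" by (rule embeds_onE) blast
    have "g x \<in> Clq ` {..<?m}" if x: "x \<in> ?N" for x
    proof -
      obtain y where y: "adj F x y" using new_verts_nbr[OF F Tne x] .
      then have "adj ?B (g x) (g y)" "g y \<in> host_core ?m p" "g x \<in> host_core ?m p"
        using g x new_verts_adj[OF F x y] by auto
      then show ?thesis by (cases "g x"; cases "g y") (auto simp: adj_host)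
    qed
    then have "card ?N \<le> card (Clq ` {..<?m})" using g(1) by (intro card_inj_on_le) auto
    also have "\<dots> \<le> ?m" by (metis card_image_le card_lessThan finite_lessThan)
    finally show False using cardN by simp
  qed
  show "embeds_on F (?N - cset F x) ?B (host_core ?m p)" if x: "x \<in> ?N" for x
  proof -
    have "?N - cset F x \<subseteq> ?N - {x}" by auto
    then have "card (?N - cset F x) \<le> card (?N - {x})" using finN by (intro card_mono) auto
    also have "\<dots> = ?m" using x by (simp add: card_Diff_singleton)
    finally obtain \<alpha> where \<alpha>: "inj_on \<alpha> (?N - cset F x)" "\<alpha> ` (?N - cset F x) \<subseteq> {..<?m}"
      using inj_on_into_lessThan[of "?N - cset F x" ?m x] finN by (metis DiffE cset_refl finite_Diff)
    show ?thesis
    proof (rule embeds_onI[of "Clq \<circ> \<alpha>"])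
      show "inj_on (Clq \<circ> \<alpha>) (?N - cset F x)" using \<alpha>(1) by (auto simp: inj_on_def)
      show "(Clq \<circ> \<alpha>) ` (?N - cset F x) \<subseteq> host_core ?m p" using \<alpha>(2) by auto
      fix a b assume ab: "a \<in> ?N - cset F x" "b \<in> ?N - cset F x" "adj F a b"
      then have "\<alpha> a \<noteq> \<alpha> b" using \<alpha>(1) simple_adjD(3)[OF F ab(3)] by (auto dest: inj_onD)
      moreover have "\<alpha> a < ?m" "\<alpha> b < ?m" using \<alpha>(2) ab by auto
      ultimately show "adj ?B ((Clq \<circ> \<alpha>) a) ((Clq \<circ> \<alpha>) b)" by (simp add: adj_host)
    qed
  qed
  fix G :: "hvert sgraph" and h J
  assume GV: "verts G = host_verts T ?m p M" and GE: "edges ?B \<subseteq> edges G" and h: "h \<in> host_core ?m p"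
    and J: "J \<subseteq> {..<M}" "card (verts F) < card J" "\<forall>j\<in>J. \<exists>x\<in>verts T. adj G h (Cp j x)"
  have BG: "adj G u v" if "adj ?B u v" for u v using that GE by (auto simp: adj_def)
  have J': "\<forall>j\<in>J. \<exists>x. x \<in> verts T \<and> adj G h (Cp j x)" using J(3) by blast
  then obtain t where t: "\<And>j. j \<in> J \<Longrightarrow> t j \<in> verts T \<and> adj G h (Cp j (t j))" by metis
  have finJ: "finite J" using J(1) by (rule finite_subset) simp
  have clq: "adj G (Clq a) (Clq b)" if "a < ?m" "b < ?m" "a \<noteq> b" for a b
    using that by (intro BG) (simp add: adj_host)
  obtain l where l: "l \<in> ?K" using new_verts_nbr[OF F Tne c] by auto
  show "embeds_on F ?N G (host_verts T ?m p M)"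
  proof (cases h)
    case (Clq a)
    then have a: "a < ?m" using h by simp
    obtain j where j: "j \<in> J" using J(2) by (metis card.empty ex_in_conv not_less_zero)
    have "card (?N - {l}) \<le> ?m" using l KN by (simp add: card_Diff_singleton subset_iff)
    then obtain \<alpha> where \<alpha>: "inj_on \<alpha> (?N - {l})" "\<alpha> ` (?N - {l}) \<subseteq> {..<?m}" "\<alpha> c = a"
      using inj_on_into_lessThan[of "?N - {l}" ?m c a] finN a c l cK
      by (metis Diff_iff finite_Diff singletonD)
    let ?g = "\<lambda>x. if x = l then Cp j (t j) else Clq (\<alpha> x)"
    show ?thesis
    proof (rule embeds_onI[of ?g])
      show "inj_on ?g ?N" using \<alpha>(1) by (auto simp: inj_on_def)
      show "?g ` ?N \<subseteq> host_verts T ?m p M" using \<alpha>(2) t[OF j] J(1) j by auto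
      fix x y assume xy: "x \<in> ?N" "y \<in> ?N" "adj F x y"
      have e: "adj G (Cp j (t j)) (Clq a)" using t[OF j] Clq adj_sym by metis
      consider "x = l" "y = c" | "y = l" "x = c" | "x \<noteq> l" "y \<noteq> l"
        using leafK[OF l] xy(3) adj_sym[OF xy(3)] by metis
      then show "adj G (?g x) (?g y)"
      proof cases
        case 1
        then show ?thesis using e \<alpha>(3) l cK by auto
      next
        case 2
        then show ?thesis using adj_sym[OF e] \<alpha>(3) l cK by auto
      next
        case 3
        then have "\<alpha> x \<noteq> \<alpha> y" using \<alpha>(1) xy simple_adjD(3)[OF F xy(3)] by (auto dest: inj_onD)
        moreover have "\<alpha> x < ?m" "\<alpha> y < ?m" using \<alpha>(2) xy 3 by auto
        ultimately show ?thesis using clq 3 by simp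
      qed
    qed
  next
    case (Pend z)
    have "card ?K \<le> card J" using card_mono[OF finF KF] J(2) by linarith
    then obtain \<kappa> where \<kappa>: "inj_on \<kappa> ?K" "\<kappa> ` ?K \<subseteq> J"
      using inj_on_iff_card_le[OF finK finJ] by blast
    have "card (?N - cset F c) \<le> card (?N - {c})" using finN by (intro card_mono) auto
    also have "\<dots> = ?m" using c by (simp add: card_Diff_singleton)
    finally obtain \<alpha> where \<alpha>: "inj_on \<alpha> (?N - cset F c)" "\<alpha> ` (?N - cset F c) \<subseteq> {..<?m}"
      using inj_on_into_lessThan[of "?N - cset F c" ?m c] finN by (metis DiffE cset_refl finite_Diff)
    let ?g = "\<lambda>x. if x = c then Pend z else if x \<in> ?K then Cp (\<kappa> x) (t (\<kappa> x)) else Clq (\<alpha> x)"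
    have e: "adj G (Pend z) (Cp (\<kappa> x) (t (\<kappa> x)))" if "x \<in> ?K" for x
      using \<kappa>(2) t[of "\<kappa> x"] that Pend by auto
    show ?thesis
    proof (rule embeds_onI[of ?g])
      show "inj_on ?g ?N"
        using \<alpha>(1) \<kappa>(1) unfolding inj_on_def cs by (simp split: if_split)
      show "?g ` ?N \<subseteq> host_verts T ?m p M"
      proof
        fix w assume "w \<in> ?g ` ?N"
        then obtain x where x: "x \<in> ?N" "w = ?g x" by blast
        consider "x = c" | "x \<noteq> c" "x \<in> ?K" | "x \<in> ?N - cset F c" using x cs by auto
        then show "w \<in> host_verts T ?m p M"
        proof cases
          case 1
          then show ?thesis using x h Pend by simp
        next
          case 2
          then have "\<kappa> x \<in> J" using \<kappa>(2) by auto
          then show ?thesis using x 2 t[of "\<kappa> x"] J(1) by auto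
        next
          case 3
          then show ?thesis using x \<alpha>(2) cs by auto
        qed
      qed
      fix x y assume xy: "x \<in> ?N" "y \<in> ?N" "adj F x y"
      show "adj G (?g x) (?g y)"
      proof (cases "x \<in> cset F c")
        case True
        then consider "x = c" "y \<in> ?K" | "y = c" "x \<in> ?K"
          using star[OF True xy(3)] adj_sym[OF xy(3)] xy(3) by auto
        then show ?thesis using e cK adj_sym[OF e] by cases auto
      next
        case False
        then have "y \<notin> cset F c" using cset_adj[OF _ adj_sym[OF xy(3)]] by blast
        with False xy have "\<alpha> x \<noteq> \<alpha> y" "\<alpha> x < ?m" "\<alpha> y < ?m"
          using \<alpha> simple_adjD(3)[OF F xy(3)] by (auto dest: inj_onD)
        then show ?thesis using False \<open>y \<notin> cset F c\<close> clq cs by auto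
      qed
    qed
  next
    case (Cp i x)
    with h show ?thesis by simp
  qed
qed

section \<open>Hosts when no component of \<open>F'\<close> is a star\<close>

locale star_free =
  fixes F :: "'a sgraph" and T :: "nat sgraph"
  assumes F: "simple_graph F" and T: "good_tree F T"
    and new_ne: "new_verts F T \<noteq> {}"
    and no_star: "\<And>c. c \<in> new_verts F T \<Longrightarrow> \<exists>u w. u \<in> cset F c \<and> adj F u w \<and> u \<noteq> c \<and> w \<noteq> c"
begin

abbreviation N where "N \<equiv> new_verts F T"

text \<open>These are the vertices that a pendant host vertex cannot represent. Every other vertex
  of \<open>N\<close> is a leaf, as \<open>F'\<close> has no isolated vertex.\<close>

definition B where "B = {x \<in> N. \<exists>y z. adj F x y \<and> adj F x z \<and> y \<noteq> z}"

definition m where "m = card B - 1"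

lemma sT: "simple_graph T" and Tne: "verts T \<noteq> {}"
  using T by (auto simp: good_tree_def is_tree_def connected_graph_def)

lemma adj_irrefl: "\<not> adj F x x"
  using simple_adjD(3)[OF F] by blast

lemma N_adj: "x \<in> N \<Longrightarrow> adj F x y \<Longrightarrow> y \<in> N"
  by (rule new_verts_adj[OF F])

lemma finN: "finite N"
  using simple_finite(1)[OF F] by (rule finite_subset[OF new_verts_subset])

lemma B_subset: "B \<subseteq> N"
  by (auto simp: B_def)

lemma finB: "finite B"
  using finN by (rule finite_subset[OF B_subset])

lemma leaf_unique: "x \<in> N \<Longrightarrow> x \<notin> B \<Longrightarrow> adj F x y \<Longrightarrow> adj F x z \<Longrightarrow> y = z"
  unfolding B_def by blast

text \<open>Two adjacent leaves would form a component with a single edge, which is a star.\<close>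

lemma leaf_nbr:
  assumes x: "x \<in> N" "x \<notin> B" and xy: "adj F x y"
  shows "y \<in> B"
proof (rule ccontr)
  assume y: "y \<notin> B"
  have yN: "y \<in> N" using x(1) xy by (rule N_adj)
  have "u \<in> {x, y}" if "u \<in> cset F x" for u
    using that
  proof (induction rule: cset_induct)
    case (step a b)
    then consider "adj F x b" | "adj F y b" by auto
    then show ?case
      using leaf_unique[OF x xy] leaf_unique[OF yN y adj_sym[OF xy]] by cases auto
  qed simp
  moreover obtain u w where uw: "u \<in> cset F x" "adj F u w" "u \<noteq> x" "w \<noteq> x" using no_star[OF x(1)] by blast
  moreover have "w \<in> cset F x" using uw cset_adj by metis
  ultimately have "u = y" "w = y" by auto
  with uw adj_irrefl show False by simp
qed

lemma edge_meets_B: "x \<in> N \<Longrightarrow> adj F x y \<Longrightarrow> x \<in> B \<or> y \<in> B"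
  using leaf_nbr by blast

lemma nbr_exists:
  assumes "x \<in> N"
  obtains y where "adj F x y"
  using new_verts_nbr[OF F Tne assms] .

lemma B_meets_cset:
  assumes "x \<in> N"
  obtains b where "b \<in> B" "b \<in> cset F x"
proof -
  obtain y where y: "adj F x y" using nbr_exists[OF assms] .
  with edge_meets_B[OF assms y] that[of x] that[of y] show ?thesis by (auto intro: adj_cset)
qed

text \<open>As the component is not a star centred at \<open>c\<close>, some edge of it avoids
  \<open>c\<close>, and this edge has an end in \<open>B\<close>.\<close>

lemma two_B: assumes "c \<in> N" obtains b where "b \<in> B" "b \<noteq> c" "b \<in> cset F c"
proof -
  obtain u w where uw: "u \<in> cset F c" "adj F u w" "u \<noteq> c" "w \<noteq> c" using no_star[OF assms] by blast
  have u: "u \<in> N" using new_verts_cset[OF F assms uw(1)] .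
  have "w \<in> cset F c" using uw cset_adj by metis
  with edge_meets_B[OF u uw(2)] uw that show ?thesis by blast
qed

lemma m_pos: "0 < m" and card_B: "card B = Suc m"
proof -
  obtain x where "x \<in> N" using new_ne by blast
  then obtain b where b: "b \<in> B" using B_meets_cset by blast
  then have "b \<in> N" using B_subset by blast
  then obtain b' where "b' \<in> B" "b' \<noteq> b" using two_B by metis
  with b finB have "2 \<le> card B"
    by (metis card_le_Suc0_iff_eq not_less_eq_eq numeral_2_eq_2)
  then show "0 < m" "card B = Suc m" by (auto simp: m_def)
qed

lemma card_subset_m: "A \<subseteq> B \<Longrightarrow> b \<in> B \<Longrightarrow> b \<notin> A \<Longrightarrow> card A \<le> m"
proof -
  assume "A \<subseteq> B" "b \<in> B" "b \<notin> A"
  then have "card A \<le> card (B - {b})" using finB by (intro card_mono) auto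
  also have "\<dots> = m" using \<open>b \<in> B\<close> card_B by (simp add: card_Diff_singleton)
  finally show ?thesis .
qed

text \<open>Leaving out two vertices of \<open>B\<close> makes room in the clique of size
  \<open>card B - 1\<close> for one further vertex, possibly a leaf.\<close>

lemma card_insert_m:
  assumes "A \<subseteq> B" "b \<in> B - A" "b' \<in> B - A" "b \<noteq> b'"
  shows "card (insert w A) \<le> m"
proof -
  have "card A \<le> card (B - {b, b'})" using finB assms by (intro card_mono) auto
  also have "\<dots> = m - 1" using assms card_B by (simp add: card_Diff_subset)
  finally show ?thesis using m_pos by (intro order.trans[OF card_insert_le_m1]) auto
qed

text \<open>The vertices outside \<open>D\<close> go into the host: those in \<open>B\<close>, and \<open>w\<close>, into the clique, the
  leaves to pendant vertices. A vertex \<open>Pend z\<close> can be kept free.\<close>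

lemma embed_outside:
  assumes p: "m * (card (verts F) + 1) \<le> p"
    and cross: "\<And>x y. x \<in> D \<Longrightarrow> y \<in> N - D \<Longrightarrow> adj F x y \<Longrightarrow> y = w"
    and card: "card (B - D \<union> {w} \<inter> (N - D)) \<le> m" and h: "h < m"
  obtains g where "inj_on g (N - D)" "g ` (N - D) \<subseteq> host_core m p - {Pend z}"
    "\<And>x y. x \<in> N - D \<Longrightarrow> y \<in> N - D \<Longrightarrow> adj F x y \<Longrightarrow> adj (host T True m p M) (g x) (g y)"
    "w \<in> N - D \<Longrightarrow> g w = Clq h"
proof -
  \<comment> \<open>The vertices destined for the clique. Even if \<open>w\<close> is a leaf it is
    among them, since it has to receive the position \<open>h\<close>.\<close>
  let ?A = "B - D \<union> {w} \<inter> (N - D)" and ?k = "card (verts F)"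
  have finA: "finite ?A" using finB by simp
  obtain \<alpha> where \<alpha>: "inj_on \<alpha> ?A" "\<alpha> ` ?A \<subseteq> {..<m}" "w \<in> ?A \<Longrightarrow> \<alpha> w = h"
    using inj_on_into_lessThan[OF finA card, of w h] h by auto
  \<comment> \<open>Of the \<open>card (verts F) + 1\<close> labels, the one belonging to
    \<open>Pend z\<close> is withheld; enough remain for all vertices of \<open>F\<close>.\<close>
  have "card (verts F) \<le> card ({..<?k + 1} - {z div m})"
    by (cases "z div m < ?k + 1") (simp_all add: card_Diff_singleton)
  then obtain idx where idx: "inj_on idx (verts F)" "idx ` verts F \<subseteq> {..<?k + 1} - {z div m}"
    using inj_on_iff_card_le[of "verts F" "{..<?k + 1} - {z div m}"] simple_finite(1)[OF F] by auto
  define s where "s x = (SOME y. adj F x y)" for x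
  have s: "adj F x (s x)" if "x \<in> N" for x
    using nbr_exists[OF that] unfolding s_def by (metis someI_ex)
  have leaf: "s x \<in> ?A" "adj F x y \<Longrightarrow> y = s x" if x: "x \<in> N - D - ?A" for x y
  proof -
    have xl: "x \<in> N" "x \<notin> B" "x \<noteq> w" "x \<notin> D" using x by auto
    have "s x \<in> B" using leaf_nbr[OF xl(1,2) s[OF xl(1)]] .
    \<comment> \<open>An edge from \<open>D\<close> to \<open>x\<close> would force
      \<open>x = w\<close>.\<close>
    moreover have "s x \<notin> D"
      using cross[of "s x" x] xl adj_sym[OF s[OF xl(1)]] by blast
    ultimately show "s x \<in> ?A" by simp
    show "adj F x y \<Longrightarrow> y = s x" using leaf_unique[OF xl(1,2) _ s[OF xl(1)]] .
  qed
  \<comment> \<open>The index of a pendant vertex encodes a pair: modulo \<open>m\<close> it is the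
    clique vertex at which the leaf hangs, and its quotient by \<open>m\<close> is the label that
    keeps leaves apart and away from \<open>Pend z\<close>.\<close>
  define g where "g x = (if x \<in> ?A then Clq (\<alpha> x) else Pend (\<alpha> (s x) + m * idx x))" for x
  have gA: "g x = Clq (\<alpha> x)" if x: "x \<in> ?A" for x unfolding g_def by (rule if_P[OF x])
  have gP: "g x = Pend (\<alpha> (s x) + m * idx x)" if x: "x \<in> N - D - ?A" for x
  proof -
    have "x \<notin> ?A" using x by blast
    then show ?thesis unfolding g_def by (rule if_not_P)
  qed
  have \<alpha>m: "\<alpha> x < m" if "x \<in> ?A" for x using \<alpha>(2) that by blast
  have dm: "(\<alpha> (s x) + m * idx x) mod m = \<alpha> (s x)" "(\<alpha> (s x) + m * idx x) div m = idx x"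
    if "x \<in> N - D - ?A" for x
    using \<alpha>m[OF leaf(1)[OF that]] by simp_all
  have idxk: "idx x < ?k + 1" "idx x \<noteq> z div m" if "x \<in> N" for x
    using idx(2) that new_verts_subset[of F T] by auto
  have lp: "\<alpha> (s x) + m * idx x < p" if x: "x \<in> N - D - ?A" for x
  proof -
    have "\<alpha> (s x) + m * idx x < m * (idx x + 1)" using \<alpha>m[OF leaf(1)[OF x]] by simp
    also have "\<dots> \<le> m * (?k + 1)" using idxk(1)[of x] x by (intro mult_le_mono) auto
    finally show ?thesis using p by linarith
  qed
  show ?thesis
  proof (rule that[of g])
    show "inj_on g (N - D)"
    proof (rule inj_onI)
      fix x y assume xy: "x \<in> N - D" "y \<in> N - D" "g x = g y"
      then consider "x \<in> ?A" "y \<in> ?A" | "x \<in> N - D - ?A" "y \<in> N - D - ?A"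
        by (auto simp: g_def split: if_splits)
      then show "x = y"
      proof cases
        case 1
        then show ?thesis using xy(3) inj_onD[OF \<alpha>(1) _ 1] by (simp add: g_def)
      next
        case 2
        then have "\<alpha> (s x) + m * idx x = \<alpha> (s y) + m * idx y" using xy(3) gP[OF 2(1)] gP[OF 2(2)] by simp
        then have "idx x = idx y" using dm(2)[OF 2(1)] dm(2)[OF 2(2)] by simp
        then show ?thesis using inj_onD[OF idx(1)] 2 new_verts_subset[of F T] by blast
      qed
    qed
    show "g ` (N - D) \<subseteq> host_core m p - {Pend z}"
    proof
      fix v assume "v \<in> g ` (N - D)"
      then obtain x where x: "x \<in> N - D" "v = g x" by blast
      show "v \<in> host_core m p - {Pend z}"
      proof (cases "x \<in> ?A")
        case True
        then show ?thesis using x \<alpha>m[OF True] by (simp add: g_def)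
      next
        case False
        then have x': "x \<in> N - D - ?A" using x by blast
        have "\<alpha> (s x) + m * idx x \<noteq> z" using dm(2)[OF x'] idxk(2)[of x] x by auto
        then show ?thesis using lp[OF x'] x(2) gP[OF x'] by simp
      qed
    qed
    show "g w = Clq h" if "w \<in> N - D" using that \<alpha>(3) by (simp add: g_def)
    have pend: "adj (host T True m p M) (g x) (g y)" if x: "x \<in> N - D - ?A" and xy: "adj F x y" for x y
    proof -
      have y: "y = s x" "y \<in> ?A" using leaf[OF x] xy by auto
      have "g x = Pend (\<alpha> (s x) + m * idx x)" "g y = Clq (\<alpha> (s x))"
        using gP[OF x] gA[OF y(2)] y(1) by simp_all
      then show ?thesis using lp[OF x] dm(1)[OF x] \<alpha>m[OF y(2)] y(1) by (simp add: adj_host)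
    qed
    fix x y assume xy: "x \<in> N - D" "y \<in> N - D" "adj F x y"
    show "adj (host T True m p M) (g x) (g y)"
    proof (cases "x \<in> ?A \<and> y \<in> ?A")
      case True
      then have "\<alpha> x \<noteq> \<alpha> y" using xy(3) adj_irrefl by (metis \<alpha>(1) inj_onD)
      then show ?thesis using True \<alpha>m by (simp add: g_def adj_host)
    next
      case False
      then consider "x \<in> N - D - ?A" | "y \<in> N - D - ?A" using xy(1,2) by blast
      then show ?thesis
      proof cases
        case 1
        then show ?thesis using xy(3) by (rule pend)
      next
        case 2
        then show ?thesis using adj_sym[OF xy(3)] by (intro adj_sym[OF pend])
      qed
    qed
  qed
qed

text \<open>The removed component takes a vertex of \<open>B\<close> with it, so the clique suffices
  for the others. No edge leaves a component, hence \<open>x\<close> itself, lying in the removed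
  part, can stand for the crossing vertex \<open>w\<close>.\<close>

lemma host_embeds_removed:
  assumes p: "m * (card (verts F) + 1) \<le> p" and x: "x \<in> N"
  shows "embeds_on F (N - cset F x) (host T True m p M) (host_core m p)"
proof -
  obtain b where b: "b \<in> B" "b \<in> cset F x" using B_meets_cset[OF x] .
  have card: "card (B - cset F x \<union> {x} \<inter> (N - cset F x)) \<le> m"
    using b by (intro card_subset_m[of _ b]) auto
  have cross: "y = x" if "a \<in> cset F x" "y \<in> N - cset F x" "adj F a y" for a y
    using cset_adj[OF that(1,3)] that(2) by simp
  show ?thesis
  proof (rule embed_outside[where z = 0 and M = M, OF p cross card m_pos])
    fix g assume "inj_on g (N - cset F x)" "g ` (N - cset F x) \<subseteq> host_core m p - {Pend 0}"
      "\<And>a y. a \<in> N - cset F x \<Longrightarrow> y \<in> N - cset F x \<Longrightarrow> adj F a y \<Longrightarrow> adj (host T True m p M) (g a) (g y)"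
    then show ?thesis by (intro embeds_onI[of g]) auto
  qed
qed

text \<open>A pendant vertex has one neighbour in the host, so all \<open>m + 1\<close> vertices of
  \<open>B\<close> would have to fit into the clique.\<close>

lemma host_core_free: "\<not> embeds_on F N (host T True m p M) (host_core m p)"
proof
  assume "embeds_on F N (host T True m p M) (host_core m p)"
  then obtain g where g: "inj_on g N" "g ` N \<subseteq> host_core m p"
    "\<And>x y. x \<in> N \<Longrightarrow> y \<in> N \<Longrightarrow> adj F x y \<Longrightarrow> adj (host T True m p M) (g x) (g y)"
    by (rule embeds_onE) blast
  have "g x \<in> Clq ` {..<m}" if x: "x \<in> B" for x
  proof -
    obtain y z where yz: "adj F x y" "adj F x z" "y \<noteq> z" using x by (auto simp: B_def)
    have N: "x \<in> N" "y \<in> N" "z \<in> N" using x yz N_adj B_subset by auto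
    have gc: "g x \<in> host_core m p" "g y \<in> host_core m p" "g z \<in> host_core m p" using g(2) N by auto
    have "g y \<noteq> g z" using g(1) N yz(3) by (auto dest: inj_onD)
    moreover have "adj (host T True m p M) (g x) (g y)" "adj (host T True m p M) (g x) (g z)"
      using g(3) N yz by auto
    ultimately show ?thesis using gc
      by (cases "g x"; cases "g y"; cases "g z") (auto simp: adj_host)
  qed
  then have "card B \<le> card (Clq ` {..<m})"
    using g(1) B_subset by (intro card_inj_on_le[of g]) (auto intro: inj_on_subset)
  also have "\<dots> \<le> m" by (metis card_image_le card_lessThan finite_lessThan)
  finally show False using card_B by simp
qed

text \<open>Glues an explicit placement \<open>g0\<close> of \<open>D\<close> to a placement of the
  rest in the core. Edges between the two parts all end in \<open>w\<close>, which is sent to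
  \<open>Clq h\<close>; the only core vertex open to \<open>g0\<close> is \<open>Pend z\<close>,
  which the other part leaves free.\<close>

lemma combine_embedding:
  fixes G :: "hvert sgraph"
  assumes GV: "verts G = host_verts T m p M" and GE: "edges (host T True m p M) \<subseteq> edges G"
    and p: "m * (card (verts F) + 1) \<le> p"
    and g0: "inj_on g0 D" "g0 ` D \<subseteq> host_verts T m p M" "\<And>x. x \<in> D \<Longrightarrow> g0 x \<notin> host_core m p - {Pend z}"
      "\<And>x y. x \<in> D \<Longrightarrow> y \<in> D \<Longrightarrow> adj F x y \<Longrightarrow> adj G (g0 x) (g0 y)"
    and cross: "\<And>x y. x \<in> D \<Longrightarrow> y \<in> N - D \<Longrightarrow> adj F x y \<Longrightarrow> y = w \<and> adj G (g0 x) (Clq h)"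
    and card: "card (B - D \<union> {w} \<inter> (N - D)) \<le> m" and h: "h < m"
  shows "embeds_on F N G (host_verts T m p M)"
proof -
  have BG: "adj G u v" if "adj (host T True m p M) u v" for u v using that GE by (auto simp: adj_def)
  obtain g where g: "inj_on g (N - D)" "g ` (N - D) \<subseteq> host_core m p - {Pend z}"
    "\<And>x y. x \<in> N - D \<Longrightarrow> y \<in> N - D \<Longrightarrow> adj F x y \<Longrightarrow> adj (host T True m p M) (g x) (g y)"
    "w \<in> N - D \<Longrightarrow> g w = Clq h"
    by (rule embed_outside[where z = z and M = M, OF p _ card h]) (use cross that in blast)+
  define f where "f x = (if x \<in> D then g0 x else g x)" for x
  have cr: "adj G (f x) (f y)" if "x \<in> D" "y \<in> N - D" "adj F x y" for x y
    using cross[OF that] g(4) that by (auto simp: f_def)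
  show ?thesis
  proof (rule embeds_onI[of f])
    show "inj_on f N"
    proof (rule inj_onI)
      fix x y assume xy: "x \<in> N" "y \<in> N" "f x = f y"
      have no: False if "u \<in> D" "v \<in> N - D" "f u = f v" for u v
        using g0(3)[OF that(1)] g(2) that by (auto simp: f_def)
      then consider "x \<in> D" "y \<in> D" | "x \<in> N - D" "y \<in> N - D" using xy by (metis DiffI)
      then show "x = y"
        using xy(3) g0(1) g(1) by cases (auto simp: f_def dest: inj_onD)
    qed
    show "f ` N \<subseteq> host_verts T m p M"
      using g0(2) g(2) host_core_subset[of m p T M] by (auto simp: f_def)
    fix x y assume xy: "x \<in> N" "y \<in> N" "adj F x y"
    consider "x \<in> D" "y \<in> D" | "x \<in> D" "y \<in> N - D" | "y \<in> D" "x \<in> N - D" | "x \<in> N - D" "y \<in> N - D"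
      using xy by blast
    then show "adj G (f x) (f y)"
    proof cases
      case 1
      then show ?thesis using g0(4) xy by (simp add: f_def)
    next
      case 2
      then show ?thesis using cr xy by blast
    next
      case 3
      then show ?thesis using cr adj_sym xy by metis
    next
      case 4
      then show ?thesis using BG g(3) xy by (simp add: f_def)
    qed
  qed
qed

text \<open>For a leaf \<open>y\<close> of \<open>T\<close>, consider the component of \<open>F\<close> in two copies of \<open>T\<close> joined by \<open>y v\<close>. Its
  part in the second copy and possibly the preimage of \<open>y\<close> stay outside the host, and as \<open>y\<close> is a leaf
  they meet the rest in a single edge. This frees enough clique vertices for the rest to fit.\<close>

lemma touching_edge_embeds:
  fixes G :: "hvert sgraph"
  assumes GV: "verts G = host_verts T m p M" and GE: "edges (host T True m p M) \<subseteq> edges G"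
    and p: "m * (card (verts F) + 1) \<le> p"
    and h: "h \<in> host_core m p" and j: "j < M" and v: "v \<in> verts T" and hv: "adj G h (Cp j v)"
  shows "embeds_on F N G (host_verts T m p M)"
proof -
  have BG: "adj G a b" if "adj (host T True m p M) a b" for a b using that GE by (auto simp: adj_def)
  have treeT: "is_tree T" using T by (simp add: good_tree_def)
  have newD: "contains_new_component (add_edge (double T) {Inl a, Inr v}) F T" if "a \<in> verts T" for a
    using T that v by (simp add: good_tree_def)
  \<comment> \<open>A component that is not a star has at least three vertices. So \<open>T\<close>
    has at least two, since otherwise its joined double would be too small, and therefore
    \<open>T\<close> has a leaf.\<close>
  have comp3: "\<not> contains (D :: 'z sgraph) (comp_at F z)"
    if z: "z \<in> N" and D: "card (verts D) \<le> 2" "finite (verts D)" for D z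
  proof
    assume "contains D (comp_at F z)"
    then obtain f where f: "emb f (comp_at F z) D" using contains_iff_emb by blast
    obtain u w where uw: "u \<in> cset F z" "adj F u w" "u \<noteq> z" "w \<noteq> z" using no_star[OF z] by blast
    have "w \<in> cset F z" using uw cset_adj by metis
    then have "{u, w, z} \<subseteq> cset F z" using uw by simp
    moreover have "card (cset F z) \<le> 2"
      using card_inj_on_le[of f "cset F z" "verts D"] f D by (auto simp: emb_def)
    moreover have "finite (cset F z)"
      using f D(2) by (auto simp: emb_def intro: inj_on_finite)
    ultimately have "card {u, w, z} \<le> 2" using card_mono order_trans by meson
    moreover have "u \<noteq> w" using uw adj_irrefl by auto
    ultimately show False using uw by simp
  qed
  have cT: "2 \<le> card (verts T)"
  proof (rule ccontr)
    assume "\<not> ?thesis"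
    moreover have "finite (verts T)" using sT by (rule simple_finite)
    ultimately have D: "card (verts (add_edge (double T) {Inl v, Inr v})) \<le> 2"
      "finite (verts (add_edge (double T) {Inl v, Inr v}))" by (auto simp: card_Plus)
    from newD[OF v] obtain z where "z \<in> verts F" "\<not> contains T (comp_at F z)"
      "contains (add_edge (double T) {Inl v, Inr v}) (comp_at F z)"
      by (auto simp: contains_new_component_def components_of_eq)
    with comp3[of z "add_edge (double T) {Inl v, Inr v}"] D show False by (simp add: new_verts_def)
  qed
  obtain y wT where y: "y \<in> verts T" "adj T y wT" "\<And>x. adj T y x \<Longrightarrow> x = wT"
    using tree_leaf[OF treeT cT] by metis
  obtain v' where v': "adj T v v'"
  proof -
    have "\<not> verts T \<subseteq> {v}" using cT card_mono[of "{v}" "verts T"] by auto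
    then obtain u where u: "u \<in> verts T" "u \<noteq> v" by blast
    have "(adj T)\<^sup>*\<^sup>* v u" using treeT v u by (simp add: is_tree_def connected_graph_def)
    then show ?thesis using u(2) that by (metis converse_rtranclpE)
  qed
  let ?D = "add_edge (double T) {Inl y, Inr v}"
  obtain z where z: "z \<in> verts F" "\<not> contains T (comp_at F z)" "contains ?D (comp_at F z)"
    using newD[OF y(1)] by (auto simp: contains_new_component_def components_of_eq)
  then obtain \<phi> where \<phi>: "emb \<phi> (comp_at F z) ?D" using contains_iff_emb by blast
  have zN: "z \<in> N" using z by (simp add: new_verts_def)
  let ?C = "cset F z"
  have CN: "?C \<subseteq> N" using new_verts_cset[OF F zN] by blast
  have \<phi>i: "inj_on \<phi> ?C" and \<phi>D: "\<And>x. x \<in> ?C \<Longrightarrow> \<phi> x \<in> verts T <+> verts T"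
    using \<phi> by (auto simp: emb_def)
  have \<phi>a: "adj (double T) (\<phi> x) (\<phi> x') \<or> \<phi> x = Inl y \<and> \<phi> x' = Inr v \<or> \<phi> x = Inr v \<and> \<phi> x' = Inl y"
    if "x \<in> ?C" "adj F x x'" for x x'
    using emb_adj[OF \<phi>, of x x'] that by (auto simp: adj_comp_at adj_add_edge doubleton_eq_iff)
  obtain a b where ab: "a \<in> ?C" "b \<in> ?C" "adj F a b" "\<phi> a = Inl y" "\<phi> b = Inr v"
  proof -
    \<comment> \<open>Without the joining edge the connected component would stay on one side of the
      double and so embed into \<open>T\<close>.\<close>
    have "\<exists>x x'. x \<in> ?C \<and> adj F x x' \<and> \<not> adj (double T) (\<phi> x) (\<phi> x')"
    proof (rule ccontr)
      assume "\<not> ?thesis"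
      then have dd: "adj (double T) (\<phi> x) (\<phi> x')" if "x \<in> ?C" "adj F x x'" for x x' using that by blast
      have side: "isl (\<phi> x) = isl (\<phi> z)" if "x \<in> ?C" for x
        using that
      proof (induction rule: cset_induct)
        case (step c d)
        with dd[of c d] show ?case by (cases "\<phi> c"; cases "\<phi> d") (auto simp: adj_double)
      qed simp
      let ?\<psi> = "\<lambda>x. case \<phi> x of Inl t \<Rightarrow> t | Inr t \<Rightarrow> t"
      have "emb ?\<psi> (comp_at F z) T"
      proof (rule embI[OF simple_comp_at[OF F z(1)]])
        show "inj_on ?\<psi> (verts (comp_at F z))"
        proof (rule inj_onI)
          fix x x' assume xx: "x \<in> verts (comp_at F z)" "x' \<in> verts (comp_at F z)" "?\<psi> x = ?\<psi> x'"
          then have "\<phi> x = \<phi> x'" using side[of x] side[of x']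
            by (cases "\<phi> x"; cases "\<phi> x'") auto
          then show "x = x'" using \<phi>i xx by (auto dest: inj_onD)
        qed
        show "?\<psi> ` verts (comp_at F z) \<subseteq> verts T"
        proof
          fix t assume "t \<in> ?\<psi> ` verts (comp_at F z)"
          then obtain x where "x \<in> ?C" "t = ?\<psi> x" by auto
          with \<phi>D[of x] show "t \<in> verts T" by (cases "\<phi> x") auto
        qed
        fix x x' assume "adj (comp_at F z) x x'"
        then have "adj (double T) (\<phi> x) (\<phi> x')" using dd by (simp add: adj_comp_at)
        then show "adj T (?\<psi> x) (?\<psi> x')" by (cases "\<phi> x"; cases "\<phi> x'") (auto simp: adj_double)
      qed
      with z(2) show False using contains_iff_emb by blast
    qed
    then obtain x x' where x: "x \<in> ?C" "adj F x x'" "\<not> adj (double T) (\<phi> x) (\<phi> x')" by blast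
    have x': "x' \<in> ?C" using x cset_adj by metis
    from \<phi>a[OF x(1,2)] x(3) consider "\<phi> x = Inl y" "\<phi> x' = Inr v" | "\<phi> x' = Inl y" "\<phi> x = Inr v" by blast
    then show ?thesis
    proof cases
      case 1
      then show ?thesis using that[of x x'] x x' by simp
    next
      case 2
      then show ?thesis using that[of x' x] x x' adj_sym[OF x(2)] by simp
    qed
  qed
  \<comment> \<open>The part of the component in the second copy. Its only edge to the rest is
    \<open>{a, b}\<close>, so it can be placed in copy \<open>j\<close> of the host, with
    \<open>b\<close> at the touched vertex \<open>v\<close>.\<close>
  define R where "R = {x \<in> ?C. \<not> isl (\<phi> x)}"
  define \<psi> where "\<psi> x = projr (\<phi> x)" for x
  have RC: "R \<subseteq> ?C" and aR: "a \<notin> R" and bR: "b \<in> R" and RN: "R \<subseteq> N" using ab CN by (auto simp: R_def)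
  have anb: "a \<noteq> b" using ab adj_irrefl by auto
  have \<phi>R: "\<phi> x = Inr (\<psi> x)" if "x \<in> R" for x using that by (auto simp: R_def \<psi>_def)
  have \<psi>b: "\<psi> b = v" using ab by (simp add: \<psi>_def)
  have \<psi>T: "\<psi> x \<in> verts T" if "x \<in> R" for x using \<phi>R[OF that] \<phi>D[of x] that RC by auto
  have \<psi>i: "inj_on \<psi> R"
  proof (rule inj_onI)
    fix x x' assume "x \<in> R" "x' \<in> R" "\<psi> x = \<psi> x'"
    then show "x = x'" using \<phi>R[of x] \<phi>R[of x'] RC inj_onD[OF \<phi>i, of x x'] by auto
  qed
  have R_adj: "adj T (\<psi> x) (\<psi> x')" if "x \<in> R" "x' \<in> R" "adj F x x'" for x x'
    using \<phi>a[of x x'] \<phi>R[OF that(1)] \<phi>R[OF that(2)] that RC by (auto simp: adj_double)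
  have eq_a: "x = a" if "x \<in> ?C" "\<phi> x = Inl y" for x using inj_onD[OF \<phi>i] that ab by metis
  have eq_b: "x = b" if "x \<in> ?C" "\<phi> x = Inr v" for x using inj_onD[OF \<phi>i] that ab by metis
  have R_cross: "x = b \<and> x' = a" if x: "x \<in> R" "x' \<notin> R" "adj F x x'" for x x'
  proof -
    have xC: "x \<in> ?C" using x RC by auto
    then have x'C: "x' \<in> ?C" using x cset_adj by metis
    then obtain t where "\<phi> x' = Inl t" using x(2) by (auto simp: R_def isl_def)
    then show ?thesis using \<phi>a[OF xC x(3)] \<phi>R[OF x(1)] eq_a[OF x'C] eq_b[OF xC]
      by (auto simp: adj_double)
  qed
  \<comment> \<open>This is where the leaf \<open>y\<close> pays off: besides \<open>b\<close>, the
    vertex \<open>a\<close> has at most one neighbour.\<close>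
  have a_nbr: "\<phi> x = Inl wT" if x: "adj F a x" "x \<noteq> b" for x
  proof -
    have xC: "x \<in> ?C" using x ab cset_adj by metis
    have "\<phi> x \<noteq> Inr v" using eq_b[OF xC] x by blast
    then have "adj (double T) (Inl y) (\<phi> x)" using \<phi>a[OF ab(1) x(1)] ab by auto
    then show ?thesis using y(3) by (cases "\<phi> x") (auto simp: adj_double)
  qed
  have a_nbr_unique: "x = x'" if "adj F a x" "x \<noteq> b" "adj F a x'" "x' \<noteq> b" for x x'
    using a_nbr that inj_onD[OF \<phi>i, of x x'] ab cset_adj by metis
  have a_nbr_R: "x \<notin> R" if "adj F a x" "x \<noteq> b" for x using a_nbr[OF that] by (simp add: R_def)
  have cpR: "adj G (Cp j (\<psi> x)) (Cp j (\<psi> x'))" if "x \<in> R" "x' \<in> R" "adj F x x'" for x x'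
    using R_adj[OF that] \<psi>T that j by (intro BG) (simp add: adj_host)
  have aN: "a \<in> N" and bN: "b \<in> N" using ab CN by auto
  \<comment> \<open>If \<open>a\<close> is a leaf, \<open>b\<close> is its only neighbour, and the
    first copy contributes nothing beyond \<open>a\<close>.\<close>
  have C_small: "?C \<subseteq> insert a R" if "a \<notin> B"
  proof
    fix x assume "x \<in> ?C"
    then have "x \<in> cset F a" using cset_eq[OF ab(1)] by simp
    then show "x \<in> insert a R"
    proof (induction rule: cset_induct)
      case (step c d)
      show ?case
      proof (cases "c = a")
        case True
        then have "d = b" using leaf_unique[OF aN that ab(3)] step(2) by simp
        then show ?thesis using bR by simp
      next
        case False
        then show ?thesis using step R_cross[of c d] by blast
      qed
    qed simp
  qed
  have star_a: "\<exists>u w. u \<in> ?C \<and> adj F u w \<and> u \<noteq> a \<and> w \<noteq> a"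
    using no_star[OF aN] cset_eq[OF ab(1)] by simp
  have RB: "\<exists>b'. b' \<in> B \<inter> R \<and> b' \<noteq> b" if "a \<notin> B"
  proof -
    obtain b' where b': "b' \<in> B" "b' \<noteq> b" "b' \<in> cset F b" using two_B[OF bN] .
    then have "b' \<in> ?C" using cset_eq[OF ab(2)] by simp
    then have "b' \<in> insert a R" using C_small[OF that] by blast
    with b' that show ?thesis by blast
  qed
  show ?thesis
  proof (cases h)
    case (Clq h')
    then have h': "h' < m" using h by simp
    have ha: "adj G (Cp j v) (Clq h')" using hv Clq adj_sym by metis
    show ?thesis
    \<comment> \<open>Normally \<open>R\<close> goes to the copy and \<open>a\<close> to the touched
      clique vertex, which works if enough vertices of \<open>B\<close> lie in \<open>R\<close>. If
      \<open>b\<close> is a leaf at some \<open>a\<close> in \<open>B\<close>, leaving out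
      \<open>R\<close> may free no clique vertex; then \<open>a\<close> and \<open>b\<close> both
      move to the copy.\<close>
    proof (cases "a \<in> B \<and> b \<notin> B")
      case False
      show ?thesis
      proof (rule combine_embedding[OF GV GE p, of "\<lambda>x. Cp j (\<psi> x)" R p a h'])
        show "inj_on (\<lambda>x. Cp j (\<psi> x)) R" using \<psi>i by (auto simp: inj_on_def)
        show "(\<lambda>x. Cp j (\<psi> x)) ` R \<subseteq> host_verts T m p M" using \<psi>T j by auto
        show "x' = a \<and> adj G (Cp j (\<psi> x)) (Clq h')" if "x \<in> R" "x' \<in> N - R" "adj F x x'" for x x'
          using R_cross[of x x'] that \<psi>b ha by auto
        show "card (B - R \<union> {a} \<inter> (N - R)) \<le> m"
        proof (cases "a \<in> B")
          case True
          then have "B - R \<union> {a} \<inter> (N - R) = B - R" using aR by auto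
          then show ?thesis using False True bR by (auto intro: card_subset_m[of _ b])
        next
          case aB: False
          \<comment> \<open>The leaf \<open>a\<close> occupies a clique vertex here, so two vertices
            of \<open>B\<close> have to be found in \<open>R\<close>: \<open>b\<close> and
            \<open>b'\<close>.\<close>
          then have "b \<in> B" using edge_meets_B[OF aN ab(3)] by simp
          obtain b' where "b' \<in> B \<inter> R" "b' \<noteq> b" using RB[OF aB] by blast
          then have "card (insert a (B - R)) \<le> m"
            using \<open>b \<in> B\<close> bR by (intro card_insert_m[of _ b b']) auto
          moreover have "B - R \<union> {a} \<inter> (N - R) = insert a (B - R)" using aN aR by auto
          ultimately show ?thesis by simp
        qed
      qed (use cpR h' in auto)
    next
      case True
      then have aB: "a \<in> B" and bB: "b \<notin> B" by auto
      then obtain w where w: "adj F a w" "w \<noteq> b" unfolding B_def by blast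
      have b_nbr: "x = a" if "adj F b x" for x using leaf_unique[OF bN bB that adj_sym[OF ab(3)]] .
      have wa: "w \<noteq> a" using w adj_irrefl by auto
      have wN: "w \<in> N" using N_adj[OF aN w(1)] .
      have a_only: "x = b \<or> x = w" if "adj F a x" for x using a_nbr_unique[OF that _ w] by blast
      \<comment> \<open>Otherwise the component consists of \<open>a\<close>, \<open>b\<close> and
        \<open>w\<close>, a star centred at \<open>a\<close>.\<close>
      have wB: "w \<in> B"
      proof (rule ccontr)
        assume wB: "w \<notin> B"
        have "x \<in> {a, b, w}" if "x \<in> ?C" for x
        proof -
          have "x \<in> cset F a" using cset_eq[OF ab(1)] that by simp
          then show ?thesis
          proof (induction rule: cset_induct)
            case (step c d)
            then show ?case using a_only b_nbr leaf_unique[OF wN wB adj_sym[OF w(1)]] by auto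
          qed simp
        qed
        moreover obtain s t where st: "s \<in> ?C" "adj F s t" "s \<noteq> a" "t \<noteq> a" using star_a by blast
        ultimately have "s = b \<or> s = w" by blast
        then show False using st b_nbr leaf_unique[OF wN wB adj_sym[OF w(1)]] by blast
      qed
      have nv: "v \<noteq> v'" using simple_adjD[OF sT v'] by auto
      \<comment> \<open>\<open>a\<close> takes the touched vertex \<open>v\<close>, and its leaf
        \<open>b\<close> takes a neighbour of \<open>v\<close> inside the copy.\<close>
      let ?g = "\<lambda>x. if x = a then Cp j v else Cp j v'"
      have v'T: "v' \<in> verts T" using simple_adjD[OF sT v'] by auto
      have vv: "adj G (Cp j v) (Cp j v')" using v v'T v' j by (intro BG) (simp add: adj_host)
      show ?thesis
      proof (rule combine_embedding[OF GV GE p, of ?g "{a, b}" p w h'])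
        show "inj_on ?g {a, b}" using nv by (auto simp: inj_on_def)
        show "?g ` {a, b} \<subseteq> host_verts T m p M" using v v'T j by auto
        show "adj G (?g x) (?g x')" if "x \<in> {a, b}" "x' \<in> {a, b}" "adj F x x'" for x x'
          using that adj_irrefl vv adj_sym[OF vv] by auto
        show "x' = w \<and> adj G (?g x) (Clq h')" if "x \<in> {a, b}" "x' \<in> N - {a, b}" "adj F x x'" for x x'
          using that a_only b_nbr ha by auto
        have "B - {a, b} \<union> {w} \<inter> (N - {a, b}) = B - {a, b}" using wB by auto
        then show "card (B - {a, b} \<union> {w} \<inter> (N - {a, b})) \<le> m"
          using aB by (auto intro: card_subset_m[of _ a])
      qed (use h' in auto)
    qed
  next
    case (Pend t)
    then have t: "t < p" using h by simp
    \<comment> \<open>\<open>Pend t\<close> takes the role of \<open>a\<close>: the touched vertex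
      of the copy represents \<open>b\<close>, and the clique vertex at which \<open>Pend t\<close>
      hangs represents the other neighbour of \<open>a\<close>, if there is one.\<close>
    let ?h = "t mod m"
    have h': "?h < m" using m_pos by simp
    have tv: "adj G (Pend t) (Cp j v)" using hv Pend by simp
    have th: "adj G (Pend t) (Clq ?h)" using t h' by (intro BG) (simp add: adj_host)
    let ?g = "\<lambda>x. if x = a then Pend t else Cp j (\<psi> x)"
    let ?D = "insert a R"
    have gi: "inj_on ?g ?D" using \<psi>i by (auto simp: inj_on_def)
    have gV: "?g ` ?D \<subseteq> host_verts T m p M" using \<psi>T j t by auto
    have gh: "?g x \<notin> host_core m p - {Pend t}" for x by auto
    have ga: "adj G (?g x) (?g x')" if x: "x \<in> ?D" "x' \<in> ?D" "adj F x x'" for x x'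
    proof -
      consider "x = a" "x' \<in> R" | "x' = a" "x \<in> R" | "x \<in> R" "x' \<in> R"
        using x adj_irrefl by auto
      then show ?thesis
      proof cases
        case 1
        then have "x' = b" using R_cross[OF 1(2) aR] adj_sym x by metis
        then show ?thesis using 1 tv \<psi>b anb by simp
      next
        case 2
        then have "x = b" using R_cross[OF 2(2) aR] x by metis
        then show ?thesis using 2 adj_sym[OF tv] \<psi>b anb by simp
      next
        case 3
        then show ?thesis using cpR x aR by auto
      qed
    qed
    have gc: "x = a \<and> x' \<noteq> b" if "x \<in> ?D" "x' \<in> N - ?D" "adj F x x'" for x x'
      using that R_cross[of x x'] bR by auto
    show ?thesis
    proof (cases "a \<in> B")
      case False
      show ?thesis
      proof (rule combine_embedding[OF GV GE p gi gV gh ga, of a ?h])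
        show "x' = a \<and> adj G (?g x) (Clq ?h)" if "x \<in> ?D" "x' \<in> N - ?D" "adj F x x'" for x x'
          using gc[OF that] leaf_unique[OF aN False ab(3)] that by auto
        obtain b' where "b' \<in> B \<inter> R" using RB[OF False] by blast
        then show "card (B - ?D \<union> {a} \<inter> (N - ?D)) \<le> m"
          by (intro card_subset_m[of _ b']) auto
      qed (use h' in auto)
    next
      case True
      then obtain w where w: "adj F a w" "w \<noteq> b" unfolding B_def by blast
      have wa: "w \<noteq> a" using w adj_irrefl by auto
      have wN: "w \<in> N" using N_adj[OF aN w(1)] .
      have wD: "w \<notin> ?D" using wa a_nbr_R[OF w] by simp
      show ?thesis
      proof (rule combine_embedding[OF GV GE p gi gV gh ga, of w ?h])
        show "x' = w \<and> adj G (?g x) (Clq ?h)" if "x \<in> ?D" "x' \<in> N - ?D" "adj F x x'" for x x'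
          using gc[OF that] a_nbr_unique[OF _ _ w, of x'] that th by auto
        show "card (B - ?D \<union> {w} \<inter> (N - ?D)) \<le> m"
        proof (cases "w \<in> B")
          case wB: True
          then have "B - ?D \<union> {w} \<inter> (N - ?D) = B - ?D" using wD by auto
          then show ?thesis using True by (auto intro: card_subset_m[of _ a])
        next
          case wB: False
          \<comment> \<open>The leaf \<open>w\<close> occupies a clique vertex, so both
            \<open>a\<close> and \<open>b\<close> must be vertices of \<open>B\<close> outside the
            clique. A leaf \<open>b\<close> would make the component a star centred at
            \<open>a\<close>.\<close>
          have "b \<in> B"
          proof (rule ccontr)
            assume bB: "b \<notin> B"
            have b_nbr: "x = a" if "adj F b x" for x using leaf_unique[OF bN bB that adj_sym[OF ab(3)]] .
            have "x \<in> {a, b, w}" if "x \<in> ?C" for x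
            proof -
              have "x \<in> cset F a" using cset_eq[OF ab(1)] that by simp
              then show ?thesis
              proof (induction rule: cset_induct)
                case (step c d)
                then show ?case
                  using a_nbr_unique[OF _ _ w, of d] b_nbr leaf_unique[OF wN wB adj_sym[OF w(1)]] by auto
              qed simp
            qed
            moreover obtain s t where st: "s \<in> ?C" "adj F s t" "s \<noteq> a" "t \<noteq> a" using star_a by blast
            ultimately have "s = b \<or> s = w" by blast
            then show False using st b_nbr leaf_unique[OF wN wB adj_sym[OF w(1)]] by blast
          qed
          then have "card (insert w (B - ?D)) \<le> m"
            using True anb bR by (intro card_insert_m[of _ a b]) auto
          moreover have "B - ?D \<union> {w} \<inter> (N - ?D) = insert w (B - ?D)" using wN wD by auto
          ultimately show ?thesis by simp
        qed
      qed (use h' in auto)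
    qed
  next
    case (Cp i x)
    with h show ?thesis by simp
  qed
qed

text \<open>A single edge from the core to a copy already completes \<open>F'\<close>, so the
  tolerance is \<open>q = 0\<close> and no copy is lost.\<close>

lemma host_saturated_star_free:
  assumes p: "m * (card (verts F) + 1) \<le> p" and M: "2 * card (verts F) \<le> M" "n \<le> M"
  shows "\<exists>(G :: hvert sgraph) \<tau>. saturated F G \<and> card (verts G) = m + p + M * card (verts T) \<and> copies G T n \<tau>"
proof (rule host_saturated[OF F T host_core_free[of p M] host_embeds_removed[OF p], where q = 0])
  fix G :: "hvert sgraph" and h J
  assume G: "verts G = host_verts T m p M" "edges (host T True m p M) \<subseteq> edges G"
    and h: "h \<in> host_core m p" and J: "J \<subseteq> {..<M}" "0 < card J" "\<forall>j\<in>J. \<exists>x\<in>verts T. adj G h (Cp j x)"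
  from J(2) obtain j where "j \<in> J" by (metis card.empty ex_in_conv less_irrefl)
  with J obtain x where "x \<in> verts T" "adj G h (Cp j x)" "j < M" by blast
  with touching_edge_embeds[OF G p h] show "embeds_on F N G (host_verts T m p M)" by blast
qed (use M in auto)

end

text \<open>\<open>sat\<close> ranges over graphs on natural numbers, while hosts live on
  \<open>hvert\<close>; numbering the vertices transports saturation and the copies.\<close>

lemma saturated_nat_copy:
  fixes G :: "'b sgraph"
  assumes G: "saturated F G" and C: "copies G T n \<tau>"
  shows "\<exists>(H :: nat sgraph) \<tau>'. saturated F H \<and> card (verts H) = card (verts G) \<and> copies H T n \<tau>'"
proof -
  have sG: "simple_graph G" and nc: "\<not> contains G F"
    and sat: "\<And>e. e \<in> non_edges G \<Longrightarrow> contains (add_edge G e) F"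
    using G by (auto simp: saturated_def)
  obtain f :: "'b \<Rightarrow> nat" where "bij_betw f (verts G) {0..<card (verts G)}"
    using ex_bij_betw_finite_nat[OF simple_finite(1)[OF sG]] by blast
  then have inj: "inj_on f (verts G)" by (simp add: bij_betw_def)
  define H where "H = SGraph (f ` verts G) ((`) f ` edges G)"
  have vH: "verts H = f ` verts G" by (simp add: H_def)
  have EV: "e \<subseteq> verts G" if "e \<in> edges G" for e using that sG by (auto simp: simple_graph_def vpairs_def)
  have adjH: "adj H (f u) (f v) \<longleftrightarrow> adj G u v" if "u \<in> verts G" "v \<in> verts G" for u v
  proof -
    have "f ` e = f ` {u, v} \<longleftrightarrow> e = {u, v}" if "e \<in> edges G" for e
      using inj_on_image_eq_iff[OF inj EV[OF that], of "{u, v}"] \<open>u \<in> verts G\<close> \<open>v \<in> verts G\<close> by simp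
    moreover have "f ` {u, v} = {f u, f v}" by simp
    ultimately have "{f u, f v} \<in> (`) f ` edges G \<longleftrightarrow> {u, v} \<in> edges G"
      by (metis (no_types, lifting) image_iff)
    then show ?thesis by (simp add: adj_def H_def)
  qed
  have sH: "simple_graph H"
    unfolding simple_graph_def
  proof
    show "finite (verts H)" using simple_finite(1)[OF sG] by (simp add: vH)
    show "edges H \<subseteq> vpairs (verts H)"
    proof
      fix e assume "e \<in> edges H"
      then obtain e0 where e0: "e0 \<in> edges G" "e = f ` e0" by (auto simp: H_def)
      then have "card e0 = 2" using sG by (auto simp: simple_graph_def vpairs_def)
      then have "card e = 2" using e0 EV[OF e0(1)] inj by (metis card_image inj_on_subset)
      then show "e \<in> vpairs (verts H)" using e0 EV[OF e0(1)] by (auto simp: vpairs_def vH)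
    qed
  qed
  have GH: "emb f G H"
    by (rule embI[OF sG inj]) (use adjH simple_adjD[OF sG] in \<open>auto simp: vH\<close>)
  have HG: "emb (inv_into (verts G) f) H G"
  proof (rule embI[OF sH])
    show "inj_on (inv_into (verts G) f) (verts H)" by (simp add: vH inj_on_inv_into)
    show "inv_into (verts G) f ` verts H \<subseteq> verts G" by (auto simp: vH inj)
    fix a b assume ab: "adj H a b"
    then have "a \<in> f ` verts G" "b \<in> f ` verts G" using simple_adjD[OF sH ab] by (simp_all add: vH)
    then obtain u v where "a = f u" "b = f v" "u \<in> verts G" "v \<in> verts G" by blast
    then show "adj G (inv_into (verts G) f a) (inv_into (verts G) f b)" using ab adjH inj by simp
  qed
  have "saturated F H" unfolding saturated_def
  proof (intro conjI ballI sH)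
    show "\<not> contains H F" using nc contains_trans[OF _ HG] by blast
    fix e assume "e \<in> non_edges H"
    then obtain a b where e: "e = {a, b}" "a \<in> verts H" "b \<in> verts H" "a \<noteq> b" "\<not> adj H a b"
      by (rule non_edgeE)
    then obtain u v where uv: "a = f u" "b = f v" "u \<in> verts G" "v \<in> verts G" by (auto simp: vH)
    then have "{u, v} \<in> non_edges G" using e adjH by (auto simp: non_edge_iff)
    moreover have "emb f (add_edge G {u, v}) (add_edge H e)"
      using emb_add_edge[OF GH, of "{u, v}"] uv e(1) by simp
    ultimately show "contains (add_edge H e) F" using sat contains_trans by blast
  qed
  moreover have "card (verts H) = card (verts G)" by (simp add: vH card_image[OF inj])
  moreover have "copies H T n (\<lambda>i x. f (\<tau> i x))"
    unfolding copies_def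
  proof (intro conjI allI impI ballI)
    fix i assume i: "i < n"
    have im: "\<tau> i ` verts T \<subseteq> verts G" using copiesD(2)[OF C i] by blast
    show "inj_on (\<lambda>x. f (\<tau> i x)) (verts T)"
      using comp_inj_on[OF copiesD(1)[OF C i] inj_on_subset[OF inj im]] by (simp add: comp_def)
    show "(\<lambda>x. f (\<tau> i x)) ` verts T \<subseteq> verts H" using im by (auto simp: vH)
    show "(\<lambda>x. f (\<tau> i x)) ` verts T \<inter> (\<lambda>x. f (\<tau> k x)) ` verts T = {}" if k: "k < n" "i \<noteq> k" for k
    proof -
      have "f (\<tau> i x) \<noteq> f (\<tau> k x')" if "x \<in> verts T" "x' \<in> verts T" for x x'
        using copiesD(3)[OF C i k] copiesD(2)[OF C i that(1)] copiesD(2)[OF C k(1) that(2)] that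
          inj_on_eq_iff[OF inj] by (metis disjoint_iff imageI)
      then show ?thesis by blast
    qed
    fix x w assume x: "x \<in> verts T"
    have \<tau>x: "\<tau> i x \<in> verts G" using copiesD(2)[OF C i x] .
    show "adj H (f (\<tau> i x)) w \<longleftrightarrow> (\<exists>y\<in>verts T. w = f (\<tau> i y) \<and> adj T x y)"
    proof
      assume a: "adj H (f (\<tau> i x)) w"
      then obtain v where v: "v \<in> verts G" "w = f v" using simple_adjD(2)[OF sH a] by (auto simp: vH)
      then have "adj G (\<tau> i x) v" using a adjH[OF \<tau>x] by simp
      then show "\<exists>y\<in>verts T. w = f (\<tau> i y) \<and> adj T x y" using copiesD(4)[OF C i x] v(2) by blast
    next
      assume "\<exists>y\<in>verts T. w = f (\<tau> i y) \<and> adj T x y"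
      then obtain y where y: "y \<in> verts T" "w = f (\<tau> i y)" "adj T x y" by blast
      then show "adj H (f (\<tau> i x)) w"
        using copiesD(5)[OF C i x] adjH[OF \<tau>x copiesD(2)[OF C i y(1)]] by simp
    qed
  qed
  ultimately show ?thesis by blast
qed

subsection \<open>The saturation number\<close>

lemma sat_attained:
  assumes "edges F \<noteq> {}"
  obtains G :: "nat sgraph" where "saturated F G" "card (verts G) = n" "card (edges G) = sat n F"
proof -
  let ?G = "SGraph {..<n} {} :: nat sgraph"
  have "simple_graph ?G" "\<not> contains ?G F" using assms by (auto simp: simple_graph_def contains_def)
  then obtain G where G: "saturated F G" "verts G = verts ?G" by (rule extend_saturated)
  then have "\<exists>m. \<exists>G :: nat sgraph. saturated F G \<and> card (verts G) = n \<and> card (edges G) = m"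
    by (intro exI[of _ "card (edges G)"] exI[of _ G]) simp
  from LeastI_ex[OF this] show ?thesis using that unfolding sat_def by blast
qed

lemma sat_le: "saturated F (G :: nat sgraph) \<Longrightarrow> sat (card (verts G)) F \<le> card (edges G)"
  unfolding sat_def by (rule Least_le) blast

text \<open>Each tree component saves one edge. Those with more than \<open>J\<close> vertices are
  at most \<open>card (verts G) / (J + 1)\<close> many, and each smaller size contributes at most
  \<open>B\<close>. The factor \<open>J + 1\<close> keeps the inequality in the natural
  numbers.\<close>

lemma edges_lower_bound:
  assumes G: "simple_graph G" and B: "\<And>j. j \<le> J \<Longrightarrow> card {C \<in> tree_comps G. card C = j} \<le> B"
  shows "(J + 1) * card (verts G) \<le> (J + 1) * (card (edges G) + (J + 1) * B) + card (verts G)"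
proof -
  let ?T = "tree_comps G" and ?L = "{C \<in> tree_comps G. J < card C}"
  have TC: "?T \<subseteq> cset G ` verts G" by (auto simp: tree_comps_def)
  have finT: "finite ?T" using finite_subset[OF TC finite_csets[OF G]] .
  have "?T \<subseteq> (\<Union>j\<le>J. {C \<in> ?T. card C = j}) \<union> ?L" by auto
  then have "card ?T \<le> card ((\<Union>j\<le>J. {C \<in> ?T. card C = j}) \<union> ?L)"
    using finT by (intro card_mono) auto
  also have "\<dots> \<le> card (\<Union>j\<le>J. {C \<in> ?T. card C = j}) + card ?L" by (rule card_Un_le)
  also have "card (\<Union>j\<le>J. {C \<in> ?T. card C = j}) \<le> (\<Sum>j\<le>J. card {C \<in> ?T. card C = j})"
    by (rule card_UN_le) simp
  also have "\<dots> \<le> (J + 1) * B" using sum_bounded_above[of "{..J}" _ B] B by simp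
  finally have 1: "card ?T \<le> (J + 1) * B + card ?L" by simp
  have "(J + 1) * card ?L = (\<Sum>C\<in>?L. J + 1)" by simp
  also have "\<dots> \<le> (\<Sum>C\<in>?L. card C)" by (rule sum_mono) simp
  also have "\<dots> \<le> card (verts G)" using TC by (intro sum_tree_comps_le[OF G]) auto
  finally have 2: "(J + 1) * card ?L \<le> card (verts G)" .
  have "card (verts G) \<le> card (edges G) + ((J + 1) * B + card ?L)"
    using card_verts_le_tree_comps[OF G] 1 by linarith
  then have "(J + 1) * card (verts G) \<le> (J + 1) * (card (edges G) + (J + 1) * B + card ?L)"
    unfolding add.assoc by (rule mult_le_mono2)
  then show ?thesis using 2 by (simp add: algebra_simps)
qed

text \<open>Tree components of each size up to \<open>J\<close> are bounded in number: too many
  would yield \<open>card (verts F) + 2\<close> isomorphic ones, and their tree would be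
  good.\<close>

lemma no_good_tree_lower_bound:
  assumes F: "simple_graph F" "edges F \<noteq> {}"
    and no: "\<And>T :: nat sgraph. good_tree F T \<Longrightarrow> J < card (verts T)"
  shows "\<exists>C. \<forall>n. (J + 1) * n \<le> (J + 1) * (sat n F + C) + n"
proof (intro exI allI)
  fix n
  let ?M = "card (verts F) + 2"
  obtain G :: "nat sgraph" where G: "saturated F G" "card (verts G) = n" "card (edges G) = sat n F"
    using sat_attained[OF F(2)] .
  have sG: "simple_graph G" using G(1) by (simp add: saturated_def)
  have "card {C \<in> tree_comps G. card C = j} \<le> ?M * 2 ^ (J * J)" if j: "j \<le> J" for j
  proof (rule ccontr)
    assume "\<not> ?thesis"
    moreover have "?M * 2 ^ (j * j) \<le> ?M * 2 ^ (J * J)"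
      using j by (intro mult_le_mono2 power_increasing mult_le_mono) auto
    ultimately have "?M * 2 ^ (j * j) \<le> card {C \<in> tree_comps G. card C = j}" by linarith
    then obtain T :: "nat sgraph" and \<tau> where T: "is_tree T" "card (verts T) = j" "copies G T ?M \<tau>"
      using many_tree_comps[OF sG, of ?M j] by auto
    have "good_tree F T" using many_copies_good[OF F(1) G(1) T(1,3)] by simp
    with no T(2) j show False by fastforce
  qed
  from edges_lower_bound[OF sG this]
  show "(J + 1) * n \<le> (J + 1) * (sat n F + (J + 1) * (?M * 2 ^ (J * J))) + n" using G by simp
qed

lemma saturated_with_copies:
  assumes F: "simple_graph F" and T: "good_tree F (T :: nat sgraph)"
  shows "\<exists>(G :: nat sgraph) \<tau>. saturated F G \<and> card (verts G) mod card (verts T) = c mod card (verts T) \<and>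
    copies G T n \<tau>"
proof -
  let ?N = "new_verts F T" and ?r = "card (verts T)" and ?k = "card (verts F)"
  have Tne: "verts T \<noteq> {}" and finT: "finite (verts T)"
    using T by (auto simp: good_tree_def is_tree_def connected_graph_def simple_graph_def)
  then obtain s where s: "?r = Suc s" by (metis card_0_eq not0_implies_Suc)
  obtain v where "v \<in> verts T" using Tne by blast
  then have "contains_new_component (add_edge (double T) {Inl v, Inr v}) F T"
    using T by (simp add: good_tree_def)
  then have Nne: "?N \<noteq> {}" by (auto simp: contains_new_component_def components_of_eq new_verts_def)
  have "\<exists>(G :: hvert sgraph) \<tau>. saturated F G \<and> card (verts G) mod ?r = c mod ?r \<and> copies G T n \<tau>"
  proof (cases "\<exists>x\<in>?N. \<forall>u w. u \<in> cset F x \<longrightarrow> adj F u w \<longrightarrow> u = x \<or> w = x")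
    case True
    then obtain x where x: "x \<in> ?N" "\<And>u w. u \<in> cset F x \<Longrightarrow> adj F u w \<Longrightarrow> u = x \<or> w = x" by blast
    \<comment> \<open>Since \<open>s = card (verts T) - 1\<close>, the summand \<open>?q * s\<close>
      completes the \<open>?q\<close> clique vertices to a multiple of
      \<open>card (verts T)\<close>, leaving the residue of \<open>c\<close>. The last summand of
      \<open>?M\<close> pays for the copies spoiled by the core.\<close>
    let ?q = "card ?N - 1" let ?p = "c + ?q * s" let ?M = "2 * ?k + n + ?k * (?q + ?p)"
    obtain G :: "hvert sgraph" and \<tau> where "saturated F G" "card (verts G) = ?q + ?p + ?M * ?r" "copies G T n \<tau>"
      using host_saturated_star[OF F T x, where M = ?M and n = n and p = ?p] by auto
    moreover have "(?q + ?p + ?M * ?r) mod ?r = c mod ?r"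
    proof -
      have "q + (c + q * s) + M * ?r = c + (q + M) * ?r" for q M by (simp add: s algebra_simps)
      then have "?q + ?p + ?M * ?r = c + (?q + ?M) * ?r" .
      then show ?thesis by (simp only: mod_mult_self1)
    qed
    ultimately show ?thesis by metis
  next
    case False
    interpret star_free F T using F T Nne False by unfold_locales blast+
    \<comment> \<open>Again \<open>m + m * s\<close> is a multiple of \<open>?r\<close>; the last
      summand of \<open>?p\<close>, also a multiple, guarantees the number of leaves that the
      construction requires.\<close>
    let ?p = "c + m * s + ?r * (m * (?k + 1))" let ?M = "2 * ?k + n"
    have "m * (?k + 1) \<le> ?p" by (simp add: s)
    then obtain G :: "hvert sgraph" and \<tau> where "saturated F G" "card (verts G) = m + ?p + ?M * ?r" "copies G T n \<tau>"
      using host_saturated_star_free[where M = ?M and n = n and p = ?p] by auto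
    moreover have "(m + ?p + ?M * ?r) mod ?r = c mod ?r"
    proof -
      have "m + ?p + ?M * ?r = c + (m + m * (?k + 1) + ?M) * ?r" by (simp add: s algebra_simps)
      then show ?thesis by (simp only: mod_mult_self1)
    qed
    ultimately show ?thesis by metis
  qed
  then obtain G :: "hvert sgraph" and \<tau> where
    G: "saturated F G" "card (verts G) mod ?r = c mod ?r" "copies G T n \<tau>" by blast
  with saturated_nat_copy[OF G(1,3)] show ?thesis by metis
qed

section \<open>Growth along a residue class\<close>

lemma clone_nat:
  fixes G T :: "nat sgraph"
  assumes F: "simple_graph F" and G: "saturated F G" and T: "is_tree T"
    and C: "copies G T n \<tau>" and n: "card (verts F) + 2 \<le> n"
  obtains G' :: "nat sgraph" and \<tau>' where "saturated F G'" "copies G' T n \<tau>'"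
    "card (verts G') = card (verts G) + card (verts T)"
    "card (edges G') + 1 = card (edges G) + card (verts T)"
proof -
  have sT: "simple_graph T" using T by (simp add: is_tree_def)
  have "finite (verts G)" using G by (simp add: saturated_def simple_graph_def)
  then have "\<exists>K. \<forall>v\<in>verts G. v < K" by (simp only: finite_nat_set_iff_bounded)
  then obtain K where K: "\<And>v. v \<in> verts G \<Longrightarrow> v < K" by blast
  let ?\<sigma> = "\<lambda>x. K + x"
  have inj: "inj_on ?\<sigma> (verts T)" by (simp add: inj_on_def)
  have fresh: "?\<sigma> ` verts T \<inter> verts G = {}" using K by fastforce
  note c = clone_copy[OF F G sT C n inj fresh]
  show ?thesis
    by (rule that[OF c(1) copies_mono[OF c(2)] c(3)]) (use c(4) tree_card_edges[OF T] in simp_all)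
qed

text \<open>Every cloned tree brings one edge fewer than vertices; the term \<open>k\<close> on the
  left records this saving without subtraction.\<close>

lemma sat_along_class:
  fixes G T :: "nat sgraph"
  assumes F: "simple_graph F" and G: "saturated F G" and T: "is_tree T"
    and C: "copies G T n \<tau>" and n: "card (verts F) + 2 \<le> n"
  shows "sat (card (verts G) + k * card (verts T)) F + k \<le> card (edges G) + k * card (verts T)"
proof -
  have "\<exists>(G' :: nat sgraph) \<tau>'. saturated F G' \<and> copies G' T n \<tau>' \<and>
      card (verts G') = card (verts G) + k * card (verts T) \<and>
      card (edges G') + k = card (edges G) + k * card (verts T)"
  proof (induction k)
    case 0
    then show ?case using G C by auto
  next
    case (Suc k)
    then obtain G' :: "nat sgraph" and \<tau>' where G': "saturated F G'" "copies G' T n \<tau>'"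
      "card (verts G') = card (verts G) + k * card (verts T)"
      "card (edges G') + k = card (edges G) + k * card (verts T)" by blast
    obtain G2 :: "nat sgraph" and \<tau>2 where "saturated F G2" "copies G2 T n \<tau>2"
      "card (verts G2) = card (verts G') + card (verts T)"
      "card (edges G2) + 1 = card (edges G') + card (verts T)"
      by (rule clone_nat[OF F G'(1) T G'(2) n])
    with G'(3,4) show ?case by (intro exI[of _ G2] exI[of _ \<tau>2]) simp
  qed
  then obtain G' :: "nat sgraph" where G': "saturated F G'"
      "card (verts G') = card (verts G) + k * card (verts T)"
      "card (edges G') + k = card (edges G) + k * card (verts T)" by blast
  from sat_le[OF G'(1)] G'(2,3) show ?thesis by simp
qed

lemma eventually_constant_int:
  fixes a :: "nat \<Rightarrow> int"
  assumes "\<And>k. K \<le> k \<Longrightarrow> a (Suc k) \<le> a k" "\<And>k. L \<le> a k"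
  obtains v K' where "\<And>k. K' \<le> k \<Longrightarrow> a k = v"
proof -
  let ?P = "\<lambda>m. \<exists>k\<ge>K. nat (a k - L) = m"
  have "?P (LEAST m. ?P m)" by (rule LeastI_ex) auto
  then obtain K' where K': "K \<le> K'" "nat (a K' - L) = (LEAST m. ?P m)" by blast
  have "a k \<le> a K'" if "K' \<le> k" for k
    using that
  proof (induction k rule: dec_induct)
    case (step k)
    then show ?case using assms(1)[of k] K'(1) by linarith
  qed simp
  moreover have "a K' \<le> a k" if "K' \<le> k" for k
  proof -
    have "nat (a K' - L) \<le> nat (a k - L)" unfolding K'(2)
      by (rule Least_le) (use that K'(1) in \<open>auto intro: exI[of _ k]\<close>)
    then show ?thesis using assms(2)[of k] by linarith
  qed
  ultimately show ?thesis using that[of K' "a K'"] by (meson antisym)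
qed

lemma good_tree_linear:
  assumes F: "simple_graph F" "edges F \<noteq> {}" and T: "good_tree F (T :: nat sgraph)"
    and min: "\<And>T' :: nat sgraph. good_tree F T' \<Longrightarrow> card (verts T) \<le> card (verts T')"
  shows "sat_eventually_linear F (card (verts T))"
proof -
  define r where "r = card (verts T)"
  have treeT: "is_tree T" using T by (simp add: good_tree_def)
  have "verts T \<noteq> {}" "finite (verts T)"
    using treeT by (auto simp: is_tree_def connected_graph_def simple_graph_def)
  then have r: "1 \<le> r" by (simp add: r_def Suc_le_eq card_gt_0_iff)
  define e where "e n = int r * int (sat n F) - (int r - 1) * int n" for n
  let ?M = "card (verts F) + 2"
  \<comment> \<open>Good trees have at least \<open>r\<close> vertices, so \<open>J = r - 1\<close>
    is admissible; it makes \<open>e\<close> bounded below.\<close>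
  have "\<exists>C. \<forall>n. (r - 1 + 1) * n \<le> (r - 1 + 1) * (sat n F + C) + n"
  proof (rule no_good_tree_lower_bound[OF F])
    fix T' :: "nat sgraph" assume "good_tree F T'"
    with min[of T'] r show "r - 1 < card (verts T')" by (simp add: r_def)
  qed
  then obtain C where C: "\<And>n. r * n \<le> r * (sat n F + C) + n" using r by auto
  have lower: "- int r * int C \<le> e n" for n
  proof -
    have "int (r * n) \<le> int (r * (sat n F + C) + n)" using C[of n] by linarith
    then show ?thesis by (simp add: e_def algebra_simps)
  qed
  have step: "\<exists>N. \<forall>n\<ge>N. e n \<le> D \<longrightarrow> e (n + r) \<le> e n" for D
  proof (intro exI allI impI)
    let ?B = "?M * 2 ^ (r * r)"
    \<comment> \<open>The threshold results from eliminating \<open>sat n F\<close> between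
      \<open>e n \<le> D\<close> and the edge bound for \<open>J = r\<close>: the terms in
      \<open>n\<close> cancel except for a single \<open>n\<close>.\<close>
    fix n assume n: "nat (int (r + 1) * \<bar>D\<bar> + int (r * (r + 1) * (r + 1) * ?B)) + 1 \<le> n" and D: "e n \<le> D"
    obtain G :: "nat sgraph" where G: "saturated F G" "card (verts G) = n" "card (edges G) = sat n F"
      using sat_attained[OF F(2)] .
    have sG: "simple_graph G" using G(1) by (simp add: saturated_def)
    have "\<exists>j\<le>r. ?B < card {C \<in> tree_comps G. card C = j}"
    proof (rule ccontr)
      assume "\<not> ?thesis"
      then have "(r + 1) * n \<le> (r + 1) * (sat n F + (r + 1) * ?B) + n"
        using edges_lower_bound[OF sG, of r ?B] G(2,3) by (simp add: not_less)
      then have "int r * int ((r + 1) * n) \<le> int r * int ((r + 1) * (sat n F + (r + 1) * ?B) + n)"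
        by (intro mult_left_mono) (auto simp only: of_nat_le_iff of_nat_0_le_iff)
      moreover have "int (r + 1) * (int r * int (sat n F)) \<le> int (r + 1) * (D + (int r - 1) * int n)"
        using D by (intro mult_left_mono) (auto simp: e_def)
      ultimately have "int n \<le> int (r + 1) * D + int (r * (r + 1) * (r + 1) * ?B)"
        by (simp add: algebra_simps)
      also have "\<dots> \<le> int (r + 1) * \<bar>D\<bar> + int (r * (r + 1) * (r + 1) * ?B)"
        by (intro add_right_mono mult_left_mono) auto
      finally show False using n by linarith
    qed
    then obtain j where j: "j \<le> r" "?B < card {C \<in> tree_comps G. card C = j}" by blast
    have "?M * 2 ^ (j * j) \<le> ?B"
      using j(1) by (intro mult_le_mono2 power_increasing mult_le_mono) auto
    then have "?M * 2 ^ (j * j) \<le> card {C \<in> tree_comps G. card C = j}" using j(2) by linarith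
    then obtain T' :: "nat sgraph" and \<tau> where T': "is_tree T'" "card (verts T') = j" "copies G T' ?M \<tau>"
      using many_tree_comps[OF sG, of ?M j] by auto
    have "good_tree F T'" using many_copies_good[OF F(1) G(1) T'(1,3)] by simp
    \<comment> \<open>\<open>T'\<close> may differ from \<open>T\<close>, but minimality forces it
      to have \<open>r\<close> vertices, so cloning it stays in the residue class.\<close>
    from min[OF this] T'(2) j(1) have "card (verts T') = r" by (simp add: r_def)
    then have "sat (n + r) F + 1 \<le> sat n F + r"
      using sat_along_class[OF F(1) G(1) T'(1,3), of 1] G(2,3) by simp
    then have "int r * int (sat (n + r) F + 1) \<le> int r * int (sat n F + r)"
      by (intro mult_left_mono) (auto simp only: of_nat_le_iff of_nat_0_le_iff)
    then show "e (n + r) \<le> e n" by (simp add: e_def algebra_simps)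
  qed
  have "\<exists>k. \<exists>N. \<forall>n\<ge>N. n mod r = c \<longrightarrow> e n = k" if c: "c < r" for c
  proof -
    obtain G :: "nat sgraph" and \<tau> where G: "saturated F G" "card (verts G) mod r = c" "copies G T ?M \<tau>"
      using saturated_with_copies[OF F(1) T, of c ?M] c by (auto simp: r_def)
    \<comment> \<open>\<open>?D\<close> is the scaled deviation of \<open>G\<close> from the line;
      cloning \<open>T\<close> leaves it unchanged, so it bounds \<open>e\<close> along the whole
      class.\<close>
    let ?n = "card (verts G)" and ?D = "int r * int (card (edges G)) - (int r - 1) * int (card (verts G))"
    have upper: "e (?n + k * r) \<le> ?D" for k
    proof -
      have "sat (?n + k * r) F + k \<le> card (edges G) + k * r"
        using sat_along_class[OF F(1) G(1) treeT G(3), of k] by (simp add: r_def)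
      then have "int r * int (sat (?n + k * r) F + k) \<le> int r * int (card (edges G) + k * r)"
        by (intro mult_left_mono) (auto simp only: of_nat_le_iff of_nat_0_le_iff)
      then show ?thesis by (simp add: e_def algebra_simps)
    qed
    obtain N where N: "\<And>n. N \<le> n \<Longrightarrow> e n \<le> ?D \<Longrightarrow> e (n + r) \<le> e n" using step[of ?D] by blast
    have dec: "e (?n + Suc k * r) \<le> e (?n + k * r)" if "N \<le> k" for k
    proof -
      have "k * 1 \<le> k * r" using r by (intro mult_le_mono) auto
      then have "N \<le> ?n + k * r" using that by linarith
      from N[OF this upper] show ?thesis by (simp add: algebra_simps)
    qed
    obtain v K where K: "\<And>k. K \<le> k \<Longrightarrow> e (?n + k * r) = v"
      using eventually_constant_int[of N "\<lambda>k. e (?n + k * r)", OF dec lower] by blast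
    have "e n = v" if n: "?n + K * r \<le> n" "n mod r = c" for n
    proof -
      have "r dvd n - ?n" using n G(2) mod_eq_dvd_iff_nat[of ?n n r] by simp
      then obtain k where k: "n - ?n = k * r" by (metis dvdE mult.commute)
      then have "K * r \<le> k * r" using n(1) by linarith
      then have "K \<le> k" using r by simp
      moreover have "n = ?n + k * r" using k n(1) by linarith
      ultimately show ?thesis using K by simp
    qed
    then show ?thesis by blast
  qed
  then have "\<forall>c. \<exists>k. c < r \<longrightarrow> (\<exists>N. \<forall>n\<ge>N. n mod r = c \<longrightarrow> e n = k)" by blast
  then obtain k where k: "\<And>c. c < r \<Longrightarrow> \<exists>N. \<forall>n\<ge>N. n mod r = c \<longrightarrow> e n = k c" by metis
  have conv: "real (sat n F) = ((real r - 1) * real n + real_of_int v) / real r" if "e n = v" for n v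
  proof -
    have "real_of_int (int r * int (sat n F)) = real_of_int (v + (int r - 1) * int n)"
      using that[symmetric] unfolding e_def by simp
    then have "real r * real (sat n F) = (real r - 1) * real n + real_of_int v" by simp
    then show ?thesis using r by (simp add: field_simps)
  qed
  show ?thesis unfolding sat_eventually_linear_def r_def[symmetric]
  proof (intro exI[of _ k] allI impI)
    fix c assume "c < r"
    from k[OF this] obtain N where "\<forall>n\<ge>N. n mod r = c \<longrightarrow> e n = k c" by blast
    then show "\<exists>N. \<forall>n\<ge>N. n mod r = c \<longrightarrow>
        real (sat n F) = ((real r - 1) * real n + real_of_int (k c)) / real r"
      using conv by (intro exI[of _ N]) simp
  qed
qed

lemma no_good_tree_at_least_n:
  assumes F: "simple_graph F" "edges F \<noteq> {}" and no: "\<nexists>T :: nat sgraph. good_tree F T"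
  shows "sat_at_least_n F"
  unfolding sat_at_least_n_def
proof (intro exI conjI allI)
  \<comment> \<open>Only the shortfall of \<open>sat n F\<close> below \<open>n\<close> has to be of
    lower order; any excess is cut off.\<close>
  let ?g = "\<lambda>n. min 0 (real (sat n F) - real n)"
  show "real n + ?g n \<le> real (sat n F)" for n by simp
  show "?g \<in> o(\<lambda>n. real n)"
  proof (rule landau_o.smallI)
    fix c :: real assume c: "0 < c"
    \<comment> \<open>Half of \<open>c\<close> absorbs the term \<open>n / (J + 1)\<close>, the
      other half the constant \<open>C\<close>.\<close>
    obtain J :: nat where J: "2 / c < real J" using reals_Archimedean2 by blast
    obtain C where C: "\<And>n. (J + 1) * n \<le> (J + 1) * (sat n F + C) + n"
      using no_good_tree_lower_bound[OF F, of J] no by blast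
    have "norm (?g n) \<le> c * norm (real n)" if n: "2 * real C / c \<le> real n" for n
    proof -
      have "real ((J + 1) * n) \<le> real ((J + 1) * (sat n F + C) + n)" using C[of n] by linarith
      then have "(real J + 1) * (real n - real (sat n F)) \<le> (real J + 1) * real C + real n"
        by (simp add: algebra_simps)
      then have "real n - real (sat n F) \<le> real C + real n / (real J + 1)"
        by (simp add: field_simps)
      moreover have "real C \<le> c / 2 * real n" using n c by (simp add: field_simps)
      moreover have "real n / (real J + 1) \<le> c / 2 * real n"
      proof -
        have "2 \<le> c * (real J + 1)" using J c by (simp add: field_simps)
        then have "2 * real n \<le> c * (real J + 1) * real n" by (intro mult_right_mono) auto
        then show ?thesis by (simp add: field_simps)
      qed
      ultimately have "real n - real (sat n F) \<le> c * real n" by linarith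
      then show ?thesis using c by (auto simp: min_def)
    qed
    moreover have "eventually (\<lambda>n. 2 * real C / c \<le> real n) sequentially"
      using filterlim_real_sequentially by (simp add: filterlim_at_top)
    ultimately show "eventually (\<lambda>n. norm (?g n) \<le> c * norm (real n)) sequentially"
      by (auto elim: eventually_mono)
  qed
qed

section \<open>The growth rate determines \<open>r\<close>\<close>

lemma linear_zero_class:
  assumes "sat_eventually_linear F r" "1 \<le> r"
  obtains k :: int and N where
    "\<And>n. N \<le> n \<Longrightarrow> r dvd n \<Longrightarrow> real r * real (sat n F) = (real r - 1) * real n + real_of_int k"
proof -
  obtain k :: "nat \<Rightarrow> int" where "\<forall>c<r. \<exists>N. \<forall>n\<ge>N. n mod r = c \<longrightarrow>
      real (sat n F) = ((real r - 1) * real n + real_of_int (k c)) / real r"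
    using assms(1) unfolding sat_eventually_linear_def by blast
  moreover have "0 < r" using assms(2) by simp
  ultimately obtain N where N: "\<And>n. N \<le> n \<Longrightarrow> n mod r = 0 \<Longrightarrow>
      real (sat n F) = ((real r - 1) * real n + real_of_int (k 0)) / real r" by blast
  show ?thesis
  proof (rule that[of N "k 0"])
    fix n assume "N \<le> n" "r dvd n"
    then have "real (sat n F) = ((real r - 1) * real n + real_of_int (k 0)) / real r"
      using N[of n] by (simp add: dvd_eq_mod_eq_0)
    then show "real r * real (sat n F) = (real r - 1) * real n + real_of_int (k 0)"
      using \<open>0 < r\<close> by simp
  qed
qed

text \<open>On large common multiples of \<open>r\<close> and \<open>s\<close> both formulas hold
  and make \<open>(r - s) * n\<close> constant; comparing two such \<open>n\<close> at distance
  \<open>r * s\<close> forces equality.\<close>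

lemma linear_slope_unique:
  assumes r: "sat_eventually_linear F r" "1 \<le> r" and s: "sat_eventually_linear F s" "1 \<le> s"
  shows "r = s"
proof -
  obtain k N where k: "\<And>n. N \<le> n \<Longrightarrow> r dvd n \<Longrightarrow> real r * real (sat n F) = (real r - 1) * real n + real_of_int k"
    using linear_zero_class[OF r] by metis
  obtain l N' where l: "\<And>n. N' \<le> n \<Longrightarrow> s dvd n \<Longrightarrow> real s * real (sat n F) = (real s - 1) * real n + real_of_int l"
    using linear_zero_class[OF s] by metis
  have key: "(real r - real s) * real n = real r * real_of_int l - real s * real_of_int k"
    if "N \<le> n" "N' \<le> n" "r dvd n" "s dvd n" for n
  proof -
    have "real s * (real r * real (sat n F)) = real r * (real s * real (sat n F))" by simp
    then have "real s * ((real r - 1) * real n + real_of_int k) = real r * ((real s - 1) * real n + real_of_int l)"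
      using k l that by simp
    then show ?thesis by (simp add: algebra_simps)
  qed
  let ?n = "r * s * (N + N')"
  have ge: "N + N' \<le> ?n" using r(2) s(2) by simp
  have "(real r - real s) * real ?n = (real r - real s) * real (?n + r * s)"
    using key[of ?n] key[of "?n + r * s"] ge by simp
  then have "(real r - real s) * (real r * real s) = 0" by (auto simp: algebra_simps)
  with r(2) s(2) show ?thesis by auto
qed

text \<open>With slope \<open>1 - 1 / r\<close> the deficit against \<open>n\<close> is about
  \<open>n / r\<close>, whereas \<open>g\<close> eventually allows at most
  \<open>n / (2 * r)\<close>.\<close>

lemma linear_not_at_least_n:
  assumes r: "sat_eventually_linear F r" "1 \<le> r"
  shows "\<not> sat_at_least_n F"
proof
  assume "sat_at_least_n F"
  then obtain g :: "nat \<Rightarrow> real" where g: "g \<in> o(\<lambda>n. real n)" "\<And>n. real n + g n \<le> real (sat n F)"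
    unfolding sat_at_least_n_def by blast
  obtain k N where k: "\<And>n. N \<le> n \<Longrightarrow> r dvd n \<Longrightarrow> real r * real (sat n F) = (real r - 1) * real n + real_of_int k"
    using linear_zero_class[OF r] by metis
  have "eventually (\<lambda>n. norm (g n) \<le> 1 / (2 * real r) * norm (real n)) sequentially"
    using landau_o.smallD[OF g(1), of "1 / (2 * real r)"] r(2) by simp
  then obtain N' where N': "\<And>n. N' \<le> n \<Longrightarrow> \<bar>g n\<bar> \<le> 1 / (2 * real r) * real n"
    unfolding eventually_sequentially by auto
  let ?n = "r * (N + N' + nat (2 * \<bar>k\<bar>) + 1)"
  have "1 * x \<le> r * x" for x using r(2) by (rule mult_le_mono1)
  then have ge: "N + N' + nat (2 * \<bar>k\<bar>) + 1 \<le> ?n" by (simp only: mult_1)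
  have "real r * \<bar>g ?n\<bar> \<le> real r * (1 / (2 * real r) * real ?n)"
    using N'[of ?n] ge by (intro mult_left_mono) auto
  also have "\<dots> = real ?n / 2" using r(2) by (simp add: field_simps)
  finally have 1: "real r * \<bar>g ?n\<bar> \<le> real ?n / 2" .
  have "real r * (real ?n + g ?n) \<le> real r * real (sat ?n F)" using g(2)[of ?n] by (intro mult_left_mono) auto
  also have "\<dots> = (real r - 1) * real ?n + real_of_int k" using k[of ?n] ge by simp
  finally have "real ?n + real r * g ?n \<le> real_of_int k" by (simp add: algebra_simps)
  moreover have "real r * (- \<bar>g ?n\<bar>) \<le> real r * g ?n" by (intro mult_left_mono) auto
  ultimately have "real ?n \<le> 2 * real_of_int k" using 1 by simp
  moreover have "2 * real_of_int k < real ?n"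
  proof -
    have "2 * k < int ?n" using ge by linarith
    then have "real_of_int (2 * k) < real_of_int (int ?n)" by (simp only: of_int_less_iff)
    then show ?thesis by simp
  qed
  ultimately show False by simp
qed

theorem theorem3:
  fixes F :: "'a sgraph"
  assumes "simple_graph F" and "edges F \<noteq> {}"
  shows "((\<exists>r\<ge>1. sat_eventually_linear F r) \<or> sat_at_least_n F) \<and>
         \<not> ((\<exists>r\<ge>1. sat_eventually_linear F r) \<and> sat_at_least_n F) \<and>
         ((\<exists>r\<ge>1. sat_eventually_linear F r) \<longleftrightarrow> (\<exists>T :: nat sgraph. good_tree F T)) \<and>
         (\<forall>r\<ge>1. sat_eventually_linear F r \<longrightarrow>
            (\<exists>T :: nat sgraph. good_tree F T \<and> card (verts T) = r) \<and>
            (\<forall>T :: nat sgraph. good_tree F T \<longrightarrow> r \<le> card (verts T)))"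
proof (cases "\<exists>T :: nat sgraph. good_tree F T")
  case True
  then obtain T :: "nat sgraph" where T: "good_tree F T"
    and min: "\<And>T' :: nat sgraph. good_tree F T' \<Longrightarrow> card (verts T) \<le> card (verts T')"
    using ex_has_least_nat[of "good_tree F" _ "\<lambda>T. card (verts T)"] by blast
  have lin: "sat_eventually_linear F (card (verts T))" using good_tree_linear[OF assms T min] .
  have "verts T \<noteq> {}" "finite (verts T)"
    using T by (auto simp: good_tree_def is_tree_def connected_graph_def simple_graph_def)
  then have r: "1 \<le> card (verts T)" by (simp add: Suc_le_eq card_gt_0_iff)
  \<comment> \<open>Uniqueness of the slope identifies every admissible \<open>r\<close> with the
    size of a smallest good tree, which yields the last clause.\<close>
  have "r = card (verts T)" if "sat_eventually_linear F r" "1 \<le> r" for r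
    using linear_slope_unique[OF that lin r] .
  with T min lin r linear_not_at_least_n[OF lin r] show ?thesis by metis
next
  case False
  with no_good_tree_at_least_n[OF assms] linear_not_at_least_n show ?thesis by blast
qed

end
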